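(* Let $K$ be a number field, $\overline{K}$ an algebraic closure of $K$, and $E/K$ an elliptic curve over $K$ with a $K$-rational point $P$ such that $2P\neq O$ and $3P\neq O$. Then for each $\sigma\in Gal(\overline{K}/K)$, the Mordell–Weil group $E(\overline{K}^{\sigma})$ has infinite rank.
   Context: $\overline{K}^{\sigma}$ denotes the subfield of $\overline{K}$ fixed by $\sigma$; $O$ is the identity of $E$. *)

theory Defs
  imports
    Complex_Main
    "HOL-Library.Extended_Nat"
    "HOL-Computational_Algebra.Polynomial"
    "HOL-Algebra.FiniteProduct"
begin

section \<open>Number fields inside an algebraic closure\<close>

text \<open>
  The algebraic closure is the whole of a type \<open>'a\<close> of class \<open>alg_closed_field\<close>; its subfields,
  in particular the number field \<open>K\<close>, are subsets of \<open>'a\<close>.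
\<close>

definition is_subfield :: "'a::field set \<Rightarrow> bool" where
  "is_subfield K \<longleftrightarrow>
     0 \<in> K \<and> 1 \<in> K \<and>
     (\<forall>x\<in>K. \<forall>y\<in>K. x + y \<in> K \<and> x * y \<in> K) \<and>
     (\<forall>x\<in>K. - x \<in> K \<and> inverse x \<in> K)"

definition number_field :: "'a::field_char_0 set \<Rightarrow> bool" where
  "number_field K \<longleftrightarrow>
     is_subfield K \<and>
     (\<exists>B. finite B \<and> K = module.span (\<lambda>(q::rat) x. of_rat q * x) B)"

text \<open>
  Algebraicity over \<open>K\<close> of every element of the type. Together with the class
  \<open>alg_closed_field\<close> this says that the type is an algebraic closure of \<open>K\<close>.
\<close>

definition algebraic_extension :: "'a::field set \<Rightarrow> bool" where
  "algebraic_extension K \<longleftrightarrow>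
     (\<forall>x::'a. \<exists>p. p \<noteq> 0 \<and> (\<forall>i. coeff p i \<in> K) \<and> poly p x = 0)"

definition galois_group :: "'a::field set \<Rightarrow> ('a \<Rightarrow> 'a) set" where
  "galois_group K =
     {\<sigma>. bij \<sigma> \<and> \<sigma> 1 = 1 \<and>
         (\<forall>x y. \<sigma> (x + y) = \<sigma> x + \<sigma> y) \<and>
         (\<forall>x y. \<sigma> (x * y) = \<sigma> x * \<sigma> y) \<and>
         (\<forall>x\<in>K. \<sigma> x = x)}"

definition fixed_field :: "('a \<Rightarrow> 'a) \<Rightarrow> 'a set" where
  "fixed_field \<sigma> = {x. \<sigma> x = x}"


section \<open>Elliptic curves in Weierstrass form\<close>

text \<open>
  The curve \<open>y\<^sup>2 + a\<^sub>1xy + a\<^sub>3y = x\<^sup>3 + a\<^sub>2x\<^sup>2 + a\<^sub>4x + a\<^sub>6\<close>. The only point at infinity is the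
  identity \<open>O\<close> of the group law.
\<close>

record 'a weierstrass_curve =
  a1 :: 'a
  a2 :: 'a
  a3 :: 'a
  a4 :: 'a
  a6 :: 'a

datatype 'a point = Infinity | Affine 'a 'a

definition discriminant :: "'a::field weierstrass_curve \<Rightarrow> 'a" where
  "discriminant E =
     (let b2 = (a1 E)\<^sup>2 + 4 * a2 E;
          b4 = 2 * a4 E + a1 E * a3 E;
          b6 = (a3 E)\<^sup>2 + 4 * a6 E;
          b8 = (a1 E)\<^sup>2 * a6 E + 4 * a2 E * a6 E - a1 E * a3 E * a4 E
               + a2 E * (a3 E)\<^sup>2 - (a4 E)\<^sup>2
      in - b2\<^sup>2 * b8 - 8 * b4 ^ 3 - 27 * b6\<^sup>2 + 9 * b2 * b4 * b6)"

definition elliptic_curve_over :: "'a::field set \<Rightarrow> 'a weierstrass_curve \<Rightarrow> bool" where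
  "elliptic_curve_over K E \<longleftrightarrow>
     {a1 E, a2 E, a3 E, a4 E, a6 E} \<subseteq> K \<and> discriminant E \<noteq> 0"

definition rational_points :: "'a::field weierstrass_curve \<Rightarrow> 'a set \<Rightarrow> 'a point set" where
  "rational_points E L =
     insert Infinity
       {Affine x y | x y. x \<in> L \<and> y \<in> L \<and>
          y\<^sup>2 + a1 E * x * y + a3 E * y = x ^ 3 + a2 E * x\<^sup>2 + a4 E * x + a6 E}"

text \<open>
  Chord and tangent law: \<open>l\<close> is the slope of the line through the two points, or of the tangent
  line if they coincide; the third intersection point is then negated. The inverse of
  \<open>(x, y)\<close> is \<open>(x, - y - a\<^sub>1x - a\<^sub>3)\<close>, which explains the case where the sum is \<open>O\<close>.
\<close>

fun point_add :: "'a::field weierstrass_curve \<Rightarrow> 'a point \<Rightarrow> 'a point \<Rightarrow> 'a point" where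
  "point_add E Infinity Q = Q"
| "point_add E P Infinity = P"
| "point_add E (Affine x1 y1) (Affine x2 y2) =
     (if x1 = x2 \<and> y1 + y2 + a1 E * x2 + a3 E = 0 then Infinity
      else
        let l = (if x1 = x2
                 then (3 * x1\<^sup>2 + 2 * a2 E * x1 + a4 E - a1 E * y1) / (2 * y1 + a1 E * x1 + a3 E)
                 else (y2 - y1) / (x2 - x1));
            x3 = l\<^sup>2 + a1 E * l - a2 E - x1 - x2
        in Affine x3 (- (l + a1 E) * x3 - (y1 - l * x1) - a3 E))"

definition mordell_weil_group :: "'a::field weierstrass_curve \<Rightarrow> 'a set \<Rightarrow> 'a point monoid" where
  "mordell_weil_group E L =
     \<lparr>carrier = rational_points E L, monoid.mult = point_add E, one = Infinity\<rparr>"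


section \<open>Rank of an abelian group\<close>

text \<open>
  Groups are written multiplicatively, so an integral linear combination \<open>\<Sum> c s \<cdot> s\<close> appears as a
  product of powers. Torsion elements are never part of an independent set.
\<close>

definition int_independent :: "('g, 'm) monoid_scheme \<Rightarrow> 'g set \<Rightarrow> bool" where
  "int_independent G S \<longleftrightarrow>
     (\<forall>c :: 'g \<Rightarrow> int. finprod G (\<lambda>s. s [^]\<^bsub>G\<^esub> c s) S = \<one>\<^bsub>G\<^esub> \<longrightarrow> (\<forall>s\<in>S. c s = 0))"

definition abelian_rank :: "('g, 'm) monoid_scheme \<Rightarrow> enat" where
  "abelian_rank G =
     (SUP S \<in> {S. finite S \<and> S \<subseteq> carrier G \<and> int_independent G S}. enat (card S))"

end

theory Submission
  imports Defs "HOL-Algebra.Ideal_Product" "HOL-Computational_Algebra.Primes" "HOL-Algebra.Generated_Groups"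
begin

text \<open>
  Moving \<open>P\<close> to the origin with horizontal tangent brings \<open>E\<close> into the form
  \<open>y\<^sup>2 + a\<^sub>1xy + cy = x\<^sup>3 + a\<^sub>2x\<^sup>2\<close>, where \<open>c \<noteq> 0\<close> because \<open>2P \<noteq> O\<close> and \<open>a\<^sub>2 \<noteq> 0\<close> because \<open>3P \<noteq> O\<close>. A
  line \<open>y = sx + m\<close> meets \<open>E\<close> in the roots of a cubic of discriminant \<open>\<Delta>(s, m)\<close>; for \<open>m = 0\<close> the line
  passes through \<open>P\<close> and the two other intersections are the roots of a quadratic of discriminant
  \<open>d(s)\<close>. The genus one curve \<open>d(s)\<Delta>(s, m) = W\<^sup>2\<close> has a rational point at \<open>m = 0\<close>, and the osculating
  parabola there yields a second one, with \<open>m = m(s)\<close> rational in \<open>s\<close>. So for each \<open>s\<close> in \<open>K\<close>, either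
  \<open>\<sigma>\<close> fixes \<open>\<surd>d(s)\<close>, and the line through \<open>P\<close> meets \<open>E\<close> in points fixed by \<open>\<sigma>\<close>, or \<open>\<sigma>\<close> permutes the
  roots of the cubic for \<open>m(s)\<close> oddly and hence fixes one of them.

  If the rank were finite, all points over the fixed field would have a nonzero multiple over one
  field \<open>F = \<rat>(\<theta>)\<close>. Let \<open>s\<close> be an odd integer divided by a large power of two, chosen so that at one
  degree-one place of \<open>F\<close> the valuation of \<open>d(s)\<close> is odd and at another the pole order of \<open>m(s)\<close> is
  prime to three. Then neither the quadratic nor the cubic has a root in \<open>F\<close>, so the conjugates over
  \<open>F\<close> of the fixed point share a multiple with it. In the cubic case the three conjugates add up to
  \<open>O\<close>, so they are torsion; but \<open>s\<close> is large at a place above two, hence so is the abscissa of one of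
  them, and the duplication formula shows that such a point is not torsion. In the quadratic case
  \<open>2Q\<close> and \<open>- P\<close> agree up to torsion for the fixed point \<open>Q\<close>; subtracting the points obtained from two values of
  \<open>s\<close> of different dyadic size gives a torsion point with a large abscissa, again a contradiction.
\<close>

section \<open>The group law\<close>

text \<open>The product of \<open>d\<close> and the discriminant couples two coverings:
  \<open>\<sigma>\<close> acts by the same sign on both square roots, so where it moves
  \<open>\<surd>d\<close> it permutes the three roots oddly, and a fixed point exists for either
  sign. The rational point at \<open>m = 0\<close> comes from the value
  \<open>c\<^sup>2 s\<^sup>2 d\<close> of the discriminant there. The obstacle is that finite rank
  yields a field \<open>F\<close> over which there is no control. Hence \<open>s\<close> is chosen
  after \<open>F\<close>, and it is a rational number so that it lies in \<open>K\<close> whatever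
  \<open>K\<close> is. Places of degree one serve because a rational number has to approach an
  algebraic zero or pole to order exactly one. Torsion has to be excluded over the whole algebraic
  closure, since the conjugates of the fixed point lie in no prescribed field. The two-adic place is
  therefore a valuation ring of the closure; it is not discrete and is handled through membership.
  The demands on \<open>s\<close> do not interfere: the numerator is controlled modulo odd primes,
  the denominator is a power of two.\<close>

text \<open>
  Associativity is derived from the injection of the points of \<open>y\<^sup>2 = f(x)\<close> into the ideal class group
  of the coordinate ring; the pair \<open>(u, v)\<close> stands for \<open>u + v y\<close>, and \<open>conorm\<close> is its norm.
\<close>

definition coord_ring :: "'a::field poly \<Rightarrow> ('a poly \<times> 'a poly) ring" where
  "coord_ring f = \<lparr>carrier = UNIV,
     monoid.mult = (\<lambda>u v. (fst u * fst v + snd u * snd v * f, fst u * snd v + snd u * fst v)),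
     one = (1, 0), zero = (0, 0), add = (\<lambda>u v. (fst u + fst v, snd u + snd v))\<rparr>"

lemma coord_ring_simps [simp]:
  "carrier (coord_ring f) = UNIV" "\<one>\<^bsub>coord_ring f\<^esub> = (1, 0)" "\<zero>\<^bsub>coord_ring f\<^esub> = (0, 0)"
  by (simp_all add: coord_ring_def)

lemma coord_ring_ops:
  "u \<otimes>\<^bsub>coord_ring f\<^esub> v = (fst u * fst v + snd u * snd v * f, fst u * snd v + snd u * fst v)"
  "u \<oplus>\<^bsub>coord_ring f\<^esub> v = (fst u + fst v, snd u + snd v)"
  by (simp_all add: coord_ring_def)

lemma cring_coord_ring: "cring (coord_ring f)"
proof (intro cringI abelian_groupI comm_monoidI)
  fix x :: "'a poly \<times> 'a poly"
  show "\<exists>y\<in>carrier (coord_ring f). y \<oplus>\<^bsub>coord_ring f\<^esub> x = \<zero>\<^bsub>coord_ring f\<^esub>"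
    by (rule bexI[of _ "(- fst x, - snd x)"]) (auto simp: coord_ring_ops)
qed (auto simp: coord_ring_ops algebra_simps)

definition conorm :: "'a::field poly \<Rightarrow> 'a poly \<times> 'a poly \<Rightarrow> 'a poly" where
  "conorm f u = (fst u)\<^sup>2 - (snd u)\<^sup>2 * f"

lemma conorm_mult: "conorm f (u \<otimes>\<^bsub>coord_ring f\<^esub> v) = conorm f u * conorm f v"
  by (simp add: coord_ring_ops conorm_def power2_eq_square algebra_simps)

text \<open>The square has even degree and \<open>(snd u)\<^sup>2 * f\<close> has odd degree, so
  their leading terms never cancel. An element whose norm has degree below 3 is therefore a
  polynomial in \<open>x\<close> alone; this gap is what keeps the ideal of an affine point from
  being principal.\<close>

lemma degree_conorm:
  assumes "degree f = 3"
  shows "snd u \<noteq> 0 \<Longrightarrow> degree (conorm f u) \<ge> 3 + 2 * degree (snd u) \<and> conorm f u \<noteq> 0"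
    and "snd u = 0 \<Longrightarrow> degree (conorm f u) = 2 * degree (fst u)"
proof -
  have f0: "f \<noteq> 0" using assms by auto
  show "degree (conorm f u) = 2 * degree (fst u)" if "snd u = 0"
    using that by (cases "fst u = 0") (simp_all add: conorm_def degree_power_eq)
  assume b: "snd u \<noteq> 0"
  have db: "degree ((snd u)\<^sup>2 * f) = 3 + 2 * degree (snd u)"
    using b f0 assms by (simp add: degree_mult_eq degree_power_eq)
  have da: "degree ((fst u)\<^sup>2) = 2 * degree (fst u)"
    by (cases "fst u = 0") (simp_all add: degree_power_eq)
  show "degree (conorm f u) \<ge> 3 + 2 * degree (snd u) \<and> conorm f u \<noteq> 0"
  proof (cases "degree ((fst u)\<^sup>2) < degree ((snd u)\<^sup>2 * f)")
    case True
    then have "degree (conorm f u) = degree ((snd u)\<^sup>2 * f)"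
      using degree_add_eq_right[of "(fst u)\<^sup>2" "- ((snd u)\<^sup>2 * f)"] by (simp add: conorm_def)
    with db show ?thesis by auto
  next
    case False
    have "2 * degree (fst u) \<noteq> 3 + 2 * degree (snd u)" by presburger
    with False da db have "degree ((snd u)\<^sup>2 * f) < degree ((fst u)\<^sup>2)" by linarith
    then have "degree (conorm f u) = degree ((fst u)\<^sup>2)"
      using degree_add_eq_left[of "- ((snd u)\<^sup>2 * f)" "(fst u)\<^sup>2"] by (simp add: conorm_def)
    with False db show ?thesis by auto
  qed
qed

lemma conorm_eq_0:
  assumes "degree f = 3" and "conorm f u = 0"
  shows "u = (0, 0)"
proof -
  have "snd u = 0" using degree_conorm(1)[OF assms(1), of u] assms(2) by blast
  with assms(2) show ?thesis by (simp add: conorm_def prod_eq_iff)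
qed

section \<open>Ideals of points and the class relation\<close>

definition eval_at :: "'a::field \<Rightarrow> 'a \<Rightarrow> 'a poly \<times> 'a poly \<Rightarrow> 'a" where
  "eval_at x y u = poly (fst u) x + poly (snd u) x * y"

fun point_ideal :: "'a::field point \<Rightarrow> ('a poly \<times> 'a poly) set" where
  "point_ideal Infinity = UNIV"
| "point_ideal (Affine x y) = {u. eval_at x y u = 0}"

lemma eval_at_mult:
  "poly f x = y\<^sup>2 \<Longrightarrow> eval_at x y (u \<otimes>\<^bsub>coord_ring f\<^esub> v) = eval_at x y u * eval_at x y v"
  by (simp add: coord_ring_ops eval_at_def power2_eq_square algebra_simps)

fun point_neg :: "'a::field weierstrass_curve \<Rightarrow> 'a point \<Rightarrow> 'a point" where
  "point_neg E Infinity = Infinity"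
| "point_neg E (Affine x y) = Affine x (- y - a1 E * x - a3 E)"

definition on_curve :: "'a::field weierstrass_curve \<Rightarrow> 'a \<Rightarrow> 'a \<Rightarrow> bool" where
  "on_curve E x y \<longleftrightarrow> y\<^sup>2 + a1 E * x * y + a3 E * y = x ^ 3 + a2 E * x\<^sup>2 + a4 E * x + a6 E"

locale short_curve =
  fixes E :: "'a::field_char_0 weierstrass_curve"
  assumes short: "a1 E = 0" "a3 E = 0"
    and nonsingular: "\<And>x. poly [:a6 E, a4 E, a2 E, 1:] x = 0 \<Longrightarrow> poly (pderiv [:a6 E, a4 E, a2 E, 1:]) x \<noteq> 0"
begin

definition f where "f = [:a6 E, a4 E, a2 E, 1:]"

abbreviation "R \<equiv> coord_ring f"

sublocale cring R by (rule cring_coord_ring)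

lemma degree_f: "degree f = 3"
  by (simp add: f_def)

lemma on_curve_iff: "on_curve E x y \<longleftrightarrow> poly f x = y\<^sup>2"
  by (auto simp: on_curve_def short f_def power2_eq_square power3_eq_cube algebra_simps)

text \<open>The norm is multiplicative and vanishes only at zero, so the coordinate ring is a
  domain.\<close>

lemma mult_cancel:
  assumes "u \<noteq> (0, 0)" and "u \<otimes>\<^bsub>R\<^esub> v = u \<otimes>\<^bsub>R\<^esub> w"
  shows "v = w"
proof -
  let ?z = "(fst v - fst w, snd v - snd w)"
  have "u \<otimes>\<^bsub>R\<^esub> ?z = (0, 0)"
    using assms(2) by (simp add: coord_ring_ops algebra_simps)
  then have "conorm f (u \<otimes>\<^bsub>R\<^esub> ?z) = 0"
    by (simp only:) (simp add: conorm_def)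
  then have "conorm f u = 0 \<or> conorm f ?z = 0"
    by (simp only: conorm_mult mult_eq_0_iff)
  then have "u = (0, 0) \<or> ?z = (0, 0)"
    using conorm_eq_0[OF degree_f] by blast
  with assms(1) show ?thesis
    by (auto simp: prod_eq_iff)
qed

lemma mult_nonzero: "u \<noteq> (0, 0) \<Longrightarrow> v \<noteq> (0, 0) \<Longrightarrow> u \<otimes>\<^bsub>R\<^esub> v \<noteq> (0, 0)"
  using mult_cancel[of u v "(0, 0)"] by (auto simp: coord_ring_ops)

lemma PIdl_iff: "u \<in> PIdl\<^bsub>R\<^esub> a \<longleftrightarrow> (\<exists>v. u = v \<otimes>\<^bsub>R\<^esub> a)"
  by (auto simp: cgenideal_def)

lemma ideal_point_ideal:
  assumes "P \<in> rational_points E UNIV"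
  shows "ideal (point_ideal P) R"
proof (cases P)
  case Infinity
  then show ?thesis using oneideal by (simp add: )
next
  case (Affine x y)
  with assms have xy: "poly f x = y\<^sup>2"
    using on_curve_iff[of x y] by (auto simp: rational_points_def on_curve_def)
  show ?thesis unfolding Affine
  proof (rule idealI)
    show "ring R" by (rule ring_axioms)
    show "subgroup (point_ideal (Affine x y)) (add_monoid R)"
    proof (rule group.subgroupI)
      show "group (add_monoid R)" by (rule add.is_group)
      show "point_ideal (Affine x y) \<noteq> {}" by (auto simp: eval_at_def intro!: exI[of _ 0])
      fix a assume a: "a \<in> point_ideal (Affine x y)"
      have "\<ominus>\<^bsub>R\<^esub> a = (- fst a, - snd a)"
        by (rule minus_equality) (auto simp: coord_ring_ops)
      then have i: "inv\<^bsub>add_monoid R\<^esub> a = (- fst a, - snd a)"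
        by (simp add: a_inv_def)
      from a have "- eval_at x y a = 0" by simp
      then show "inv\<^bsub>add_monoid R\<^esub> a \<in> point_ideal (Affine x y)"
        unfolding i by (simp add: eval_at_def)
    next
      fix a b assume "a \<in> point_ideal (Affine x y)" "b \<in> point_ideal (Affine x y)"
      then have "eval_at x y a + eval_at x y b = 0" by simp
      then show "a \<otimes>\<^bsub>add_monoid R\<^esub> b \<in> point_ideal (Affine x y)"
        by (simp add: coord_ring_ops eval_at_def algebra_simps)
    qed simp
  qed (simp_all only: point_ideal.simps mem_Collect_eq eval_at_mult[OF xy] mult_zero_left mult_zero_right)
qed

lemma ideal_prod_subset:
  assumes "ideal K R" and "\<And>i j. i \<in> I \<Longrightarrow> j \<in> J \<Longrightarrow> i \<otimes>\<^bsub>R\<^esub> j \<in> K"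
  shows "ideal_prod R I J \<subseteq> K"
proof
  interpret K: ideal K R by (rule assms(1))
  fix u assume "u \<in> ideal_prod R I J"
  then show "u \<in> K"
    by induction (use assms(2) K.a_closed in auto)
qed

lemma ideal_PIdl [simp]: "ideal (PIdl\<^bsub>R\<^esub> a) R"
  by (rule cgenideal_ideal) simp

lemma ideal_prod_PIdl: "ideal_prod R (PIdl\<^bsub>R\<^esub> a) (PIdl\<^bsub>R\<^esub> b) = PIdl\<^bsub>R\<^esub> (a \<otimes>\<^bsub>R\<^esub> b)"
proof
  show "ideal_prod R (PIdl\<^bsub>R\<^esub> a) (PIdl\<^bsub>R\<^esub> b) \<subseteq> PIdl\<^bsub>R\<^esub> (a \<otimes>\<^bsub>R\<^esub> b)"
  proof (rule ideal_prod_subset[OF ideal_PIdl])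
    fix i j assume "i \<in> PIdl\<^bsub>R\<^esub> a" "j \<in> PIdl\<^bsub>R\<^esub> b"
    then obtain u v where "i = u \<otimes>\<^bsub>R\<^esub> a" "j = v \<otimes>\<^bsub>R\<^esub> b" unfolding PIdl_iff by blast
    then have "i \<otimes>\<^bsub>R\<^esub> j = (u \<otimes>\<^bsub>R\<^esub> v) \<otimes>\<^bsub>R\<^esub> (a \<otimes>\<^bsub>R\<^esub> b)"
      by (simp add: coord_ring_ops algebra_simps)
    then show "i \<otimes>\<^bsub>R\<^esub> j \<in> PIdl\<^bsub>R\<^esub> (a \<otimes>\<^bsub>R\<^esub> b)" unfolding PIdl_iff by blast
  qed
  have "a \<otimes>\<^bsub>R\<^esub> b \<in> ideal_prod R (PIdl\<^bsub>R\<^esub> a) (PIdl\<^bsub>R\<^esub> b)"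
    by (intro ideal_prod.prod cgenideal_self) auto
  then show "PIdl\<^bsub>R\<^esub> (a \<otimes>\<^bsub>R\<^esub> b) \<subseteq> ideal_prod R (PIdl\<^bsub>R\<^esub> a) (PIdl\<^bsub>R\<^esub> b)"
    by (intro cgenideal_minimal ideal_prod_is_ideal ideal_PIdl)
qed

sublocale M: comm_monoid "ideals_set R"
  rewrites "carrier (ideals_set R) = {I. ideal I R}"
    and "monoid.mult (ideals_set R) = ideal_prod R"
    and "monoid.one (ideals_set R) = UNIV"
  using ideals_set_is_comm_monoid by (simp_all add: ideals_set_def)

declare ideal_prod_is_ideal [simp]

text \<open>Equality in the ideal class group. Principal factors on both sides stand in for
  fractional ideals.\<close>

definition sim where
  "sim I J \<longleftrightarrow> (\<exists>a b. a \<noteq> (0, 0) \<and> b \<noteq> (0, 0) \<and>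
     ideal_prod R (PIdl\<^bsub>R\<^esub> a) I = ideal_prod R (PIdl\<^bsub>R\<^esub> b) J)"

lemma sim_refl: "sim I I"
  unfolding sim_def by (intro exI[of _ "(1, 0)"]) simp

lemma sim_sym: "sim I J \<Longrightarrow> sim J I"
  unfolding sim_def by metis

lemma sim_mult:
  assumes [simp]: "ideal I R" "ideal J R" "ideal I' R" "ideal J' R" and "sim I I'" "sim J J'"
  shows "sim (ideal_prod R I J) (ideal_prod R I' J')"
proof -
  obtain a b a' b' where *: "a \<noteq> (0, 0)" "b \<noteq> (0, 0)" "a' \<noteq> (0, 0)" "b' \<noteq> (0, 0)"
    "ideal_prod R (PIdl\<^bsub>R\<^esub> a) I = ideal_prod R (PIdl\<^bsub>R\<^esub> b) I'"
    "ideal_prod R (PIdl\<^bsub>R\<^esub> a') J = ideal_prod R (PIdl\<^bsub>R\<^esub> b') J'"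
    using assms(5,6) unfolding sim_def by blast
  have m4: "ideal_prod R (ideal_prod R A B) (ideal_prod R C D)
      = ideal_prod R (ideal_prod R A C) (ideal_prod R B D)"
    if "ideal A R" "ideal B R" "ideal C R" "ideal D R" for A B C D
    using that by (simp add: M.m_ac)
  have "ideal_prod R (PIdl\<^bsub>R\<^esub> (a \<otimes>\<^bsub>R\<^esub> a')) (ideal_prod R I J)
      = ideal_prod R (ideal_prod R (PIdl\<^bsub>R\<^esub> a) I) (ideal_prod R (PIdl\<^bsub>R\<^esub> a') J)"
    unfolding ideal_prod_PIdl[symmetric] by (rule m4) simp_all
  also have "\<dots> = ideal_prod R (PIdl\<^bsub>R\<^esub> (b \<otimes>\<^bsub>R\<^esub> b')) (ideal_prod R I' J')"
    unfolding ideal_prod_PIdl[symmetric] * by (rule m4) simp_all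
  finally show ?thesis
    unfolding sim_def using mult_nonzero[OF *(1,3)] mult_nonzero[OF *(2,4)] by blast
qed

lemma sim_trans:
  assumes [simp]: "ideal I R" "ideal J R" "ideal H R" and "sim I J" "sim J H"
  shows "sim I H"
proof -
  obtain a b a' b' where *: "a \<noteq> (0, 0)" "b \<noteq> (0, 0)" "a' \<noteq> (0, 0)" "b' \<noteq> (0, 0)"
    "ideal_prod R (PIdl\<^bsub>R\<^esub> a) I = ideal_prod R (PIdl\<^bsub>R\<^esub> b) J"
    "ideal_prod R (PIdl\<^bsub>R\<^esub> a') J = ideal_prod R (PIdl\<^bsub>R\<^esub> b') H"
    using assms(4,5) unfolding sim_def by blast
  have "ideal_prod R (PIdl\<^bsub>R\<^esub> (a' \<otimes>\<^bsub>R\<^esub> a)) I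
      = ideal_prod R (PIdl\<^bsub>R\<^esub> a') (ideal_prod R (PIdl\<^bsub>R\<^esub> a) I)"
    unfolding ideal_prod_PIdl[symmetric] by (rule M.m_assoc) simp_all
  also have "\<dots> = ideal_prod R (PIdl\<^bsub>R\<^esub> b) (ideal_prod R (PIdl\<^bsub>R\<^esub> a') J)"
    unfolding *(5) by (rule M.m_lcomm) simp_all
  also have "\<dots> = ideal_prod R (PIdl\<^bsub>R\<^esub> (b \<otimes>\<^bsub>R\<^esub> b')) H"
    unfolding *(6) ideal_prod_PIdl[symmetric] by (rule M.m_assoc[symmetric]) simp_all
  finally show ?thesis
    unfolding sim_def using mult_nonzero[OF *(3,1)] mult_nonzero[OF *(2,4)] by blast
qed

lemma linear_in_point_ideal: "([:-x, 1:], 0) \<in> point_ideal (Affine x y)"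
  by (simp add: eval_at_def)

lemma conj_in_point_ideal: "([:-y:], 1) \<in> point_ideal (Affine x y)"
  by (simp add: eval_at_def)

lemma on_curveD: "Affine x y \<in> rational_points E UNIV \<longleftrightarrow> poly f x = y\<^sup>2"
  using on_curve_iff[of x y] by (auto simp: rational_points_def on_curve_def)

lemma ideal_scale:
  assumes "ideal K R" and "([:c:], 0) \<otimes>\<^bsub>R\<^esub> u \<in> K" and "c \<noteq> 0"
  shows "u \<in> K"
proof -
  interpret K: ideal K R by (rule assms(1))
  have "([:inverse c:], 0) \<otimes>\<^bsub>R\<^esub> (([:c:], 0) \<otimes>\<^bsub>R\<^esub> u) \<in> K"
    by (rule K.I_l_closed[OF assms(2)]) simp
  moreover have "([:inverse c:], 0) \<otimes>\<^bsub>R\<^esub> (([:c:], 0) \<otimes>\<^bsub>R\<^esub> u) = u"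
    using assms(3) by (simp add: coord_ring_ops prod_eq_iff)
  ultimately show ?thesis by (simp only:)
qed

text \<open>The vertical line through a point has divisor (P) + (-P) - 2(O). If
  \<open>y \<noteq> 0\<close>, the constant \<open>2 * y\<close> is the difference of the two
  conjugate generators, which brings the linear polynomial into the product. At a point of order two
  the product of these generators is \<open>f\<close> itself, and nonsingularity makes the cofactor
  of the linear polynomial in \<open>f\<close> nonzero at \<open>x\<close>.\<close>

lemma point_ideal_prod_neg:
  assumes "poly f x = y\<^sup>2"
  shows "ideal_prod R (point_ideal (Affine x y)) (point_ideal (Affine x (- y))) = PIdl\<^bsub>R\<^esub> ([:-x, 1:], 0)"
    (is "?K = _")
proof
  have i: "ideal (point_ideal (Affine x y)) R" "ideal (point_ideal (Affine x (- y))) R"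
    using assms ideal_point_ideal[of "Affine x y"] ideal_point_ideal[of "Affine x (- y)"]
    by (simp_all only: on_curveD power2_minus)
  then have iK: "ideal ?K R" by (rule ideal_prod_is_ideal)
  interpret K: ideal ?K R by (rule iK)
  show "?K \<subseteq> PIdl\<^bsub>R\<^esub> ([:-x, 1:], 0)"
  proof (rule ideal_prod_subset[OF ideal_PIdl])
    fix u v assume "u \<in> point_ideal (Affine x y)" "v \<in> point_ideal (Affine x (- y))"
    then have u: "poly (fst u) x = - (poly (snd u) x * y)" and v: "poly (fst v) x = poly (snd v) x * y"
      by (simp_all add: eval_at_def add_eq_0_iff2)
    have "[:-x, 1:] dvd fst u * fst v + snd u * snd v * f" "[:-x, 1:] dvd fst u * snd v + snd u * fst v"
      unfolding poly_eq_0_iff_dvd[symmetric] using assms by (simp_all add: u v power2_eq_square)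
    then obtain p q where "fst u * fst v + snd u * snd v * f = [:-x, 1:] * p"
      "fst u * snd v + snd u * fst v = [:-x, 1:] * q" by (elim dvdE)
    then have "u \<otimes>\<^bsub>R\<^esub> v = (p, q) \<otimes>\<^bsub>R\<^esub> ([:-x, 1:], 0)"
      by (simp add: coord_ring_ops algebra_simps)
    then show "u \<otimes>\<^bsub>R\<^esub> v \<in> PIdl\<^bsub>R\<^esub> ([:-x, 1:], 0)" unfolding PIdl_iff by blast
  qed
  have t_K: "([:-x, 1:], 0) \<in> point_ideal (Affine x y)" "([:-x, 1:], 0) \<in> point_ideal (Affine x (- y))"
    by (rule linear_in_point_ideal)+
  have yy: "([:-y:], 1) \<in> point_ideal (Affine x y)" "([:y:], 1) \<in> point_ideal (Affine x (- y))"
    using conj_in_point_ideal[of y x] conj_in_point_ideal[of "- y" x] by simp_all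
  define t where "t = [:-x, 1:]"
  have "(t, 0) \<in> ?K"
  proof (cases "y = 0")
    case False
    have eq: "(t, 0) \<otimes>\<^bsub>R\<^esub> ([:y:], 1) \<oplus>\<^bsub>R\<^esub> (([:-1:], 0) \<otimes>\<^bsub>R\<^esub> (([:-y:], 1) \<otimes>\<^bsub>R\<^esub> (t, 0)))
      = ([:2 * y:], 0) \<otimes>\<^bsub>R\<^esub> (t, 0)"
      by (simp add: coord_ring_ops flip: smult_add_left)
    have "([:2 * y:], 0) \<otimes>\<^bsub>R\<^esub> (t, 0) \<in> ?K"
      unfolding eq[symmetric] using t_K yy by (intro K.a_closed K.I_l_closed ideal_prod.prod) (simp_all only: t_def coord_ring_simps UNIV_I)
    then show ?thesis by (rule ideal_scale[OF iK]) (use False in simp)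
  next
    case True
    then have "poly f x = 0" using assms by simp
    then obtain g where g: "f = t * g" unfolding poly_eq_0_iff_dvd t_def by (elim dvdE)
    have "poly (pderiv f) x = poly g x"
      unfolding g t_def by (subst pderiv_mult) (simp add: pderiv_pCons)
    then have gx: "poly g x \<noteq> 0"
      using nonsingular[of x] \<open>poly f x = 0\<close> unfolding f_def[symmetric] by metis
    have "t dvd g - [:poly g x:]"
      unfolding t_def poly_eq_0_iff_dvd[symmetric] by simp
    then obtain h where h: "g - [:poly g x:] = t * h" by (elim dvdE)
    have gh: "[:poly g x:] = g - t * h" using h by (simp add: algebra_simps)
    have eq: "([:-y:], 1) \<otimes>\<^bsub>R\<^esub> ([:y:], 1) \<oplus>\<^bsub>R\<^esub> ((- h, 0) \<otimes>\<^bsub>R\<^esub> ((t, 0) \<otimes>\<^bsub>R\<^esub> (t, 0)))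
      = ([:poly g x:], 0) \<otimes>\<^bsub>R\<^esub> (t, 0)"
      unfolding gh g using True by (simp add: coord_ring_ops algebra_simps)
    have "([:poly g x:], 0) \<otimes>\<^bsub>R\<^esub> (t, 0) \<in> ?K"
      unfolding eq[symmetric] using t_K yy by (intro K.a_closed K.I_l_closed ideal_prod.prod) (simp_all only: t_def coord_ring_simps UNIV_I)
    then show ?thesis by (rule ideal_scale[OF iK]) (use gx in simp)
  qed
  then have "([:-x, 1:], 0) \<in> ?K" by (simp only: t_def)
  then show "PIdl\<^bsub>R\<^esub> ([:-x, 1:], 0) \<subseteq> ?K"
    by (intro cgenideal_minimal iK)
qed

end

section \<open>The divisor of a line\<close>

context short_curve begin

lemma point_ideal_on_line:
  assumes "u \<in> point_ideal (Affine x y)" and "y = l * x + k"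
  obtains h where "fst u + snd u * [:k, l:] = [:-x, 1:] * h"
proof -
  have "[:-x, 1:] dvd fst u + snd u * [:k, l:]"
    unfolding poly_eq_0_iff_dvd[symmetric] using assms by (simp add: eval_at_def algebra_simps)
  with that show ?thesis by (elim dvdE)
qed

text \<open>Modulo \<open>y - g\<close> the three elements reduce to \<open>t1 * h1\<close>,
  \<open>t2 * h2\<close>, \<open>t3 * h3\<close>, and \<open>t1 * t2 * t3 = f - g\<^sup>2\<close> is
  the product of \<open>y - g\<close> and \<open>y + g\<close>. The witness \<open>w\<close> is the
  telescoped quotient of these reductions.\<close>

lemma collinear_prod_subset:
  fixes g t1 t2 t3 :: "'a poly"
  assumes f: "f = g\<^sup>2 + t1 * t2 * t3"
    and u: "fst u1 + snd u1 * g = t1 * h1" "fst u2 + snd u2 * g = t2 * h2" "fst u3 + snd u3 * g = t3 * h3"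
  shows "u1 \<otimes>\<^bsub>R\<^esub> u2 \<otimes>\<^bsub>R\<^esub> u3 \<in> PIdl\<^bsub>R\<^esub> (- g, 1)"
proof -
  have u': "fst u1 = t1 * h1 - snd u1 * g" "fst u2 = t2 * h2 - snd u2 * g" "fst u3 = t3 * h3 - snd u3 * g"
    using u by (simp_all add: algebra_simps)
  define w where "w = (snd u1, 0) \<otimes>\<^bsub>R\<^esub> (u2 \<otimes>\<^bsub>R\<^esub> u3) \<oplus>\<^bsub>R\<^esub> (t1 * h1 * snd u2, 0) \<otimes>\<^bsub>R\<^esub> u3
     \<oplus>\<^bsub>R\<^esub> (t1 * h1 * t2 * h2 * snd u3, 0) \<oplus>\<^bsub>R\<^esub> (g * h1 * h2 * h3, h1 * h2 * h3)"
  have "u1 \<otimes>\<^bsub>R\<^esub> u2 \<otimes>\<^bsub>R\<^esub> u3 = w \<otimes>\<^bsub>R\<^esub> (- g, 1)"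
    unfolding w_def by (simp add: coord_ring_ops u' f power2_eq_square algebra_simps)
  then show ?thesis unfolding PIdl_iff by blast
qed

text \<open>\<open>J\<close> is membership in an ideal quotient. Writing \<open>Y\<close> for the
  second coordinate, \<open>(Y - g) (Y + g) - (Y - g)\<^sup>2 - 2 l t (Y - g)\<close> equals
  \<open>2 y (Y - g)\<close>, which puts \<open>Y - g\<close> into \<open>J\<close>; then
  \<open>2 g\<close>, hence \<open>t\<close>, hence the unit \<open>2 y\<close> follow.\<close>

lemma line_multiplier_double:
  assumes add: "\<And>h k. J h \<Longrightarrow> J k \<Longrightarrow> J (h \<oplus>\<^bsub>R\<^esub> k)"
    and mult: "\<And>w h. J h \<Longrightarrow> J (w \<otimes>\<^bsub>R\<^esub> h)"
    and g: "g = [:y:] + smult l t" and "y \<noteq> 0"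
    and tt: "J ((t, 0) \<otimes>\<^bsub>R\<^esub> (t, 0))" and lt: "J ((- g, 1) \<otimes>\<^bsub>R\<^esub> (t, 0))"
    and ll: "J ((- g, 1) \<otimes>\<^bsub>R\<^esub> (- g, 1))" and c: "J (g, 1)"
  shows "J (1, 0)"
proof -
  define z where "z = ([:inverse (2 * y):], 0 :: 'a poly)"
  have z: "[:inverse (2 * y):] * [:2 * y:] = 1" using \<open>y \<noteq> 0\<close> by (simp add: one_pCons)
  have "J (z \<otimes>\<^bsub>R\<^esub> ((- g, 1) \<otimes>\<^bsub>R\<^esub> (g, 1) \<oplus>\<^bsub>R\<^esub> ([:-1:], 0) \<otimes>\<^bsub>R\<^esub> ((- g, 1) \<otimes>\<^bsub>R\<^esub> (- g, 1))
      \<oplus>\<^bsub>R\<^esub> ([:- 2 * l:], 0) \<otimes>\<^bsub>R\<^esub> ((- g, 1) \<otimes>\<^bsub>R\<^esub> (t, 0))))"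
    by (intro mult add tt lt ll c)
  also have "z \<otimes>\<^bsub>R\<^esub> ((- g, 1) \<otimes>\<^bsub>R\<^esub> (g, 1) \<oplus>\<^bsub>R\<^esub> ([:-1:], 0) \<otimes>\<^bsub>R\<^esub> ((- g, 1) \<otimes>\<^bsub>R\<^esub> (- g, 1))
      \<oplus>\<^bsub>R\<^esub> ([:- 2 * l:], 0) \<otimes>\<^bsub>R\<^esub> ((- g, 1) \<otimes>\<^bsub>R\<^esub> (t, 0)))
      = (([:inverse (2 * y):] * (2 * g - smult (2 * l) t)) * (- g), [:inverse (2 * y):] * (2 * g - smult (2 * l) t))"
    by (simp add: coord_ring_ops z_def algebra_simps flip: smult_add_right)
  also have "2 * g - smult (2 * l) t = [:2 * y:]"
    by (simp add: g algebra_simps numeral_poly smult_add_right)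
  finally have l: "J (- g, 1)" by (simp only: z mult_1_left)
  have s: "J ((g, 1) \<oplus>\<^bsub>R\<^esub> ([:-1:], 0) \<otimes>\<^bsub>R\<^esub> (- g, 1))"
    by (rule add[OF c mult[OF l]])
  have s_eq: "(g, 1) \<oplus>\<^bsub>R\<^esub> ([:-1:], 0) \<otimes>\<^bsub>R\<^esub> (- g, 1) = ([:2 * y:] + smult (2 * l) t, 0)"
  proof -
    have "[:-1:] = (- 1 :: 'a poly)"
      by (rule poly_eqI) (simp add: coeff_pCons split: nat.split)
    moreover have "g + g = smult 2 g"
      by (rule poly_eqI) (simp only: coeff_add coeff_smult mult_2)
    moreover have "smult 2 g = [:2 * y:] + smult (2 * l) t"
      unfolding g smult_add_right by simp
    ultimately have "(g, 1) \<oplus>\<^bsub>R\<^esub> ([:-1:], 0) \<otimes>\<^bsub>R\<^esub> (- g, 1) = (g + g, 0)" "g + g = [:2 * y:] + smult (2 * l) t"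
      by (simp_all only: coord_ring_ops fst_conv snd_conv) simp_all
    then show ?thesis by (simp only:)
  qed
  have "J (z \<otimes>\<^bsub>R\<^esub> ((t, 0) \<otimes>\<^bsub>R\<^esub> ([:2 * y:] + smult (2 * l) t, 0) \<oplus>\<^bsub>R\<^esub> ([:- 2 * l:], 0) \<otimes>\<^bsub>R\<^esub> ((t, 0) \<otimes>\<^bsub>R\<^esub> (t, 0))))"
    using s unfolding s_eq by (intro mult add tt)
  also have "z \<otimes>\<^bsub>R\<^esub> ((t, 0) \<otimes>\<^bsub>R\<^esub> ([:2 * y:] + smult (2 * l) t, 0) \<oplus>\<^bsub>R\<^esub> ([:- 2 * l:], 0) \<otimes>\<^bsub>R\<^esub> ((t, 0) \<otimes>\<^bsub>R\<^esub> (t, 0)))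
     = (([:inverse (2 * y):] * [:2 * y:]) * t, 0)"
    by (simp add: coord_ring_ops z_def algebra_simps flip: smult_add_right)
  finally have t: "J (t, 0)" by (simp only: z mult_1_left)
  have "J (z \<otimes>\<^bsub>R\<^esub> (([:2 * y:] + smult (2 * l) t, 0) \<oplus>\<^bsub>R\<^esub> ([:- 2 * l:], 0) \<otimes>\<^bsub>R\<^esub> (t, 0)))"
    using s unfolding s_eq by (intro mult add t)
  also have "z \<otimes>\<^bsub>R\<^esub> (([:2 * y:] + smult (2 * l) t, 0) \<oplus>\<^bsub>R\<^esub> ([:- 2 * l:], 0) \<otimes>\<^bsub>R\<^esub> (t, 0))
     = ([:inverse (2 * y):] * [:2 * y:], 0)"
    by (simp add: coord_ring_ops z_def)
  finally show ?thesis by (simp only: z)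
qed

text \<open>The difference of \<open>t1 * t2\<close> and \<open>t1 * t3\<close> is a nonzero
  constant times \<open>t1\<close>. The same step for \<open>t2\<close>, and then for the pair
  \<open>t1\<close>, \<open>t2\<close>, reaches a constant.\<close>

lemma line_multiplier_distinct:
  assumes add: "\<And>h k. J h \<Longrightarrow> J k \<Longrightarrow> J (h \<oplus>\<^bsub>R\<^esub> k)"
    and mult: "\<And>w h. J h \<Longrightarrow> J (w \<otimes>\<^bsub>R\<^esub> h)"
    and "x1 \<noteq> x2" "x1 \<noteq> x3" "x2 \<noteq> x3"
    and t: "t1 = [:-x1, 1:]" "t2 = [:-x2, 1:]" "t3 = [:-x3, 1:]"
    and tt: "J (t1 * t2, 0)" "J (t1 * t3, 0)" "J (t2 * t3, 0)"
  shows "J (1, 0)"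
proof -
  have *: "J (t, 0)" if "J (t * u, 0)" "J (t * v, 0)" "u - v = [:c:]" "c \<noteq> 0" for t u v c
  proof -
    have z: "[:inverse c:] * [:c:] = 1" using that by (simp add: one_pCons)
    have "J (([:inverse c:], 0) \<otimes>\<^bsub>R\<^esub> ((t * u, 0) \<oplus>\<^bsub>R\<^esub> ([:-1:], 0) \<otimes>\<^bsub>R\<^esub> (t * v, 0)))"
      by (intro mult add that)
    also have "([:inverse c:], 0) \<otimes>\<^bsub>R\<^esub> ((t * u, 0) \<oplus>\<^bsub>R\<^esub> ([:-1:], 0) \<otimes>\<^bsub>R\<^esub> (t * v, 0))
        = (([:inverse c:] * (u - v)) * t, 0)"
      by (simp add: coord_ring_ops algebra_simps smult_diff_right)
    finally show ?thesis by (simp only: that z mult_1_left)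
  qed
  have 1: "J (t1, 0)" by (rule *[OF tt(1,2), of "x3 - x2"]) (use assms in auto)
  have 2: "J (t2, 0)"
    by (rule *[of t2 t1 t3 "x3 - x1"]) (use assms in \<open>auto simp: mult.commute\<close>)
  show ?thesis by (rule *[of 1 t1 t2 "x2 - x1"]) (use assms 1 2 in auto)
qed

lemma collinear_prod:
  assumes f: "f = [:k, l:]\<^sup>2 + [:-x1, 1:] * [:-x2, 1:] * [:-x3, 1:]"
    and y: "y1 = l * x1 + k" "y2 = l * x2 + k" "y3 = l * x3 + k"
  shows "ideal_prod R (ideal_prod R (point_ideal (Affine x1 y1)) (point_ideal (Affine x2 y2)))
      (point_ideal (Affine x3 y3)) = PIdl\<^bsub>R\<^esub> (- [:k, l:], 1)"
    (is "ideal_prod R (ideal_prod R ?I1 ?I2) ?I3 = _")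
proof
  define g where "g = [:k, l:]"
  define t1 t2 t3 where t_def: "t1 = [:-x1, 1:]" "t2 = [:-x2, 1:]" "t3 = [:-x3, 1:]"
  have fg: "f = g\<^sup>2 + t1 * t2 * t3" using f by (simp only: g_def t_def)
  have "poly f x1 = y1\<^sup>2" "poly f x2 = y2\<^sup>2" "poly f x3 = y3\<^sup>2"
    unfolding f y by (simp_all add: algebra_simps)
  then have i [simp]: "ideal ?I1 R" "ideal ?I2 R" "ideal ?I3 R"
    using ideal_point_ideal on_curveD by blast+
  define K where "K = ideal_prod R (ideal_prod R ?I1 ?I2) ?I3"
  have iK: "ideal K R" unfolding K_def by (intro ideal_prod_is_ideal i)
  interpret K: ideal K R by (rule iK)
  show "ideal_prod R (ideal_prod R ?I1 ?I2) ?I3 \<subseteq> PIdl\<^bsub>R\<^esub> (- [:k, l:], 1)"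
  proof (rule ideal_prod_subset[OF ideal_PIdl])
    fix u v assume u: "u \<in> ideal_prod R ?I1 ?I2" and v: "v \<in> ?I3"
    interpret Q: ideal "PIdl\<^bsub>R\<^esub> (- [:k, l:], 1)" R by (rule ideal_PIdl)
    from u show "u \<otimes>\<^bsub>R\<^esub> v \<in> PIdl\<^bsub>R\<^esub> (- [:k, l:], 1)"
    proof induction
      case (prod a b)
      obtain h1 where 1: "fst a + snd a * g = t1 * h1"
        using point_ideal_on_line[OF prod(1) y(1)] unfolding g_def t_def .
      obtain h2 where 2: "fst b + snd b * g = t2 * h2"
        using point_ideal_on_line[OF prod(2) y(2)] unfolding g_def t_def .
      obtain h3 where 3: "fst v + snd v * g = t3 * h3"
        using point_ideal_on_line[OF v y(3)] unfolding g_def t_def .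
      show ?case using collinear_prod_subset[OF fg 1 2 3] unfolding g_def .
    next
      case (sum s1 s2)
      then show ?case using Q.a_closed l_distr[of s1 s2 v] by simp
    qed
  qed
  \<comment> \<open>\<open>J\<close> is the ideal quotient of the product ideal by
    \<open>y - g\<close>. Every product of three generators is a multiple of \<open>y - g\<close>,
    either visibly or because \<open>t1 * t2 * t3\<close> is the product of \<open>y - g\<close> and
    \<open>y + g\<close>, so the inclusion amounts to finding 1 in \<open>J\<close>.\<close>
  define J where "J h \<longleftrightarrow> h \<otimes>\<^bsub>R\<^esub> (- g, 1) \<in> K" for h
  have add: "J (h \<oplus>\<^bsub>R\<^esub> h')" if "J h" "J h'" for h h'
    using K.a_closed[OF that[unfolded J_def]] l_distr[of h h' "(- g, 1)"] by (simp add: J_def)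
  have mult: "J (w \<otimes>\<^bsub>R\<^esub> h)" if "J h" for w h
    using K.I_l_closed[OF that[unfolded J_def], of w] m_assoc[of w h "(- g, 1)"] by (simp add: J_def)
  have K3: "u1 \<otimes>\<^bsub>R\<^esub> u2 \<otimes>\<^bsub>R\<^esub> u3 \<in> K" if "u1 \<in> ?I1" "u2 \<in> ?I2" "u3 \<in> ?I3" for u1 u2 u3
    unfolding K_def using that by (intro ideal_prod.prod)
  have t: "(t1, 0) \<in> ?I1" "(t2, 0) \<in> ?I2" "(t3, 0) \<in> ?I3"
    unfolding t_def by (rule linear_in_point_ideal)+
  have g: "(- g, 1) \<in> ?I1" "(- g, 1) \<in> ?I2" "(- g, 1) \<in> ?I3"
    by (simp_all add: g_def eval_at_def y)
  have J_tt: "J (t1 * t2, 0)" "J (t1 * t3, 0)" "J (t2 * t3, 0)"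
    using K3[OF t(1,2) g(3)] K3[OF t(1) g(2) t(3)] K3[OF g(1) t(2,3)]
    by (simp_all add: J_def coord_ring_ops algebra_simps)
  have J_lt: "J ((- g, 1) \<otimes>\<^bsub>R\<^esub> (t1, 0))" "J ((- g, 1) \<otimes>\<^bsub>R\<^esub> (t2, 0))" "J ((- g, 1) \<otimes>\<^bsub>R\<^esub> (t3, 0))"
    using K3[OF t(1) g(2) g(3)] K3[OF g(1) t(2) g(3)] K3[OF g(1) g(2) t(3)]
    by (simp_all add: J_def coord_ring_ops algebra_simps)
  have J_ll: "J ((- g, 1) \<otimes>\<^bsub>R\<^esub> (- g, 1))"
    using K3[OF g] by (simp add: J_def)
  have J_c: "J (g, 1)"
    using K3[OF t] by (simp add: J_def coord_ring_ops fg power2_eq_square algebra_simps)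
  \<comment> \<open>A line tangent to the curve at a point with vanishing ordinate would make the
    abscissa a double root of \<open>f\<close>.\<close>
  have nz: "l * x + k \<noteq> 0" if "f = [:k, l:]\<^sup>2 + [:-x, 1:] * [:-x, 1:] * [:-z, 1:]" for x z
  proof
    assume "l * x + k = 0"
    then have k: "k = - (l * x)" by (simp add: add_eq_0_iff)
    have "poly f x = 0" unfolding that by (simp add: k algebra_simps)
    moreover have "poly (pderiv f) x = 0" unfolding that
      by (simp add: k pderiv_add pderiv_mult pderiv_power_Suc pderiv_pCons power2_eq_square algebra_simps)
    ultimately show False using nonsingular[of x] unfolding f_def[symmetric] by blast
  qed
  have dbl: "J (1, 0)" if "J (t * t, 0)" "J ((- g, 1) \<otimes>\<^bsub>R\<^esub> (t, 0))" "t = [:-x, 1:]" "l * x + k \<noteq> 0" for t x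
    by (rule line_multiplier_double[OF add mult _ that(4) _ that(2) J_ll J_c, of l])
      (use that(1) in \<open>simp_all add: that(3) g_def coord_ring_ops algebra_simps\<close>)
  have "J (1, 0)"
  proof -
    consider "x1 = x2" | "x1 = x3" | "x2 = x3" | "x1 \<noteq> x2" "x1 \<noteq> x3" "x2 \<noteq> x3" by blast
    then show ?thesis
    proof cases
      case 1
      have f': "f = [:k, l:]\<^sup>2 + [:-x1, 1:] * [:-x1, 1:] * [:-x3, 1:]" using f unfolding 1[symmetric] .
      have tt: "J (t1 * t1, 0)" using J_tt(1) unfolding t_def 1[symmetric] .
      show ?thesis by (rule dbl[OF tt J_lt(1) t_def(1) nz[OF f']])
    next
      case 2
      have f': "f = [:k, l:]\<^sup>2 + [:-x1, 1:] * [:-x1, 1:] * [:-x2, 1:]"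
        by (subst f[unfolded 2[symmetric]]) (simp only: mult_ac)
      have tt: "J (t1 * t1, 0)" using J_tt(2) unfolding t_def 2[symmetric] .
      show ?thesis by (rule dbl[OF tt J_lt(1) t_def(1) nz[OF f']])
    next
      case 3
      have f': "f = [:k, l:]\<^sup>2 + [:-x2, 1:] * [:-x2, 1:] * [:-x1, 1:]"
        by (subst f[unfolded 3[symmetric]]) (simp only: mult_ac)
      have tt: "J (t2 * t2, 0)" using J_tt(3) unfolding t_def 3[symmetric] .
      show ?thesis by (rule dbl[OF tt J_lt(2) t_def(2) nz[OF f']])
    next
      case 4
      show ?thesis by (rule line_multiplier_distinct[OF add mult 4 t_def J_tt])
    qed
  qed
  then have "(- g, 1) \<in> K" by (simp add: J_def coord_ring_ops)
  then show "PIdl\<^bsub>R\<^esub> (- [:k, l:], 1) \<subseteq> ideal_prod R (ideal_prod R ?I1 ?I2) ?I3"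
    unfolding K_def[symmetric] g_def by (intro cgenideal_minimal iK)
qed

end

section \<open>Addition of points and multiplication of ideal classes\<close>

context short_curve begin

text \<open>\<open>x3\<close> is chosen to match the quadratic coefficient, so only a linear
  remainder \<open>[:\<beta>, \<alpha>:]\<close> is left. It vanishes at both abscissas; when they
  coincide, the tangent slope gives \<open>\<alpha> = 0\<close> directly.\<close>

lemma point_add_line:
  assumes P: "poly f x1 = y1\<^sup>2" and Q: "poly f x2 = y2\<^sup>2" and ne: "\<not> (x1 = x2 \<and> y1 + y2 = 0)"
  obtains l k x3 where "f = [:k, l:]\<^sup>2 + [:-x1, 1:] * [:-x2, 1:] * [:-x3, 1:]"
    "y1 = l * x1 + k" "y2 = l * x2 + k"
    "point_add E (Affine x1 y1) (Affine x2 y2) = Affine x3 (- (l * x3 + k))"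
proof -
  define l where "l = (if x1 = x2 then (3 * x1\<^sup>2 + 2 * a2 E * x1 + a4 E) / (2 * y1) else (y2 - y1) / (x2 - x1))"
  define k where "k = y1 - l * x1"
  define x3 where "x3 = l\<^sup>2 - a2 E - x1 - x2"
  have y1: "y1 = l * x1 + k" by (simp add: k_def)
  have yx: "y1 = y2 \<and> y1 \<noteq> 0" if "x1 = x2"
  proof -
    have "(y1 - y2) * (y1 + y2) = 0"
      using that P Q by (simp add: algebra_simps power2_eq_square)
    with ne that show ?thesis by auto
  qed
  have y2: "y2 = l * x2 + k"
  proof (cases "x1 = x2")
    case True with yx y1 show ?thesis by simp
  next
    case False
    then have "l * (x2 - x1) = y2 - y1" by (simp add: l_def)
    then show ?thesis by (simp add: k_def algebra_simps)
  qed
  define \<alpha> where "\<alpha> = a4 E - 2 * l * k - (x1 * x2 + x1 * x3 + x2 * x3)"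
  define \<beta> where "\<beta> = a6 E - k\<^sup>2 + x1 * x2 * x3"
  have eq: "f = [:k, l:]\<^sup>2 + [:-x1, 1:] * [:-x2, 1:] * [:-x3, 1:] + [:\<beta>, \<alpha>:]"
    by (simp add: f_def \<alpha>_def \<beta>_def x3_def power2_eq_square algebra_simps)
  have 1: "\<alpha> * x1 + \<beta> = 0"
    using P unfolding eq y1 by (simp add: algebra_simps power2_eq_square)
  have 2: "\<alpha> * x2 + \<beta> = 0"
    using Q unfolding eq y2 by (simp add: algebra_simps power2_eq_square)
  have "\<alpha> = 0"
  proof (cases "x1 = x2")
    case False
    have "\<alpha> * (x1 - x2) = (\<alpha> * x1 + \<beta>) - (\<alpha> * x2 + \<beta>)" by (simp add: algebra_simps)
    then have "\<alpha> * (x1 - x2) = 0" unfolding 1 2 by simp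
    with False show ?thesis by simp
  next
    case True
    then have l: "2 * y1 * l = 3 * x1\<^sup>2 + 2 * a2 E * x1 + a4 E"
      using yx by (auto simp: l_def)
    show ?thesis using l unfolding \<alpha>_def x3_def k_def True[symmetric]
      by (simp add: power2_eq_square algebra_simps)
  qed
  with 1 have "\<beta> = 0" by simp
  have "point_add E (Affine x1 y1) (Affine x2 y2) = Affine x3 (- (l * x3 + k))"
    using ne unfolding point_add.simps short Let_def
    by (auto simp: l_def x3_def k_def short)
  from that[OF _ y1 y2 this] eq \<open>\<alpha> = 0\<close> \<open>\<beta> = 0\<close> show ?thesis by simp
qed

lemma point_add_closed_short:
  assumes "P \<in> rational_points E UNIV" "Q \<in> rational_points E UNIV"
  shows "point_add E P Q \<in> rational_points E UNIV"
proof (cases P)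
  case Infinity
  with assms show ?thesis by simp
next
  case P: (Affine x1 y1)
  show ?thesis
  proof (cases Q)
    case Infinity
    with assms P show ?thesis by simp
  next
    case Q: (Affine x2 y2)
    show ?thesis
    proof (cases "x1 = x2 \<and> y1 + y2 = 0")
      case True
      then show ?thesis by (simp add: P Q short rational_points_def)
    next
      case False
      obtain l k x3 where *: "f = [:k, l:]\<^sup>2 + [:-x1, 1:] * [:-x2, 1:] * [:-x3, 1:]"
        "point_add E P Q = Affine x3 (- (l * x3 + k))"
        using point_add_line[of x1 y1 x2 y2] assms False unfolding P Q on_curveD by blast
      have "poly f x3 = (- (l * x3 + k))\<^sup>2"
        unfolding *(1) power2_minus by (simp add: algebra_simps)
      then show ?thesis unfolding *(2) on_curveD .
    qed
  qed
qed

lemma sim_PIdl: "a \<noteq> (0, 0) \<Longrightarrow> sim (PIdl\<^bsub>R\<^esub> a) UNIV"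
  unfolding sim_def
  by (rule exI[of _ "(1, 0)"], rule exI[of _ a])
    (use M.l_one[of "PIdl\<^bsub>R\<^esub> a"] M.r_one[of "PIdl\<^bsub>R\<^esub> a"] oneideal
       cgenideal_eq_genideal[of "(1, 0)"] genideal_one in \<open>simp\<close>)

text \<open>With \<open>T\<close> the third point on the line, the ideals of \<open>P\<close>,
  \<open>Q\<close> and \<open>T\<close> multiply to a principal ideal, and so do those of
  \<open>T\<close> and \<open>- T\<close>. Combining the two relations trades \<open>T\<close> for
  \<open>- T\<close>, which is the sum.\<close>

lemma point_class_add:
  assumes P: "P \<in> rational_points E UNIV" and Q: "Q \<in> rational_points E UNIV"
  shows "sim (ideal_prod R (point_ideal P) (point_ideal Q)) (point_ideal (point_add E P Q))"
proof (cases P)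
  case Infinity
  then show ?thesis
    using M.l_one[of "point_ideal Q"] ideal_point_ideal[OF Q] by (simp add: sim_refl)
next
  case PA: (Affine x1 y1)
  show ?thesis
  proof (cases Q)
    case Infinity
    then show ?thesis
      using M.r_one[of "point_ideal P"] ideal_point_ideal[OF P] by (simp add: sim_refl PA)
  next
    case QA: (Affine x2 y2)
    have P': "poly f x1 = y1\<^sup>2" and Q': "poly f x2 = y2\<^sup>2"
      using P Q unfolding PA QA on_curveD by blast+
    show ?thesis
    proof (cases "x1 = x2 \<and> y1 + y2 = 0")
      case True
      then have "y2 = - y1" "x2 = x1" by (auto simp: add_eq_0_iff)
      then show ?thesis
        using point_ideal_prod_neg[OF P'] sim_PIdl[of "([:-x1, 1:], 0)"]
        by (simp add: PA QA short)
    next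
      case False
      obtain l k x3 where *: "f = [:k, l:]\<^sup>2 + [:-x1, 1:] * [:-x2, 1:] * [:-x3, 1:]"
        "y1 = l * x1 + k" "y2 = l * x2 + k" "point_add E P Q = Affine x3 (- (l * x3 + k))"
        using point_add_line[OF P' Q' False] unfolding PA QA by blast
      let ?T = "point_ideal (Affine x3 (l * x3 + k))" and ?S = "point_ideal (Affine x3 (- (l * x3 + k)))"
      have 3: "poly f x3 = (l * x3 + k)\<^sup>2" "poly f x3 = (- (l * x3 + k))\<^sup>2"
        unfolding *(1) power2_minus by (simp_all add: algebra_simps)
      have i: "ideal (point_ideal P) R" "ideal (point_ideal Q) R" "ideal ?T R" "ideal ?S R"
        using ideal_point_ideal P Q 3 on_curveD by blast+
      have "ideal_prod R (PIdl\<^bsub>R\<^esub> ([:-x3, 1:], 0)) (ideal_prod R (point_ideal P) (point_ideal Q))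
        = ideal_prod R (ideal_prod R (point_ideal P) (point_ideal Q)) (ideal_prod R ?T ?S)"
        unfolding point_ideal_prod_neg[OF 3(1)] by (rule M.m_comm) (use i in simp_all)
      also have "\<dots> = ideal_prod R (ideal_prod R (ideal_prod R (point_ideal P) (point_ideal Q)) ?T) ?S"
        by (rule M.m_assoc[symmetric]) (use i in simp_all)
      also have "\<dots> = ideal_prod R (PIdl\<^bsub>R\<^esub> (- [:k, l:], 1)) ?S"
        using collinear_prod[OF *(1-3) refl] unfolding PA QA by (simp only:)
      finally show ?thesis unfolding sim_def *(4)
        by (intro exI[of _ "([:-x3, 1:], 0)"] exI[of _ "(- [:k, l:], 1)"]) simp
    qed
  qed
qed

text \<open>A trivial class means that the ideal is generated by some \<open>g\<close>, and the norm
  of \<open>g\<close> divides the square of \<open>[:-x, 1:]\<close>. The degree gap of norms makes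
  \<open>g\<close> a polynomial in one variable. A nonzero constant does not vanish at the point,
  and a linear polynomial cannot divide \<open>([:-y:], 1)\<close>, whose second component is
  1.\<close>

lemma point_ideal_not_principal:
  assumes T: "poly f x = y\<^sup>2" and s: "sim (point_ideal (Affine x y)) UNIV"
  shows False
proof -
  let ?T = "point_ideal (Affine x y)"
  have i: "ideal ?T R" using ideal_point_ideal T on_curveD by blast
  obtain a b where ab: "a \<noteq> (0, 0)" "b \<noteq> (0, 0)"
    and eq: "ideal_prod R (PIdl\<^bsub>R\<^esub> a) ?T = ideal_prod R (PIdl\<^bsub>R\<^esub> b) UNIV"
    using s unfolding sim_def by blast
  have eq': "ideal_prod R (PIdl\<^bsub>R\<^esub> a) ?T = PIdl\<^bsub>R\<^esub> b"
    unfolding eq using M.r_one[of "PIdl\<^bsub>R\<^esub> b"] by simp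
  have mem: "\<exists>v\<in>?T. u = a \<otimes>\<^bsub>R\<^esub> v" if "u \<in> ideal_prod R (PIdl\<^bsub>R\<^esub> a) ?T" for u
    using that
  proof induction
    case (prod p q)
    then obtain w where "p = w \<otimes>\<^bsub>R\<^esub> a" unfolding PIdl_iff by blast
    then have "p \<otimes>\<^bsub>R\<^esub> q = a \<otimes>\<^bsub>R\<^esub> (w \<otimes>\<^bsub>R\<^esub> q)" by (simp add: m_ac)
    moreover have "w \<otimes>\<^bsub>R\<^esub> q \<in> ?T" by (rule ideal.I_l_closed[OF i prod(2)]) simp
    ultimately show ?case by blast
  next
    case (sum s1 s2)
    then obtain v1 v2 where "v1 \<in> ?T" "v2 \<in> ?T" "s1 = a \<otimes>\<^bsub>R\<^esub> v1" "s2 = a \<otimes>\<^bsub>R\<^esub> v2" by blast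
    then have "v1 \<oplus>\<^bsub>R\<^esub> v2 \<in> ?T" "s1 \<oplus>\<^bsub>R\<^esub> s2 = a \<otimes>\<^bsub>R\<^esub> (v1 \<oplus>\<^bsub>R\<^esub> v2)"
      using additive_subgroup.a_closed[OF ideal.axioms(1)[OF i]] by (simp_all add: r_distr)
    then show ?case by blast
  qed
  have "b \<in> ideal_prod R (PIdl\<^bsub>R\<^esub> a) ?T"
    unfolding eq' by (rule cgenideal_self) simp
  then obtain g where g: "g \<in> ?T" "b = a \<otimes>\<^bsub>R\<^esub> g"
    using mem by blast
  have div: "\<exists>h. v = g \<otimes>\<^bsub>R\<^esub> h" if "v \<in> ?T" for v
  proof -
    have "a \<otimes>\<^bsub>R\<^esub> v \<in> PIdl\<^bsub>R\<^esub> b"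
      unfolding eq'[symmetric] by (intro ideal_prod.prod that cgenideal_self) simp
    then obtain h where "a \<otimes>\<^bsub>R\<^esub> v = h \<otimes>\<^bsub>R\<^esub> b" unfolding PIdl_iff by blast
    then have "a \<otimes>\<^bsub>R\<^esub> v = a \<otimes>\<^bsub>R\<^esub> (g \<otimes>\<^bsub>R\<^esub> h)" unfolding g by (simp add: m_ac)
    with mult_cancel[OF ab(1)] show ?thesis by blast
  qed
  obtain h where h: "([:-x, 1:], 0) = g \<otimes>\<^bsub>R\<^esub> h" using div[OF linear_in_point_ideal] by blast
  obtain h' where h': "([:-y:], 1) = g \<otimes>\<^bsub>R\<^esub> h'" using div[OF conj_in_point_ideal] by blast
  have "conorm f g * conorm f h = [:-x, 1:]\<^sup>2"
    unfolding conorm_mult[symmetric] h[symmetric] by (simp add: conorm_def)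
  then have nz: "conorm f g \<noteq> 0" "conorm f h \<noteq> 0" and "degree (conorm f g * conorm f h) = 2"
    using degree_power_eq[of "[:-x, 1:]" 2] by auto
  then have deg: "degree (conorm f g) + degree (conorm f h) = 2"
    using degree_mult_eq[of "conorm f g" "conorm f h"] by simp
  have sg: "snd g = 0"
  proof (rule ccontr)
    assume "snd g \<noteq> 0"
    from degree_conorm(1)[OF degree_f this] deg show False by linarith
  qed
  have sh: "snd h = 0"
  proof (rule ccontr)
    assume "snd h \<noteq> 0"
    from degree_conorm(1)[OF degree_f this] deg show False by linarith
  qed
  have "degree (fst g) = 0 \<or> degree (fst h) = 0"
    using degree_conorm(2)[OF degree_f sg] degree_conorm(2)[OF degree_f sh] deg by linarith
  then show False
  proof
    assume "degree (fst g) = 0"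
    then obtain c where c: "fst g = [:c:]" by (elim degree_eq_zeroE)
    then have "c \<noteq> 0" using nz sg by (auto simp: conorm_def)
    with g(1) c sg show False by (simp add: eval_at_def)
  next
    assume "degree (fst h) = 0"
    then have 1: "degree (fst g) = 1"
      using degree_conorm(2)[OF degree_f sg] degree_conorm(2)[OF degree_f sh] deg by linarith
    have "1 = fst g * snd h'" using h' sg by (simp add: coord_ring_ops)
    with 1 show False by (metis degree_1 degree_mult_eq add_is_0 mult_zero_right one_neq_zero mult_zero_left)
  qed
qed

text \<open>The class of \<open>P - Q\<close> is trivial, so this difference cannot be an affine
  point.\<close>

lemma point_ideal_inj:
  assumes P: "P \<in> rational_points E UNIV" and Q: "Q \<in> rational_points E UNIV"
    and s: "sim (point_ideal P) (point_ideal Q)"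
  shows "P = Q"
proof (cases Q)
  case Infinity
  show ?thesis
  proof (cases P)
    case (Affine x y)
    then show ?thesis using point_ideal_not_principal[of x y] P s Infinity on_curveD by auto
  qed (simp add: Infinity)
next
  case QA: (Affine x y)
  have Q': "poly f x = y\<^sup>2" using Q unfolding QA on_curveD .
  define Q2 where "Q2 = Affine x (- y)"
  have Q2: "Q2 \<in> rational_points E UNIV" unfolding Q2_def on_curveD using Q' by simp
  define T where "T = point_add E P Q2"
  have T: "T \<in> rational_points E UNIV" unfolding T_def using P Q2 by (rule point_add_closed_short)
  have iP: "ideal (point_ideal P) R" and iQ: "ideal (point_ideal Q) R" and iQ2: "ideal (point_ideal Q2) R"
    and iT: "ideal (point_ideal T) R"
    using ideal_point_ideal P Q Q2 T by blast+
  have 1: "sim (ideal_prod R (point_ideal P) (point_ideal Q2)) (ideal_prod R (point_ideal Q) (point_ideal Q2))"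
    by (rule sim_mult) (use iP iQ iQ2 s sim_refl in blast)+
  have 2: "sim (ideal_prod R (point_ideal Q) (point_ideal Q2)) UNIV"
    using point_ideal_prod_neg[OF Q'] sim_PIdl[of "([:-x, 1:], 0)"] unfolding QA Q2_def by simp
  have "sim (ideal_prod R (point_ideal P) (point_ideal Q2)) UNIV"
    by (rule sim_trans[OF _ _ _ 1 2]) (use iP iQ iQ2 oneideal in simp_all)
  moreover have "sim (point_ideal T) (ideal_prod R (point_ideal P) (point_ideal Q2))"
    unfolding T_def by (rule sim_sym[OF point_class_add[OF P Q2]])
  ultimately have "sim (point_ideal T) UNIV"
    using sim_trans[of "point_ideal T" "ideal_prod R (point_ideal P) (point_ideal Q2)" UNIV] iT iP iQ2 oneideal by simp
  then have "T = Infinity"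
    using point_ideal_not_principal T on_curveD by (cases T) auto
  then show ?thesis unfolding T_def Q2_def QA
    by (cases P) (auto simp: short Let_def split: if_splits)
qed

lemma point_add_assoc_short:
  assumes P: "P \<in> rational_points E UNIV" and Q: "Q \<in> rational_points E UNIV"
    and S: "S \<in> rational_points E UNIV"
  shows "point_add E (point_add E P Q) S = point_add E P (point_add E Q S)"
proof -
  let ?I = point_ideal
  have PQ: "point_add E P Q \<in> rational_points E UNIV" and QS: "point_add E Q S \<in> rational_points E UNIV"
    using P Q S point_add_closed_short by blast+
  have L: "point_add E (point_add E P Q) S \<in> rational_points E UNIV"
    and Rt: "point_add E P (point_add E Q S) \<in> rational_points E UNIV"
    using P Q S PQ QS point_add_closed_short by blast+
  note i = ideal_point_ideal[OF P] ideal_point_ideal[OF Q] ideal_point_ideal[OF S] ideal_point_ideal[OF PQ]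
    ideal_point_ideal[OF QS] ideal_point_ideal[OF L] ideal_point_ideal[OF Rt]
  have 0: "sim (ideal_prod R (ideal_prod R (?I P) (?I Q)) (?I S)) (ideal_prod R (?I (point_add E P Q)) (?I S))"
    by (rule sim_mult[OF _ _ _ _ point_class_add[OF P Q] sim_refl]) (use i in simp_all)
  have 1: "sim (ideal_prod R (ideal_prod R (?I P) (?I Q)) (?I S)) (?I (point_add E (point_add E P Q) S))"
    by (rule sim_trans[OF _ _ _ 0 point_class_add[OF PQ S]]) (use i in simp_all)
  have 3: "sim (ideal_prod R (?I P) (ideal_prod R (?I Q) (?I S))) (ideal_prod R (?I P) (?I (point_add E Q S)))"
    by (rule sim_mult[OF _ _ _ _ sim_refl point_class_add[OF Q S]]) (use i in simp_all)
  have 2: "sim (ideal_prod R (?I P) (ideal_prod R (?I Q) (?I S))) (?I (point_add E P (point_add E Q S)))"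
    by (rule sim_trans[OF _ _ _ 3 point_class_add[OF P QS]]) (use i in simp_all)
  have eq: "ideal_prod R (ideal_prod R (?I P) (?I Q)) (?I S) = ideal_prod R (?I P) (ideal_prod R (?I Q) (?I S))"
    by (rule M.m_assoc) (use i in simp_all)
  have "sim (?I (point_add E (point_add E P Q) S)) (?I (point_add E P (point_add E Q S)))"
    by (rule sim_trans[OF _ _ _ sim_sym[OF 1[unfolded eq]] 2]) (use i in simp_all)
  then show ?thesis by (rule point_ideal_inj[OF L Rt])
qed

end

section \<open>Changes of coordinates and general Weierstrass curves\<close>

definition shift_curve :: "'a::field \<Rightarrow> 'a \<Rightarrow> 'a \<Rightarrow> 'a weierstrass_curve \<Rightarrow> 'a weierstrass_curve" where
  "shift_curve r l t E = \<lparr>a1 = a1 E + 2 * l, a2 = a2 E - l * a1 E + 3 * r - l\<^sup>2,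
     a3 = a3 E + r * a1 E + 2 * t,
     a4 = a4 E - l * a3 E + 2 * r * a2 E - (t + r * l) * a1 E + 3 * r\<^sup>2 - 2 * l * t,
     a6 = a6 E + r * a4 E + r\<^sup>2 * a2 E + r ^ 3 - t * a3 E - t\<^sup>2 - r * t * a1 E\<rparr>"

text \<open>The substitution \<open>x = x' + r\<close>, \<open>y = y' + l * x' + t\<close>. It
  serves twice: with \<open>r = 0\<close> it completes the square, which transports associativity
  from the short form, and at the end it moves \<open>P\<close> to the origin with a horizontal
  tangent.\<close>

fun shift_point :: "'a::field \<Rightarrow> 'a \<Rightarrow> 'a \<Rightarrow> 'a point \<Rightarrow> 'a point" where
  "shift_point r l t Infinity = Infinity"
| "shift_point r l t (Affine x y) = Affine (x - r) (y - l * (x - r) - t)"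

lemma shift_curve_simps [simp]:
  "a1 (shift_curve r l t E) = a1 E + 2 * l"
  "a2 (shift_curve r l t E) = a2 E - l * a1 E + 3 * r - l\<^sup>2"
  "a3 (shift_curve r l t E) = a3 E + r * a1 E + 2 * t"
  "a4 (shift_curve r l t E) = a4 E - l * a3 E + 2 * r * a2 E - (t + r * l) * a1 E + 3 * r\<^sup>2 - 2 * l * t"
  "a6 (shift_curve r l t E) = a6 E + r * a4 E + r\<^sup>2 * a2 E + r ^ 3 - t * a3 E - t\<^sup>2 - r * t * a1 E"
  by (simp_all add: shift_curve_def)

lemma on_curve_shift:
  "on_curve (shift_curve r l t E) (x - r) (y - l * (x - r) - t) \<longleftrightarrow> on_curve E x y"
proof -
  have "(y - l * (x - r) - t)\<^sup>2 + a1 (shift_curve r l t E) * (x - r) * (y - l * (x - r) - t)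
      + a3 (shift_curve r l t E) * (y - l * (x - r) - t)
      - ((x - r) ^ 3 + a2 (shift_curve r l t E) * (x - r)\<^sup>2 + a4 (shift_curve r l t E) * (x - r) + a6 (shift_curve r l t E))
    = y\<^sup>2 + a1 E * x * y + a3 E * y - (x ^ 3 + a2 E * x\<^sup>2 + a4 E * x + a6 E)"
    unfolding shift_curve_simps by (simp add: algebra_simps power2_eq_square power3_eq_cube)
  then show ?thesis unfolding on_curve_def by (metis eq_iff_diff_eq_0)
qed

lemma Affine_in_rational_points:
  "Affine x y \<in> rational_points E L \<longleftrightarrow> x \<in> L \<and> y \<in> L \<and> on_curve E x y"
  by (auto simp: rational_points_def on_curve_def)

lemma Infinity_in_rational_points [simp]: "Infinity \<in> rational_points E L"
  by (simp add: rational_points_def)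

lemma shift_point_in_iff:
  "shift_point r l t P \<in> rational_points (shift_curve r l t E) UNIV \<longleftrightarrow> P \<in> rational_points E UNIV"
  by (cases P) (simp_all add: Affine_in_rational_points on_curve_shift)

lemma inj_shift_point: "shift_point r l t P = shift_point r l t Q \<Longrightarrow> P = Q"
  by (cases P; cases Q) auto

text \<open>Slopes drop by \<open>l\<close> under the substitution; for a tangent the reason is that
  the numerator of the slope drops by \<open>l\<close> times its denominator.\<close>

lemma shift_point_add:
  fixes E :: "'a::field weierstrass_curve"
  assumes "P \<in> rational_points E UNIV" "Q \<in> rational_points E UNIV"
  shows "point_add (shift_curve r l t E) (shift_point r l t P) (shift_point r l t Q) = shift_point r l t (point_add E P Q)"
proof (cases P; cases Q)
  fix x1 y1 x2 y2 assume PQ: "P = Affine x1 y1" "Q = Affine x2 y2"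
  let ?E = "shift_curve r l t E"
  let ?y1 = "y1 - l * (x1 - r) - t" and ?y2 = "y2 - l * (x2 - r) - t"
  have c: "?y1 + ?y2 + a1 ?E * (x2 - r) + a3 ?E = y1 + y2 + a1 E * x2 + a3 E" if "x1 = x2"
    using that by (simp add: algebra_simps)
  show ?thesis
  proof (cases "x1 = x2 \<and> y1 + y2 + a1 E * x2 + a3 E = 0")
    case True
    with c show ?thesis by (simp add: PQ del: shift_curve_simps)
  next
    case False
    define m where "m = (if x1 = x2
                 then (3 * x1\<^sup>2 + 2 * a2 E * x1 + a4 E - a1 E * y1) / (2 * y1 + a1 E * x1 + a3 E)
                 else (y2 - y1) / (x2 - x1))"
    define m' where "m' = (if x1 - r = x2 - r
                 then (3 * (x1 - r)\<^sup>2 + 2 * a2 ?E * (x1 - r) + a4 ?E - a1 ?E * ?y1) / (2 * ?y1 + a1 ?E * (x1 - r) + a3 ?E)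
                 else (?y2 - ?y1) / ((x2 - r) - (x1 - r)))"
    have nz: "2 * y1 + a1 E * x1 + a3 E \<noteq> 0" if "x1 = x2"
    proof -
      have "(y1 - y2) * (y1 + y2 + a1 E * x2 + a3 E) = 0"
        using assms that unfolding PQ Affine_in_rational_points on_curve_def
        by (simp add: algebra_simps power2_eq_square)
      with False that have "y1 = y2" by auto
      then have "2 * y1 + a1 E * x1 + a3 E = y1 + y2 + a1 E * x2 + a3 E" using that by simp
      with False that show ?thesis by (simp only:) simp
    qed
    have m': "m' = m - l"
    proof (cases "x1 = x2")
      case True
      have d: "2 * ?y1 + a1 ?E * (x1 - r) + a3 ?E = 2 * y1 + a1 E * x1 + a3 E"
        by (simp add: algebra_simps)
      have n: "3 * (x1 - r)\<^sup>2 + 2 * a2 ?E * (x1 - r) + a4 ?E - a1 ?E * ?y1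
        = 3 * x1\<^sup>2 + 2 * a2 E * x1 + a4 E - a1 E * y1 - l * (2 * y1 + a1 E * x1 + a3 E)"
        unfolding shift_curve_simps by (simp add: algebra_simps power2_eq_square)
      show ?thesis using True nz unfolding m_def m'_def d n by (simp add: diff_divide_distrib)
    next
      case False
      then show ?thesis unfolding m_def m'_def by (simp add: field_simps)
    qed
    define x3 where "x3 = m\<^sup>2 + a1 E * m - a2 E - x1 - x2"
    define x3' where "x3' = m'\<^sup>2 + a1 ?E * m' - a2 ?E - (x1 - r) - (x2 - r)"
    have add: "point_add E P Q = Affine x3 (- (m + a1 E) * x3 - (y1 - m * x1) - a3 E)"
      using False unfolding PQ point_add.simps Let_def m_def x3_def by simp
    have nc: "\<not> (x1 - r = x2 - r \<and> ?y1 + ?y2 + a1 ?E * (x2 - r) + a3 ?E = 0)"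
    proof
      assume *: "x1 - r = x2 - r \<and> ?y1 + ?y2 + a1 ?E * (x2 - r) + a3 ?E = 0"
      then have "x1 = x2" by simp
      from c[OF this] * False \<open>x1 = x2\<close> show False by (simp only:) blast
    qed
    have add': "point_add ?E (shift_point r l t P) (shift_point r l t Q)
       = Affine x3' (- (m' + a1 ?E) * x3' - (?y1 - m' * (x1 - r)) - a3 ?E)"
      unfolding PQ shift_point.simps point_add.simps Let_def m'_def x3'_def if_not_P[OF nc] ..
    have x3': "x3' = x3 - r"
      unfolding x3'_def x3_def m' shift_curve_simps by (simp add: algebra_simps power2_eq_square)
    show ?thesis unfolding add add' shift_point.simps x3' m' shift_curve_simps
      by (simp add: algebra_simps)
  qed
qed auto

definition nonsingular_curve :: "'a::field weierstrass_curve \<Rightarrow> bool" where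
  "nonsingular_curve E \<longleftrightarrow> (\<forall>x y. on_curve E x y \<longrightarrow>
     2 * y + a1 E * x + a3 E = 0 \<longrightarrow> 3 * x\<^sup>2 + 2 * a2 E * x + a4 E = a1 E * y \<longrightarrow> False)"

text \<open>Solving the three equations of a singular point for \<open>a3\<close>, \<open>a4\<close>
  and \<open>a6\<close> and substituting makes the discriminant vanish identically.\<close>

lemma nonsingular_curve_if_discriminant:
  assumes "discriminant E \<noteq> 0"
  shows "nonsingular_curve E"
  unfolding nonsingular_curve_def
proof (intro allI impI)
  fix x y
  assume 1: "on_curve E x y" and 2: "2 * y + a1 E * x + a3 E = 0" and 3: "3 * x\<^sup>2 + 2 * a2 E * x + a4 E = a1 E * y"
  have a3: "a3 E = - 2 * y - a1 E * x" using 2 by (simp add: algebra_simps eq_neg_iff_add_eq_0)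
  have a4: "a4 E = a1 E * y - 3 * x\<^sup>2 - 2 * a2 E * x" using 3 by (simp add: algebra_simps)
  have a6: "a6 E = y\<^sup>2 + a1 E * x * y + a3 E * y - x ^ 3 - a2 E * x\<^sup>2 - a4 E * x"
    using 1 unfolding on_curve_def by (simp add: algebra_simps)
  have "discriminant E = 0"
    unfolding discriminant_def Let_def a6 a4 a3
    by (simp add: algebra_simps power2_eq_square power3_eq_cube)
  with assms show False by simp
qed

lemma nonsingular_curve_shift:
  assumes "nonsingular_curve E"
  shows "nonsingular_curve (shift_curve r l t E)"
  unfolding nonsingular_curve_def
proof (intro allI impI)
  fix x' y'
  let ?E = "shift_curve r l t E"
  define x y where xy: "x = x' + r" "y = y' + l * x' + t"
  assume "on_curve ?E x' y'" and 2: "2 * y' + a1 ?E * x' + a3 ?E = 0"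
    and 3: "3 * x'\<^sup>2 + 2 * a2 ?E * x' + a4 ?E = a1 ?E * y'"
  then have "on_curve E x y"
    using on_curve_shift[of r l t E x y] by (simp add: xy)
  moreover have y: "2 * y + a1 E * x + a3 E = 0"
    using 2 by (simp add: xy algebra_simps)
  moreover have "3 * x\<^sup>2 + 2 * a2 E * x + a4 E - a1 E * y =
     3 * x'\<^sup>2 + 2 * a2 ?E * x' + a4 ?E - a1 ?E * y' + l * (2 * y + a1 E * x + a3 E)"
    by (simp add: xy algebra_simps power2_eq_square)
  then have "3 * x\<^sup>2 + 2 * a2 E * x + a4 E = a1 E * y" unfolding y 3 by simp
  ultimately show False using assms unfolding nonsingular_curve_def by blast
qed

lemma short_curve_shift:
  fixes E :: "'a::field_char_0 weierstrass_curve"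
  assumes "nonsingular_curve E"
  shows "short_curve (shift_curve 0 (- a1 E / 2) (- a3 E / 2) E)" (is "short_curve ?E")
proof
  show "a1 ?E = 0" "a3 ?E = 0" by simp_all
  fix x assume x: "poly [:a6 ?E, a4 ?E, a2 ?E, 1:] x = 0"
  show "poly (pderiv [:a6 ?E, a4 ?E, a2 ?E, 1:]) x \<noteq> 0"
  proof
    assume d: "poly (pderiv [:a6 ?E, a4 ?E, a2 ?E, 1:]) x = 0"
    have ns: "nonsingular_curve ?E" using assms by (rule nonsingular_curve_shift)
    have "on_curve ?E x 0" using x unfolding on_curve_def
      by (simp del: shift_curve_simps add: algebra_simps power2_eq_square power3_eq_cube)
    moreover have "2 * 0 + a1 ?E * x + a3 ?E = 0" by simp
    moreover have "3 * x\<^sup>2 + 2 * a2 ?E * x + a4 ?E = a1 ?E * 0"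
      using d by (simp del: shift_curve_simps add: pderiv_pCons algebra_simps power2_eq_square)
    ultimately show False using ns unfolding nonsingular_curve_def by blast
  qed
qed

lemma
  fixes E :: "'a::field_char_0 weierstrass_curve"
  assumes ns: "nonsingular_curve E"
    and P: "P \<in> rational_points E UNIV" and Q: "Q \<in> rational_points E UNIV"
  shows point_add_closed: "point_add E P Q \<in> rational_points E UNIV"
    and point_add_assoc: "S \<in> rational_points E UNIV \<Longrightarrow>
      point_add E (point_add E P Q) S = point_add E P (point_add E Q S)"
proof -
  let ?l = "- a1 E / 2" and ?t = "- a3 E / 2"
  let ?E = "shift_curve 0 ?l ?t E" and ?s = "shift_point 0 ?l ?t"
  interpret short_curve ?E using ns by (rule short_curve_shift)
  have cl: "point_add E P Q \<in> rational_points E UNIV" if "P \<in> rational_points E UNIV" "Q \<in> rational_points E UNIV" for P Q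
    using point_add_closed_short[of "?s P" "?s Q"] that
    by (simp only: shift_point_in_iff shift_point_add)
  then show "point_add E P Q \<in> rational_points E UNIV" using P Q by blast
  assume S: "S \<in> rational_points E UNIV"
  have "?s (point_add E (point_add E P Q) S) = ?s (point_add E P (point_add E Q S))"
    using point_add_assoc_short[of "?s P" "?s Q" "?s S"] P Q S cl
    by (simp only: shift_point_in_iff shift_point_add)
  then show "point_add E (point_add E P Q) S = point_add E P (point_add E Q S)"
    by (rule inj_shift_point)
qed

lemma point_add_commute:
  fixes E :: "'a::field_char_0 weierstrass_curve"
  assumes "P \<in> rational_points E UNIV" and "Q \<in> rational_points E UNIV"
  shows "point_add E P Q = point_add E Q P"
proof (cases P; cases Q)
  fix x1 y1 x2 y2 assume PQ: "P = Affine x1 y1" "Q = Affine x2 y2"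
  show ?thesis
  proof (cases "x1 = x2")
    case True
    have "(y1 - y2) * (y1 + y2 + a1 E * x2 + a3 E) = 0"
      using assms True unfolding PQ Affine_in_rational_points on_curve_def
      by (simp add: algebra_simps power2_eq_square)
    then consider "y1 = y2" | "y1 + y2 + a1 E * x2 + a3 E = 0" by auto
    then show ?thesis
    proof cases
      case 2
      then have "y2 + y1 + a1 E * x1 + a3 E = 0" using True by (simp only: add.commute)
      with 2 True show ?thesis by (simp add: PQ)
    qed (simp add: PQ True)
  next
    case False
    define m where "m = (y2 - y1) / (x2 - x1)"
    have m: "(y1 - y2) / (x1 - x2) = m" unfolding m_def by (metis minus_diff_eq minus_divide_divide)
    have k: "y2 - m * x2 = y1 - m * x1"
      using False unfolding m_def by (simp add: field_simps)
    show ?thesis using False unfolding PQ point_add.simps Let_def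
      by (simp add: m k algebra_simps flip: m_def)
  qed
qed auto

section \<open>Points over subfields\<close>

lemma rational_points_mono: "L \<subseteq> M \<Longrightarrow> rational_points E L \<subseteq> rational_points E M"
  by (auto simp: rational_points_def)

lemma is_subfieldD:
  assumes "is_subfield L"
  shows "0 \<in> L" "1 \<in> L" "x \<in> L \<Longrightarrow> y \<in> L \<Longrightarrow> x + y \<in> L" "x \<in> L \<Longrightarrow> y \<in> L \<Longrightarrow> x * y \<in> L"
    "x \<in> L \<Longrightarrow> - x \<in> L" "x \<in> L \<Longrightarrow> inverse x \<in> L" "x \<in> L \<Longrightarrow> y \<in> L \<Longrightarrow> x - y \<in> L"
    "x \<in> L \<Longrightarrow> y \<in> L \<Longrightarrow> x / y \<in> L" "x \<in> L \<Longrightarrow> x ^ n \<in> L" "of_nat n \<in> L" "numeral k \<in> L" "of_int i \<in> L"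
proof -
  show a: "0 \<in> L" "1 \<in> L" "x \<in> L \<Longrightarrow> y \<in> L \<Longrightarrow> x + y \<in> L" "x \<in> L \<Longrightarrow> y \<in> L \<Longrightarrow> x * y \<in> L"
    "x \<in> L \<Longrightarrow> - x \<in> L" "x \<in> L \<Longrightarrow> inverse x \<in> L" for x y
    using assms unfolding is_subfield_def by blast+
  show "x \<in> L \<Longrightarrow> y \<in> L \<Longrightarrow> x - y \<in> L" using a(3)[of x "- y"] a(5)[of y] by simp
  show "x \<in> L \<Longrightarrow> y \<in> L \<Longrightarrow> x / y \<in> L" using a(4)[of x "inverse y"] a(6)[of y] by (simp add: divide_inverse)
  show "x \<in> L \<Longrightarrow> x ^ n \<in> L" by (induction n) (use a in auto)
  show n: "of_nat n \<in> L" for n by (induction n) (use a in auto)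
  show "numeral k \<in> L" using n[of "numeral k"] by simp
  show "of_int i \<in> L" by (cases i rule: int_cases2) (use n a in auto)
qed

lemma point_add_rational:
  fixes E :: "'a::field_char_0 weierstrass_curve"
  assumes L: "is_subfield L" and E: "{a1 E, a2 E, a3 E, a4 E, a6 E} \<subseteq> L" and ns: "nonsingular_curve E"
    and P: "P \<in> rational_points E L" and Q: "Q \<in> rational_points E L"
  shows "point_add E P Q \<in> rational_points E L"
proof (cases P; cases Q)
  fix x1 y1 x2 y2 assume PQ: "P = Affine x1 y1" "Q = Affine x2 y2"
  have m: "x1 \<in> L" "y1 \<in> L" "x2 \<in> L" "y2 \<in> L" "a1 E \<in> L" "a2 E \<in> L" "a3 E \<in> L" "a4 E \<in> L" "a6 E \<in> L"
    using P Q E unfolding PQ Affine_in_rational_points by auto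
  have c: "point_add E P Q \<in> rational_points E UNIV"
    using point_add_closed[OF ns] P Q rational_points_mono[of L UNIV E] by blast
  show ?thesis
  proof (cases "x1 = x2 \<and> y1 + y2 + a1 E * x2 + a3 E = 0")
    case True
    then show ?thesis by (simp add: PQ)
  next
    case False
    define l where "l = (if x1 = x2
                 then (3 * x1\<^sup>2 + 2 * a2 E * x1 + a4 E - a1 E * y1) / (2 * y1 + a1 E * x1 + a3 E)
                 else (y2 - y1) / (x2 - x1))"
    define x3 where "x3 = l\<^sup>2 + a1 E * l - a2 E - x1 - x2"
    have eq: "point_add E P Q = Affine x3 (- (l + a1 E) * x3 - (y1 - l * x1) - a3 E)"
      using False unfolding PQ point_add.simps Let_def l_def x3_def by simp
    have l: "l \<in> L" unfolding l_def by (auto intro!: is_subfieldD[OF L] m)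
    have x3: "x3 \<in> L" unfolding x3_def by (intro is_subfieldD[OF L] m l)
    have "- (l + a1 E) * x3 - (y1 - l * x1) - a3 E \<in> L" by (intro is_subfieldD[OF L] m l x3)
    with x3 c show ?thesis unfolding eq Affine_in_rational_points by blast
  qed
qed (use assms in auto)

lemma on_curve_neg: "on_curve E x (- y - a1 E * x - a3 E) \<longleftrightarrow> on_curve E x y"
  unfolding on_curve_def by (simp add: algebra_simps power2_eq_square)

lemma point_add_neg: "point_add E (point_neg E P) P = Infinity" "point_add E P (point_neg E P) = Infinity"
  by (cases P; simp add: algebra_simps)+

lemma point_neg_rational:
  assumes L: "is_subfield L" and E: "{a1 E, a2 E, a3 E, a4 E, a6 E} \<subseteq> L" and P: "P \<in> rational_points E L"
  shows "point_neg E P \<in> rational_points E L"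
proof (cases P)
  case (Affine x y)
  with P E show ?thesis
    by (auto simp: Affine_in_rational_points on_curve_neg intro!: is_subfieldD[OF L])
qed simp

lemma comm_group_mordell_weil:
  fixes E :: "'a::field_char_0 weierstrass_curve"
  assumes L: "is_subfield L" and E: "{a1 E, a2 E, a3 E, a4 E, a6 E} \<subseteq> L" and ns: "nonsingular_curve E"
  shows "comm_group (mordell_weil_group E L)"
proof -
  have sub: "P \<in> rational_points E UNIV" if "P \<in> rational_points E L" for P
    using that rational_points_mono[of L UNIV E] by blast
  show ?thesis
  proof (rule comm_groupI)
    fix P assume "P \<in> carrier (mordell_weil_group E L)"
    then show "\<exists>Q\<in>carrier (mordell_weil_group E L). Q \<otimes>\<^bsub>mordell_weil_group E L\<^esub> P = \<one>\<^bsub>mordell_weil_group E L\<^esub>"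
      using point_neg_rational[OF L E] point_add_neg by (auto simp: mordell_weil_group_def)
  next
    fix P Q assume "P \<in> carrier (mordell_weil_group E L)" "Q \<in> carrier (mordell_weil_group E L)"
    then show "P \<otimes>\<^bsub>mordell_weil_group E L\<^esub> Q = Q \<otimes>\<^bsub>mordell_weil_group E L\<^esub> P"
      using point_add_commute[of P E Q] sub by (simp add: mordell_weil_group_def)
  qed (use point_add_rational[OF L E ns] point_add_assoc[OF ns] sub
       in \<open>auto simp: mordell_weil_group_def\<close>)
qed

section \<open>Polynomials over subfields and primitive elements\<close>

definition polys_over :: "'a::field set \<Rightarrow> 'a poly set" where
  "polys_over F = {p. \<forall>i. coeff p i \<in> F}"

lemma sum_in_subfield: "is_subfield F \<Longrightarrow> (\<And>i. i \<in> I \<Longrightarrow> g i \<in> F) \<Longrightarrow> sum g I \<in> F"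
  by (induction I rule: infinite_finite_induct) (auto simp: is_subfieldD)

lemma polys_over_intros:
  assumes F: "is_subfield F"
  shows "0 \<in> polys_over F" "1 \<in> polys_over F"
    "p \<in> polys_over F \<Longrightarrow> q \<in> polys_over F \<Longrightarrow> p + q \<in> polys_over F"
    "p \<in> polys_over F \<Longrightarrow> q \<in> polys_over F \<Longrightarrow> p - q \<in> polys_over F"
    "p \<in> polys_over F \<Longrightarrow> q \<in> polys_over F \<Longrightarrow> p * q \<in> polys_over F"
    "p \<in> polys_over F \<Longrightarrow> - p \<in> polys_over F"
    "a \<in> F \<Longrightarrow> p \<in> polys_over F \<Longrightarrow> pCons a p \<in> polys_over F"
    "a \<in> F \<Longrightarrow> p \<in> polys_over F \<Longrightarrow> smult a p \<in> polys_over F"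
    "p \<in> polys_over F \<Longrightarrow> p ^ n \<in> polys_over F"
    "a \<in> F \<Longrightarrow> monom a n \<in> polys_over F"
    "numeral k \<in> polys_over F"
proof -
  show *: "p \<in> polys_over F \<Longrightarrow> q \<in> polys_over F \<Longrightarrow> p * q \<in> polys_over F" for p q
    unfolding polys_over_def coeff_mult mem_Collect_eq
    by (intro allI sum_in_subfield[OF F] is_subfieldD[OF F]) auto
  show 1: "1 \<in> polys_over F" by (auto simp: polys_over_def coeff_1 is_subfieldD[OF F])
  show "p \<in> polys_over F \<Longrightarrow> p ^ n \<in> polys_over F"
    by (induction n) (simp_all add: 1 *)
  show "numeral k \<in> polys_over F"
    by (simp add: numeral_poly polys_over_def coeff_pCons is_subfieldD[OF F] split: nat.split)
qed (auto simp: polys_over_def coeff_pCons is_subfieldD[OF F] split: nat.split)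

lemma poly_in_subfield:
  assumes F: "is_subfield F" and "p \<in> polys_over F" "x \<in> F"
  shows "poly p x \<in> F"
  using assms(2,3) unfolding polys_over_def poly_altdef
  by (intro sum_in_subfield[OF F] is_subfieldD[OF F]) auto

lemma polys_over_division:
  assumes F: "is_subfield F" and q: "q \<in> polys_over F" "q \<noteq> 0" and "p \<in> polys_over F"
  shows "\<exists>r\<in>polys_over F. \<exists>s\<in>polys_over F. p = q * r + s \<and> (s = 0 \<or> degree s < degree q)"
  using assms(4)
proof (induction "degree p" arbitrary: p rule: less_induct)
  case less
  show ?case
  proof (cases "p = 0 \<or> degree p < degree q")
    case True
    then show ?thesis using less.prems polys_over_intros(1)[OF F]
      by (intro bexI[of _ 0] bexI[of _ p]) auto
  next
    case False
    define m where "m = monom (lead_coeff p / lead_coeff q) (degree p - degree q)"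
    have m: "m \<in> polys_over F"
      unfolding m_def using q less.prems
      by (intro polys_over_intros(10)[OF F] is_subfieldD[OF F]) (auto simp: polys_over_def)
    define p' where "p' = p - q * m"
    have p': "p' \<in> polys_over F" unfolding p'_def using m q less.prems by (intro polys_over_intros[OF F])
    have "p' = 0 \<or> degree p' < degree p"
    proof (cases "degree p = 0")
      case True
      then have "degree q = 0" using False by simp
      then obtain a b where "p = [:a:]" "q = [:b:]" using True by (auto elim!: degree_eq_zeroE)
      then have "p' = 0" using q(2) by (simp add: p'_def m_def monom_0)
      then show ?thesis ..
    next
      case dp: False
      have qm: "degree (q * m) = degree p"
        using False q(2) by (simp add: m_def degree_mult_eq degree_monom_eq)
      have "coeff p' (degree p) = lead_coeff p - lead_coeff (q * m)"
        by (simp add: p'_def qm)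
      also have "lead_coeff (q * m) = lead_coeff p"
        using False q(2) unfolding lead_coeff_mult by (simp add: m_def degree_monom_eq)
      finally have "coeff p' (degree p) = 0" by simp
      moreover have "degree p' \<le> degree p" unfolding p'_def using qm by (intro degree_diff_le) auto
      ultimately show ?thesis using dp
        by (metis le_neq_implies_less leading_coeff_0_iff)
    qed
    then show ?thesis
    proof
      assume "p' = 0"
      then show ?thesis using m polys_over_intros(1)[OF F]
        by (intro bexI[of _ m] bexI[of _ 0]) (auto simp: p'_def)
    next
      assume "degree p' < degree p"
      from less.hyps[OF this p'] obtain r s where "r \<in> polys_over F" "s \<in> polys_over F"
        "p' = q * r + s" "s = 0 \<or> degree s < degree q" by blast
      then show ?thesis using m polys_over_intros(3)[OF F]
        by (intro bexI[of _ "m + r"] bexI[of _ s]) (auto simp: p'_def algebra_simps)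
    qed
  qed
qed

lemma minimal_polynomial:
  assumes F: "is_subfield F" and "p \<in> polys_over F" "p \<noteq> 0" "poly p x = 0"
  obtains \<mu> where "\<mu> \<in> polys_over F" "\<mu> \<noteq> 0" "poly \<mu> x = 0"
    "\<And>q. q \<in> polys_over F \<Longrightarrow> poly q x = 0 \<Longrightarrow> \<exists>r\<in>polys_over F. q = \<mu> * r"
    "\<And>q. q \<in> polys_over F \<Longrightarrow> poly q x = 0 \<Longrightarrow> q \<noteq> 0 \<Longrightarrow> degree \<mu> \<le> degree q"
proof -
  define P where "P q \<longleftrightarrow> q \<in> polys_over F \<and> q \<noteq> 0 \<and> poly q x = 0" for q
  define \<mu> where "\<mu> = arg_min degree P"
  have "P p" using assms by (simp add: P_def)
  then have \<mu>: "P \<mu>" unfolding \<mu>_def by (rule arg_min_natI)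
  have min: "\<And>q. P q \<Longrightarrow> degree \<mu> \<le> degree q"
    unfolding \<mu>_def by (rule arg_min_nat_le)
  have "\<exists>r\<in>polys_over F. q = \<mu> * r" if q: "q \<in> polys_over F" "poly q x = 0" for q
  proof -
    obtain r s where rs: "r \<in> polys_over F" "s \<in> polys_over F" "q = \<mu> * r + s" "s = 0 \<or> degree s < degree \<mu>"
      using polys_over_division[OF F _ _ q(1), of \<mu>] \<mu> unfolding P_def by blast
    have "poly s x = 0" using rs(3) q(2) \<mu> by (simp add: P_def)
    then have "s = 0" using rs min[of s] by (force simp: P_def)
    with rs show ?thesis by auto
  qed
  with \<mu> min that show ?thesis unfolding P_def by blast
qed

section \<open>Integral polynomials and fields generated by one element\<close>

definition ipoly :: "int poly \<Rightarrow> 'a::field_char_0 \<Rightarrow> 'a" where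
  "ipoly u x = poly (map_poly of_int u) x"

lemma ipoly_0 [simp]: "ipoly 0 x = 0"
  by (simp add: ipoly_def)

lemma ipoly_pCons [simp]: "ipoly (pCons a u) x = of_int a + x * ipoly u x"
  by (cases "a = 0 \<and> u = 0") (auto simp: ipoly_def map_poly_pCons)

lemma ipoly_add [simp]: "ipoly (u + v) x = ipoly u x + ipoly v x"
  by (induction u v rule: poly_induct2) (simp_all add: algebra_simps)

lemma ipoly_smult [simp]: "ipoly (smult c u) x = of_int c * ipoly u x"
  by (induction u) (simp_all add: algebra_simps)

lemma ipoly_minus [simp]: "ipoly (- u) x = - ipoly u x"
  using ipoly_smult[of "-1" u x] by simp

lemma ipoly_diff [simp]: "ipoly (u - v) x = ipoly u x - ipoly v x"
  using ipoly_add[of u "- v" x] by simp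

lemma ipoly_mult [simp]: "ipoly (u * v) x = ipoly u x * ipoly v x"
  by (induction u) (simp_all add: algebra_simps)

lemma ipoly_pcompose: "ipoly (pcompose u v) x = ipoly u (ipoly v x)"
  by (induction u) (simp_all add: pcompose_pCons)

text \<open>Fractions of integral rather than rational polynomials: these can be reduced modulo a
  prime by sending \<open>\<theta>\<close> to an integer.\<close>

definition Q_adjoin :: "'a::field_char_0 \<Rightarrow> 'a set" where
  "Q_adjoin \<theta> = {ipoly u \<theta> / ipoly w \<theta> | u w. ipoly w \<theta> \<noteq> 0}"

lemma Q_adjoinI: "ipoly w \<theta> \<noteq> 0 \<Longrightarrow> ipoly u \<theta> / ipoly w \<theta> \<in> Q_adjoin \<theta>"
  by (auto simp: Q_adjoin_def)

lemma subfield_Q_adjoin: "is_subfield (Q_adjoin \<theta>)"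
  unfolding is_subfield_def
proof (intro conjI ballI)
  show "0 \<in> Q_adjoin \<theta>" using Q_adjoinI[of "[:1:]" \<theta> 0] by simp
  show "1 \<in> Q_adjoin \<theta>" using Q_adjoinI[of "[:1:]" \<theta> "[:1:]"] by simp
  fix x y assume "x \<in> Q_adjoin \<theta>" "y \<in> Q_adjoin \<theta>"
  then obtain u w u' w' where *: "x = ipoly u \<theta> / ipoly w \<theta>" "ipoly w \<theta> \<noteq> 0"
    "y = ipoly u' \<theta> / ipoly w' \<theta>" "ipoly w' \<theta> \<noteq> 0"
    unfolding Q_adjoin_def by blast
  show "x + y \<in> Q_adjoin \<theta>"
    using * Q_adjoinI[of "w * w'" \<theta> "u * w' + u' * w"] by (simp add: add_frac_eq mult.commute)
  show "x * y \<in> Q_adjoin \<theta>"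
    using * Q_adjoinI[of "w * w'" \<theta> "u * u'"] by simp
next
  fix x assume "x \<in> Q_adjoin \<theta>"
  then obtain u w where *: "x = ipoly u \<theta> / ipoly w \<theta>" "ipoly w \<theta> \<noteq> 0"
    unfolding Q_adjoin_def by blast
  show "- x \<in> Q_adjoin \<theta>" using * Q_adjoinI[of w \<theta> "- u"] by simp
  show "inverse x \<in> Q_adjoin \<theta>"
  proof (cases "ipoly u \<theta> = 0")
    case True
    with * \<open>x \<in> Q_adjoin \<theta>\<close> show ?thesis by simp
  next
    case False
    with * Q_adjoinI[of u \<theta> w] show ?thesis by simp
  qed
qed

lemma Q_adjoin_self: "\<theta> \<in> Q_adjoin \<theta>"
  using Q_adjoinI[of "[:1:]" \<theta> "[:0, 1:]"] by simp

lemma ipoly_in_subfield: "is_subfield F \<Longrightarrow> x \<in> F \<Longrightarrow> ipoly u x \<in> F"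
  by (induction u) (auto intro!: is_subfieldD)

lemma Q_adjoin_subset: "is_subfield F \<Longrightarrow> \<theta> \<in> F \<Longrightarrow> Q_adjoin \<theta> \<subseteq> F"
  by (auto simp: Q_adjoin_def intro!: is_subfieldD(8) ipoly_in_subfield)

text \<open>For \<open>\<theta> = \<alpha> + n * \<beta>\<close>, with \<open>n\<close> outside a
  finite set of quotients of root differences, \<open>g\<close> and \<open>f(\<theta> - n x)\<close>
  have only the root \<open>\<beta>\<close> in common. The minimal polynomial of
  \<open>\<beta>\<close> over the new field divides both and has \<open>\<beta>\<close> as a simple
  root, hence is linear.\<close>

lemma primitive_element:
  fixes \<alpha> \<beta> :: "'a::{alg_closed_field, field_char_0}"
  assumes "algebraic \<alpha>" "algebraic \<beta>"
  shows "\<exists>\<theta>. \<alpha> \<in> Q_adjoin \<theta> \<and> \<beta> \<in> Q_adjoin \<theta>"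
proof -
  have Q: "is_subfield (\<rat> :: 'a set)" unfolding is_subfield_def by auto
  obtain f where f: "f \<in> polys_over \<rat>" "f \<noteq> 0" "poly f \<alpha> = 0"
    using assms(1) unfolding algebraic_altdef polys_over_def by blast
  obtain g0 where g0: "g0 \<in> polys_over \<rat>" "g0 \<noteq> 0" "poly g0 \<beta> = 0"
    using assms(2) unfolding algebraic_altdef polys_over_def by blast
  obtain g where g: "g \<in> polys_over \<rat>" "g \<noteq> 0" "poly g \<beta> = 0"
    "\<And>q. q \<in> polys_over \<rat> \<Longrightarrow> poly q \<beta> = 0 \<Longrightarrow> q \<noteq> 0 \<Longrightarrow> degree g \<le> degree q"
    using minimal_polynomial[OF Q g0] by metis
  have dg: "degree g \<noteq> 0"
  proof
    assume "degree g = 0"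
    then obtain a where "g = [:a:]" by (elim degree_eq_zeroE)
    with g(2,3) show False by simp
  qed
  have simple: "poly (pderiv g) \<beta> \<noteq> 0"
  proof
    assume 0: "poly (pderiv g) \<beta> = 0"
    have "pderiv g \<in> polys_over \<rat>" using g(1) by (auto simp: polys_over_def coeff_pderiv)
    moreover have "pderiv g \<noteq> 0" using dg by (simp add: pderiv_eq_0_iff)
    ultimately have "degree g \<le> degree (pderiv g)" using g(4) 0 by blast
    with dg show False by (simp add: degree_pderiv)
  qed
  define A where "A = {x. poly f x = 0}"
  define B where "B = {x. poly g x = 0}"
  have fin: "finite ((\<lambda>(a, b). (a - \<alpha>) / (\<beta> - b)) ` (A \<times> B))" (is "finite ?D")
    unfolding A_def B_def using f(2) g(2) by (intro finite_imageI finite_cartesian_product poly_roots_finite)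
  have "infinite (range (of_nat :: nat \<Rightarrow> 'a))" by (simp add: inj_of_nat finite_image_iff)
  then obtain n :: nat where n: "of_nat n \<notin> ?D"
    using fin by (metis finite_subset image_subsetI)
  define \<theta> where "\<theta> = \<alpha> + of_nat n * \<beta>"
  define F where "F = Q_adjoin \<theta>"
  have F: "is_subfield F" unfolding F_def by (rule subfield_Q_adjoin)
  have QF: "\<rat> \<subseteq> F" using is_subfieldD[OF F] by (auto elim!: Rats_cases')
  have \<theta>: "\<theta> \<in> F" unfolding F_def by (rule Q_adjoin_self)
  have gF: "g \<in> polys_over F" using g(1) QF unfolding polys_over_def by blast
  define h where "h = pcompose f [:\<theta>, - of_nat n:]"
  have "p \<in> polys_over \<rat> \<Longrightarrow> pcompose p [:\<theta>, - of_nat n:] \<in> polys_over F" for p :: "'a poly"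
  proof (induction p)
    case (pCons a p)
    then have "a \<in> \<rat>" "p \<in> polys_over \<rat>"
      unfolding polys_over_def by (auto simp: coeff_pCons split: nat.splits)
    with pCons QF \<theta> show ?case unfolding pcompose_pCons
      by (auto intro!: polys_over_intros[OF F] is_subfieldD[OF F])
  qed (simp add: polys_over_intros[OF F])
  with f(1) have hF: "h \<in> polys_over F" unfolding h_def by blast
  have h\<beta>: "poly h \<beta> = 0" by (simp add: h_def poly_pcompose \<theta>_def f(3))
  obtain \<mu> where \<mu>: "\<mu> \<in> polys_over F" "\<mu> \<noteq> 0" "poly \<mu> \<beta> = 0"
    "\<And>q. q \<in> polys_over F \<Longrightarrow> poly q \<beta> = 0 \<Longrightarrow> \<exists>r\<in>polys_over F. q = \<mu> * r"
    using minimal_polynomial[OF F gF g(2,3)] by metis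
  obtain r1 where r1: "g = \<mu> * r1" using \<mu>(4)[OF gF g(3)] by blast
  obtain r2 where r2: "h = \<mu> * r2" using \<mu>(4)[OF hF h\<beta>] by blast
  have only: "b = \<beta>" if b: "poly \<mu> b = 0" for b
  proof (rule ccontr)
    assume ne: "b \<noteq> \<beta>"
    have "b \<in> B" using b by (simp add: B_def r1)
    moreover have "poly h b = 0" using b by (simp add: r2)
    then have "\<alpha> + of_nat n * (\<beta> - b) \<in> A"
      by (simp add: A_def h_def poly_pcompose \<theta>_def algebra_simps)
    ultimately have "(\<alpha> + of_nat n * (\<beta> - b) - \<alpha>) / (\<beta> - b) \<in> ?D" by force
    with n ne show False by simp
  qed
  obtain \<nu> where \<nu>: "\<mu> = [:-\<beta>, 1:] * \<nu>" using \<mu>(3) unfolding poly_eq_0_iff_dvd by (elim dvdE)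
  have "degree \<nu> = 0"
  proof (rule ccontr)
    assume "degree \<nu> \<noteq> 0"
    then obtain b where "poly \<nu> b = 0" using alg_closed_imp_poly_has_root[of \<nu>] by auto
    then have "poly \<nu> \<beta> = 0" using only[of b] by (auto simp: \<nu>)
    then show False using simple unfolding r1 \<nu>
      by (simp add: pderiv_mult pderiv_pCons del: mult_pCons_left mult_pCons_right)
  qed
  then obtain c where "\<nu> = [:c:]" by (elim degree_eq_zeroE)
  then have \<mu>c: "\<mu> = [:- (c * \<beta>), c:]" and "c \<noteq> 0" using \<nu> \<mu>(2) by auto
  have "coeff \<mu> 0 \<in> F" "coeff \<mu> 1 \<in> F" using \<mu>(1) unfolding polys_over_def by auto
  then have c: "- (c * \<beta>) \<in> F" "c \<in> F" unfolding \<mu>c by auto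
  have "- ((- (c * \<beta>)) / c) \<in> F" by (rule is_subfieldD(5)[OF F is_subfieldD(8)[OF F c]])
  moreover have "- ((- (c * \<beta>)) / c) = \<beta>" using \<open>c \<noteq> 0\<close> by simp
  ultimately have \<beta>: "\<beta> \<in> F" by (simp only:)
  then have "\<theta> - of_nat n * \<beta> \<in> F" by (intro is_subfieldD[OF F] \<theta>)
  then have "\<alpha> \<in> F" by (simp add: \<theta>_def)
  with \<beta> show ?thesis unfolding F_def by blast
qed

lemma finite_subset_Q_adjoin:
  fixes X :: "'a::{alg_closed_field, field_char_0} set"
  assumes alg: "\<And>x :: 'a. algebraic x" and "finite X"
  shows "\<exists>\<theta>. X \<subseteq> Q_adjoin \<theta>"
  using assms(2)
proof induction
  case (insert x X)
  then obtain \<theta>1 where "X \<subseteq> Q_adjoin \<theta>1" by blast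
  moreover obtain \<theta> where "x \<in> Q_adjoin \<theta>" "\<theta>1 \<in> Q_adjoin \<theta>"
    using primitive_element[OF alg alg] by blast
  ultimately show ?case
    using Q_adjoin_subset[OF subfield_Q_adjoin] by blast
qed auto

section \<open>Places of degree one\<close>

text \<open>
  Only values at nonzero elements of \<open>F\<close> are constrained. The last clause says that the residue field is
  the prime field.
\<close>

definition is_place :: "'a::field_char_0 set \<Rightarrow> nat \<Rightarrow> ('a \<Rightarrow> int) \<Rightarrow> bool" where
  "is_place F p v \<longleftrightarrow> prime p \<and>
     (\<forall>x\<in>F - {0}. \<forall>y\<in>F - {0}. v (x * y) = v x + v y) \<and>
     (\<forall>x\<in>F - {0}. \<forall>y\<in>F - {0}. x + y \<noteq> 0 \<longrightarrow> v (x + y) \<ge> min (v x) (v y)) \<and>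
     v (of_nat p) = 1 \<and> (\<forall>n. \<not> int p dvd n \<longrightarrow> v (of_int n) = 0) \<and>
     (\<forall>x\<in>F - {0}. v x \<ge> 0 \<longrightarrow> (\<exists>n. x = of_int n \<or> v (x - of_int n) \<ge> 1))"

text \<open>Euclid's argument for polynomial values. If the constant term \<open>c\<close> is
  nonzero, the value at \<open>c * M * k\<close> is \<open>c\<close> times a number congruent to 1
  modulo \<open>M = D * fact N\<close>, so the prime divisors of that number avoid \<open>D\<close>
  and exceed \<open>N\<close>. All but finitely many \<open>k\<close> keep it different from 1 and
  -1.\<close>

lemma prime_divisor_of_values:
  fixes h :: "int poly"
  assumes "degree h > 0" and "D \<noteq> (0::int)"
  shows "\<exists>p n. prime (p :: nat) \<and> p > N \<and> int p dvd poly h n \<and> \<not> int p dvd D"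
proof -
  define c where "c = coeff h 0"
  obtain p' where p': "h = pCons c p'" unfolding c_def by (metis coeff_pCons_0 pCons_cases)
  show ?thesis
  proof (cases "c = 0")
    case True
    obtain p where p: "prime p" "p > max N (nat \<bar>D\<bar>)" using bigger_prime by blast
    have "\<not> int p dvd D"
    proof
      assume "int p dvd D"
      then have "int p \<le> \<bar>D\<bar>" using dvd_imp_le_int[OF assms(2), of "int p"] by simp
      with p show False by linarith
    qed
    moreover have "int p dvd poly h 0" using True by (simp add: p')
    ultimately show ?thesis using p by (intro exI[of _ p] exI[of _ 0]) simp
  next
    case False
    define M where "M = D * fact N"
    have M: "M \<noteq> 0" using assms(2) by (simp add: M_def)
    define q where "q = pCons 1 (smult M (pcompose p' [:0, c * M:]))"
    have hq: "poly h (c * M * k) = c * poly q k" for k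
      by (simp add: p' q_def poly_pcompose algebra_simps)
    have "p' \<noteq> 0" using assms(1) p' by (auto split: if_splits)
    then have "smult M (pcompose p' [:0, c * M:]) \<noteq> 0"
      using M False by (auto simp: pcompose_eq_0_iff)
    then have dq: "degree q > 0" unfolding q_def by simp
    have "finite {k. poly (q - 1) k = 0}" "finite {k. poly (q + 1) k = 0}"
    proof -
      have "q \<noteq> 1" "q \<noteq> - 1" using dq by auto
      then have "q - 1 \<noteq> 0" "q + 1 \<noteq> 0" by (auto simp: add_eq_0_iff2)
      then show "finite {k. poly (q - 1) k = 0}" "finite {k. poly (q + 1) k = 0}"
        using poly_roots_finite by blast+
    qed
    then have "finite ({k. poly (q - 1) k = 0} \<union> {k. poly (q + 1) k = 0})" by simp
    then obtain k where "k \<notin> {k. poly (q - 1) k = 0} \<union> {k. poly (q + 1) k = 0}"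
      using infinite_UNIV_int by (metis UNIV_I ex_new_if_finite)
    then have k: "poly q k \<noteq> 1" "poly q k \<noteq> - 1" by (auto simp: add_eq_0_iff2)
    then have "nat \<bar>poly q k\<bar> \<noteq> 1" by linarith
    then obtain p where p: "prime p" "p dvd nat \<bar>poly q k\<bar>" using prime_factor_nat by blast
    then have "int p dvd int (nat \<bar>poly q k\<bar>)" by (simp only: of_nat_dvd_iff)
    then have pq: "int p dvd poly q k" by simp
    have pM: "\<not> int p dvd M"
    proof
      assume "int p dvd M"
      then have "int p dvd poly q k - k * M * poly p' (k * (c * M))" and "int p dvd k * M * poly p' (k * (c * M))"
        using pq by auto
      then have "int p dvd 1" by (simp add: q_def poly_pcompose algebra_simps)
      with p(1) show False by simp
    qed
    have "p > N"
    proof (rule ccontr)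
      assume "\<not> p > N"
      then have "p dvd fact N" using prime_ge_1_nat[OF p(1)] by (simp add: dvd_fact)
      then have "int p dvd fact N" by (metis of_nat_dvd_iff of_nat_fact)
      with pM show False unfolding M_def by simp
    qed
    moreover have "int p dvd poly h (c * M * k)" using pq unfolding hq by simp
    moreover have "\<not> int p dvd D" using pM unfolding M_def by auto
    ultimately show ?thesis using p(1) by blast
  qed
qed

section \<open>The local ring at a simple root modulo a prime\<close>

locale degree_one_place =
  fixes \<theta> :: "'a::field_char_0" and h :: "int poly" and p :: nat and n :: int
  assumes alg: "\<And>x :: 'a. algebraic x"
    and h: "h \<noteq> 0" "ipoly h \<theta> = 0" and h_min: "\<And>u. u \<noteq> 0 \<Longrightarrow> ipoly u \<theta> = 0 \<Longrightarrow> degree h \<le> degree u"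
    and p: "prime p" "int p dvd poly h n" "\<not> int p dvd lead_coeff h" "\<not> int p dvd poly (pderiv h) n"
begin

text \<open>The localization of the integral polynomials in \<open>\<theta>\<close> at the kernel of
  the reduction modulo \<open>p\<close> that sends \<open>\<theta>\<close> to \<open>n\<close>. It
  turns out to be a discrete valuation ring with uniformizer \<open>p\<close>.\<close>

definition R where "R = {ipoly u \<theta> / ipoly w \<theta> | u w. \<not> int p dvd poly w n}"

text \<open>This makes the reduction well defined. Pseudo-division by \<open>h\<close> leaves a
  remainder that is zero by minimality, and the multiplier, a power of the leading coefficient, is
  prime to \<open>p\<close>.\<close>

lemma reduce: "ipoly u \<theta> = 0 \<Longrightarrow> int p dvd poly u n"
proof -
  assume u: "ipoly u \<theta> = 0"
  obtain q r where qr: "pseudo_divmod u h = (q, r)" by (cases "pseudo_divmod u h")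
  define c where "c = coeff h (degree h) ^ (Suc (degree u) - degree h)"
  have 1: "smult c u = h * q + r" and 2: "r = 0 \<or> degree r < degree h"
    using pseudo_divmod[OF h(1) qr] by (simp_all add: c_def)
  have "ipoly r \<theta> = 0" using arg_cong[OF 1, of "\<lambda>z. ipoly z \<theta>"] u h(2) by simp
  then have "r = 0" using 2 h_min[of r] by force
  then have "c * poly u n = poly h n * poly q n" using arg_cong[OF 1, of "\<lambda>z. poly z n"] by simp
  then have "int p dvd c * poly u n" using p(2) by simp
  moreover have "\<not> int p dvd c" using p(1,3) prime_dvd_power[of "int p" "lead_coeff h"] unfolding c_def by auto
  ultimately show ?thesis using p(1) by (simp add: prime_dvd_mult_iff)
qed

lemma denominator_nonzero: "\<not> int p dvd poly w n \<Longrightarrow> ipoly w \<theta> \<noteq> 0"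
  using reduce by blast

lemma R_I: "\<not> int p dvd poly w n \<Longrightarrow> ipoly u \<theta> / ipoly w \<theta> \<in> R"
  unfolding R_def by blast

lemma p_not_dvd_1: "\<not> int p dvd 1" using prime_gt_1_nat[OF p(1)] by simp

lemma R_ipoly: "ipoly u \<theta> \<in> R"
  using R_I[of "[:1:]" u] p_not_dvd_1 by simp

lemma R_of_int: "of_int k \<in> R"
  using R_ipoly[of "[:k:]"] by simp

lemma R_of_nat: "of_nat k \<in> R"
  using R_of_int[of "int k"] by simp

lemma R_add: "x \<in> R \<Longrightarrow> y \<in> R \<Longrightarrow> x + y \<in> R"
proof -
  assume "x \<in> R" "y \<in> R"
  then obtain u w u' w' where *: "x = ipoly u \<theta> / ipoly w \<theta>" "\<not> int p dvd poly w n"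
    "y = ipoly u' \<theta> / ipoly w' \<theta>" "\<not> int p dvd poly w' n"
    unfolding R_def by blast
  then have "\<not> int p dvd poly (w * w') n" using p(1) by (simp add: prime_dvd_mult_iff)
  from R_I[OF this, of "u * w' + u' * w"] show ?thesis
    using * denominator_nonzero by (simp add: add_frac_eq mult.commute)
qed

lemma R_mult: "x \<in> R \<Longrightarrow> y \<in> R \<Longrightarrow> x * y \<in> R"
proof -
  assume "x \<in> R" "y \<in> R"
  then obtain u w u' w' where *: "x = ipoly u \<theta> / ipoly w \<theta>" "\<not> int p dvd poly w n"
    "y = ipoly u' \<theta> / ipoly w' \<theta>" "\<not> int p dvd poly w' n"
    unfolding R_def by blast
  then have "\<not> int p dvd poly (w * w') n" using p(1) by (simp add: prime_dvd_mult_iff)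
  from R_I[OF this, of "u * u'"] show ?thesis
    using * by simp
qed

lemma R_power: "x \<in> R \<Longrightarrow> x ^ k \<in> R"
  by (induction k) (use R_mult R_of_nat[of 1] in auto)

lemma R_ipoly': "x \<in> R \<Longrightarrow> ipoly u x \<in> R"
  by (induction u) (use R_add R_mult R_of_int R_of_nat[of 0] in auto)

lemma inverse_p_notin_R: "inverse (of_nat p) \<notin> R"
proof
  assume "inverse (of_nat p) \<in> R"
  then obtain u w where w: "\<not> int p dvd poly w n" and eq: "inverse (of_nat p) = ipoly u \<theta> / ipoly w \<theta>"
    unfolding R_def by blast
  have "ipoly (smult (int p) u - w) \<theta> = 0"
    using eq denominator_nonzero[OF w] p(1) by (simp add: field_simps prime_gt_0_nat)
  from reduce[OF this] have "int p dvd int p * poly u n - poly w n" by simp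
  then have "int p dvd poly w n" by (metis dvd_diff_right_iff dvd_triv_left)
  with w show False by blast
qed

text \<open>Here the simplicity of the root enters. From
  \<open>0 = h(\<theta>) = (\<theta> - n) h1(\<theta>) + h(n)\<close> with
  \<open>h1(n) = h'(n)\<close> prime to \<open>p\<close>, the element \<open>\<theta> - n\<close> is
  itself a multiple of \<open>p\<close>, so \<open>p\<close> alone generates the maximal
  ideal.\<close>

lemma R_divisible:
  assumes "int p dvd poly u n"
  shows "\<exists>r\<in>R. ipoly u \<theta> = of_nat p * r"
proof -
  have lin: "\<exists>q. f = [:-n, 1:] * q + [:poly f n:]" for f :: "int poly"
  proof -
    have "poly (f - [:poly f n:]) n = 0" by simp
    then obtain q where "f - [:poly f n:] = [:-n, 1:] * q" unfolding poly_eq_0_iff_dvd by (elim dvdE)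
    then show ?thesis by (metis diff_eq_eq)
  qed
  obtain q where q: "u = [:-n, 1:] * q + [:poly u n:]" using lin by blast
  obtain h1 where h1: "h = [:-n, 1:] * h1 + [:poly h n:]" using lin by blast
  have "poly (pderiv h) n = poly h1 n"
    using arg_cong[OF h1, of "\<lambda>z. poly (pderiv z) n"]
    by (simp add: pderiv_add pderiv_mult pderiv_pCons del: mult_pCons_left mult_pCons_right)
  with p(4) have h1n: "\<not> int p dvd poly h1 n" by simp
  obtain a where a: "poly u n = int p * a" using assms by (elim dvdE)
  obtain b where b: "poly h n = int p * b" using p(2) by (elim dvdE)
  have "0 = (\<theta> - of_int n) * ipoly h1 \<theta> + of_nat p * of_int b"
    using arg_cong[OF h1, of "\<lambda>z. ipoly z \<theta>"] h(2) b by (simp add: algebra_simps)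
  then have t: "\<theta> - of_int n = of_nat p * (ipoly [:-b:] \<theta> / ipoly h1 \<theta>)"
    using denominator_nonzero[OF h1n] by (simp add: field_simps eq_neg_iff_add_eq_0)
  have "ipoly u \<theta> = (\<theta> - of_int n) * ipoly q \<theta> + of_nat p * of_int a"
    using arg_cong[OF q, of "\<lambda>z. ipoly z \<theta>"] a by (simp add: algebra_simps)
  also have "\<dots> = of_nat p * ((ipoly [:-b:] \<theta> / ipoly h1 \<theta>) * ipoly q \<theta> + of_int a)"
    unfolding t by (simp add: algebra_simps)
  finally show ?thesis
    using R_add[OF R_mult[OF R_I[OF h1n] R_ipoly] R_of_int] by blast
qed

lemma R_local:
  assumes "x \<in> R"
  shows "(x \<noteq> 0 \<and> inverse x \<in> R) \<or> (\<exists>r\<in>R. x = of_nat p * r)"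
proof -
  obtain u w where *: "x = ipoly u \<theta> / ipoly w \<theta>" "\<not> int p dvd poly w n"
    using assms unfolding R_def by blast
  show ?thesis
  proof (cases "int p dvd poly u n")
    case True
    then obtain r where "r \<in> R" "ipoly u \<theta> = of_nat p * r" using R_divisible by blast
    moreover have "inverse (ipoly w \<theta>) \<in> R" using R_I[OF *(2), of "[:1:]"] by (simp add: inverse_eq_divide)
    ultimately have "x = of_nat p * (r * inverse (ipoly w \<theta>))" "r * inverse (ipoly w \<theta>) \<in> R"
      using * R_mult by (auto simp: divide_inverse)
    then show ?thesis by blast
  next
    case False
    then show ?thesis using * R_I[OF False, of w] denominator_nonzero by simp
  qed
qed

lemma of_int_unit:
  assumes "\<not> int p dvd k"
  shows "inverse (of_int k) \<in> R"
  using R_I[of "[:k:]" "[:1:]"] assms by (simp add: inverse_eq_divide)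

lemma p_notunit: "r \<in> R \<Longrightarrow> of_nat p * r \<noteq> 1"
  using inverse_p_notin_R by (metis inverse_unique)

text \<open>Termination: \<open>x\<close> divides a nonzero integer \<open>c\<close>, and a factor
  \<open>p\<close> taken out of \<open>x\<close> can be taken out of \<open>c\<close> as well, so
  the absolute value of \<open>c\<close> decreases.\<close>

lemma R_factor_aux:
  assumes "x \<in> R" "z \<in> R" "x * z = of_int c" "c \<noteq> 0"
  shows "\<exists>k::nat. \<exists>u\<in>R. u \<noteq> 0 \<and> inverse u \<in> R \<and> x = of_nat p ^ k * u"
  using assms
proof (induction "nat \<bar>c\<bar>" arbitrary: x c rule: less_induct)
  case less
  from R_local[OF less.prems(1)] show ?case
  proof
    assume "x \<noteq> 0 \<and> inverse x \<in> R"
    then show ?thesis using less.prems(1) by (intro exI[of _ 0] bexI[of _ x]) auto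
  next
    assume "\<exists>r\<in>R. x = of_nat p * r"
    then obtain r where r: "r \<in> R" "x = of_nat p * r" by blast
    have "int p dvd c"
    proof (rule ccontr)
      assume nd: "\<not> int p dvd c"
      have "of_nat p * ((r * z) * inverse (of_int c)) = 1"
        using less.prems(3,4) r(2) by (simp add: field_simps)
      then show False using p_notunit R_mult[OF R_mult[OF r(1) less.prems(2)] of_int_unit[OF nd]] by blast
    qed
    then obtain c' where c': "c = int p * c'" by (elim dvdE)
    have p2: "p \<ge> 2" using p(1) by (rule prime_ge_2_nat)
    then have "of_nat p * (r * z) = of_nat p * (of_int c' :: 'a)" using less.prems(3) r(2) c' by (simp add: algebra_simps)
    then have rz: "r * z = of_int c'" using p2 by simp
    have c0: "c' \<noteq> 0" using less.prems(4) c' by auto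
    have "\<bar>c'\<bar> < \<bar>c\<bar>" using c' c0 p2 by (simp add: abs_mult)
    then have "nat \<bar>c'\<bar> < nat \<bar>c\<bar>" by simp
    from less.hyps[OF this r(1) less.prems(2) rz c0] obtain k u where
      "u \<in> R" "u \<noteq> 0" "inverse u \<in> R" "r = of_nat p ^ k * u" by blast
    then show ?thesis using r by (intro exI[of _ "Suc k"] bexI[of _ u]) auto
  qed
qed

text \<open>Algebraicity supplies the integer: an integral equation with nonzero constant term
  exhibits that term as a multiple of \<open>x\<close> in \<open>R\<close>.\<close>

lemma R_factor:
  assumes "x \<in> R" "x \<noteq> 0"
  shows "\<exists>k::nat. \<exists>u\<in>R. u \<noteq> 0 \<and> inverse u \<in> R \<and> x = of_nat p ^ k * u"
proof -
  obtain q where q: "q \<noteq> 0" "coeff q 0 \<noteq> 0" "poly (map_poly of_int q) x = 0"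
    using algebraicE'_nonzero[OF alg assms(2)] by blast
  obtain q' where q': "q = pCons (coeff q 0) q'" by (metis coeff_pCons_0 pCons_cases)
  have "ipoly q x = 0" using q(3) by (simp add: ipoly_def)
  then have "x * ipoly (- q') x = of_int (coeff q 0)"
    by (subst (asm) q') (simp add: add_eq_0_iff2)
  from R_factor_aux[OF assms(1) R_ipoly'[OF assms(1)] this q(2)] show ?thesis .
qed

definition unit where "unit u \<longleftrightarrow> u \<in> R \<and> u \<noteq> 0 \<and> inverse u \<in> R"

lemma p0: "(of_nat p :: 'a) \<noteq> 0" using p(1) by (auto simp: prime_gt_0_nat)

lemma unit_mult: "unit u \<Longrightarrow> unit w \<Longrightarrow> unit (u * w)"
  unfolding unit_def by (auto intro: R_mult)

lemma unit_inverse: "unit u \<Longrightarrow> unit (inverse u)"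
  unfolding unit_def by auto

lemma factor:
  assumes "x \<in> Q_adjoin \<theta>" "x \<noteq> 0"
  shows "\<exists>k u. unit u \<and> x = of_nat p powi k * u"
proof -
  obtain a b where ab: "x = ipoly a \<theta> / ipoly b \<theta>" "ipoly a \<theta> \<noteq> 0" "ipoly b \<theta> \<noteq> 0"
    using assms unfolding Q_adjoin_def by auto
  obtain i u where iu: "unit u" "ipoly a \<theta> = of_nat p ^ i * u"
    using R_factor[OF R_ipoly ab(2)] unfolding unit_def by blast
  obtain j w where jw: "unit w" "ipoly b \<theta> = of_nat p ^ j * w"
    using R_factor[OF R_ipoly ab(3)] unfolding unit_def by blast
  have "x = of_nat p powi (int i - int j) * (u * inverse w)"
    using ab iu jw p0 by (simp add: power_int_diff field_simps)
  with unit_mult[OF iu(1) unit_inverse[OF jw(1)]] show ?thesis by blast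
qed

lemma factor_unique_aux:
  assumes "unit u" "unit w" "of_nat p powi i * u = of_nat p powi j * w" "i < j"
  shows False
proof -
  define k where "k = nat (j - i - 1)"
  have j: "j = i + 1 + int k" using assms(4) by (simp add: k_def)
  have "of_nat p powi i * u = of_nat p powi i * (of_nat p * (of_nat p ^ k * w))"
    using assms(3) p0 unfolding j by (simp add: power_int_add mult_ac)
  then have u: "u = of_nat p * (of_nat p ^ k * w)" using p0 by simp
  have "of_nat p * (of_nat p ^ k * w * inverse u) = u * inverse u" by (subst (2) u) simp
  also have "\<dots> = 1" using assms(1) by (simp add: unit_def)
  finally have "of_nat p * (of_nat p ^ k * w * inverse u) = 1" .
  moreover have "of_nat p ^ k * w * inverse u \<in> R"
    using assms(1,2) R_power[OF R_of_nat] unfolding unit_def by (intro R_mult) auto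
  ultimately show False using p_notunit by blast
qed

definition v where "v x = (THE k. \<exists>u. unit u \<and> x = of_nat p powi k * u)"

lemma v_eq: "unit u \<Longrightarrow> x = of_nat p powi k * u \<Longrightarrow> v x = k"
  unfolding v_def
proof (rule the_equality)
  fix j assume "unit u" "x = of_nat p powi k * u" "\<exists>u. unit u \<and> x = of_nat p powi j * u"
  then show "j = k" using factor_unique_aux by (metis linorder_neqE)
qed blast

lemma unit_1: "unit 1" using R_of_nat[of 1] by (simp add: unit_def)

lemma unit_of_int: "\<not> int p dvd k \<Longrightarrow> unit (of_int k)"
  using of_int_unit[of k] R_of_int[of k] by (auto simp: unit_def)

lemma v_pR: "r \<in> R \<Longrightarrow> of_nat p * r \<noteq> 0 \<Longrightarrow> v (of_nat p * r) \<ge> 1"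
proof -
  assume "r \<in> R" "of_nat p * r \<noteq> 0"
  then obtain k u where ku: "unit u" "r = of_nat p ^ k * u"
    using R_factor unfolding unit_def by (metis mult_not_zero)
  have "of_nat p * r = of_nat p powi (1 + int k) * u"
    using ku p0 by (simp add: power_int_add)
  from v_eq[OF ku(1) this] show ?thesis by simp
qed

lemma is_place_v: "is_place (Q_adjoin \<theta>) p v"
  unfolding is_place_def
proof (intro conjI ballI allI impI)
  fix x y assume x: "x \<in> Q_adjoin \<theta> - {0}" and y: "y \<in> Q_adjoin \<theta> - {0}"
  obtain i u where iu: "unit u" "x = of_nat p powi i * u" using factor x by blast
  obtain j w where jw: "unit w" "y = of_nat p powi j * w" using factor y by blast
  have vx: "v x = i" "v y = j" using v_eq iu jw by blast+
  have "x * y = of_nat p powi (i + j) * (u * w)" using iu jw p0 by (simp add: power_int_add)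
  from v_eq[OF unit_mult[OF iu(1) jw(1)] this] show "v (x * y) = v x + v y" by (simp add: vx)
  assume nz: "x + y \<noteq> 0"
  have *: "v (x + y) \<ge> i" if "i \<le> j" "unit u" "x = of_nat p powi i * u" "unit w" "y = of_nat p powi j * w" "x + y \<noteq> 0"
    for x y i j u w
  proof -
    obtain d where j: "j = i + int d" using \<open>i \<le> j\<close> zle_iff_zadd[of i j] by blast
    define z where "z = u + of_nat p ^ d * w"
    have xy: "x + y = of_nat p powi i * z"
      unfolding z_def that(3,5) j using p0 by (simp add: power_int_add algebra_simps)
    have "z \<in> R" "z \<noteq> 0"
      using that xy R_add R_mult R_power[OF R_of_nat] unfolding z_def unit_def by auto
    then obtain k t where kt: "unit t" "z = of_nat p ^ k * t" using R_factor unfolding unit_def by blast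
    have "x + y = of_nat p powi (i + int k) * t" unfolding xy kt(2) using p0 by (simp add: power_int_add)
    from v_eq[OF kt(1) this] show ?thesis by simp
  qed
  show "v (x + y) \<ge> min (v x) (v y)"
  proof (cases "i \<le> j")
    case True
    with *[OF True iu jw nz] show ?thesis by (simp add: vx)
  next
    case False
    then have "j \<le> i" by simp
    from *[OF this jw iu] nz show ?thesis by (simp add: vx add.commute)
  qed
next
  show "prime p" by (rule p)
  show "v (of_nat p) = 1" by (rule v_eq[OF unit_1]) simp
  show "v (of_int k) = 0" if "\<not> int p dvd k" for k
    by (rule v_eq[OF unit_of_int[OF that]]) simp
next
  fix x assume x: "x \<in> Q_adjoin \<theta> - {0}" and v: "0 \<le> v x"
  obtain i u where iu: "unit u" "x = of_nat p powi i * u" using factor x by blast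
  have "i \<ge> 0" using v v_eq[OF iu] by simp
  then have "x = of_nat p ^ nat i * u" using iu(2) by (simp add: power_int_def)
  then have "x \<in> R" using iu(1) R_mult[OF R_power[OF R_of_nat]] by (simp add: unit_def)
  then obtain a w where aw: "x = ipoly a \<theta> / ipoly w \<theta>" "\<not> int p dvd poly w n"
    unfolding R_def by blast
  have "coprime (int p) (poly w n)" using aw(2) p(1) by (simp add: prime_imp_coprime)
  then obtain s t where st: "s * int p + t * poly w n = 1"
    by (metis bezout_int coprime_imp_gcd_eq_1)
  \<comment> \<open>\<open>m\<close> represents the residue of \<open>x\<close>, because
    \<open>t\<close> inverts \<open>poly w n\<close> modulo \<open>p\<close>.\<close>
  define m where "m = t * poly a n"
  have "poly (a - smult m w) n = int p * (s * poly a n)"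
  proof -
    have "poly a n = (s * int p + t * poly w n) * poly a n" using st by simp
    then show ?thesis by (simp add: m_def algebra_simps)
  qed
  then have "int p dvd poly (a - smult m w) n" by simp
  then obtain r where r: "r \<in> R" "ipoly (a - smult m w) \<theta> = of_nat p * r" using R_divisible by blast
  have "x - of_int m = of_nat p * (r * inverse (ipoly w \<theta>))"
    using aw r denominator_nonzero[OF aw(2)] by (simp add: field_simps)
  moreover have "r * inverse (ipoly w \<theta>) \<in> R"
    using R_mult[OF r(1) R_I[OF aw(2), of "[:1:]"]] by (simp add: inverse_eq_divide)
  ultimately show "\<exists>k. x = of_int k \<or> 1 \<le> v (x - of_int k)"
    using v_pR by (metis eq_iff_diff_eq_0)
qed

text \<open>If \<open>p\<close> divided \<open>y\<close>, the equation would make \<open>p\<close>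
  divide the constant coefficient. The reversed polynomial gives the same contradiction for
  \<open>inverse y\<close> and the leading coefficient.\<close>

lemma v_unit:
  assumes "y \<in> Q_adjoin \<theta>" "y \<noteq> 0" and q: "ipoly q y = 0" "\<not> int p dvd coeff q 0" "\<not> int p dvd lead_coeff q"
  shows "v y = 0"
proof -
  have *: "\<not> (\<exists>r\<in>R. y = of_nat p * r)" if "ipoly q y = 0" "\<not> int p dvd coeff q 0" for q and y :: 'a
  proof
    assume "\<exists>r\<in>R. y = of_nat p * r"
    then obtain r where r: "r \<in> R" "y = of_nat p * r" by blast
    obtain q' where q': "q = pCons (coeff q 0) q'" by (metis coeff_pCons_0 pCons_cases)
    have yR: "y \<in> R" using r R_mult R_of_nat by blast
    have "of_int (coeff q 0) = - (y * ipoly q' y)"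
      using that(1) by (subst (asm) q') (simp add: eq_neg_iff_add_eq_0)
    also have "\<dots> = of_nat p * (r * ipoly (- q') y)" by (simp add: r(2))
    finally have c: "of_int (coeff q 0) = of_nat p * (r * ipoly (- q') y)" .
    have "of_nat p * (r * ipoly (- q') y * inverse (of_int (coeff q 0)))
        = of_int (coeff q 0) * inverse (of_int (coeff q 0) :: 'a)"
      unfolding c by (simp only: mult.assoc)
    also have "\<dots> = 1" using that(2) by (intro right_inverse) auto
    finally have "of_nat p * (r * ipoly (- q') y * inverse (of_int (coeff q 0))) = 1" .
    moreover have "r * ipoly (- q') y * inverse (of_int (coeff q 0)) \<in> R"
      by (intro R_mult r R_ipoly' yR of_int_unit that)
    ultimately show False using p_notunit by blast
  qed
  obtain i u where iu: "unit u" "y = of_nat p powi i * u" using factor assms by blast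
  have vi: "v y = i" using v_eq iu by blast
  have "\<not> i > 0"
  proof
    assume "i > 0"
    then obtain d where i: "i = 1 + int d" using zle_iff_zadd[of 1 i] by auto
    have "y = of_nat p * (of_nat p ^ d * u)"
      unfolding iu(2) i using p0 by (simp add: power_int_add)
    moreover have "of_nat p ^ d * u \<in> R"
      using iu(1) R_mult[OF R_power[OF R_of_nat]] by (simp add: unit_def)
    ultimately show False using *[OF q(1,2)] by blast
  qed
  moreover have "\<not> i < 0"
  proof
    assume "i < 0"
    then obtain d where i: "- i = 1 + int d" using zle_iff_zadd[of 1 "- i"] by auto
    have "inverse y = of_nat p powi (- i) * inverse u"
      using iu(2) by (simp add: power_int_minus)
    then have "inverse y = of_nat p * (of_nat p ^ d * inverse u)"
      unfolding i using p0 by (simp add: power_int_add)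
    moreover have "of_nat p ^ d * inverse u \<in> R"
      using iu(1) R_mult[OF R_power[OF R_of_nat]] by (simp add: unit_def)
    moreover have "ipoly (reflect_poly q) (inverse y) = 0"
    proof -
      have "map_poly of_int (reflect_poly q) = reflect_poly (map_poly of_int q :: 'a poly)"
        by (rule poly_eqI) (auto simp: coeff_map_poly coeff_reflect_poly degree_map_poly)
      then show ?thesis using q(1) assms(2) poly_reflect_poly_nz[of "inverse y" "map_poly of_int q"]
        by (simp add: ipoly_def)
    qed
    moreover have "\<not> int p dvd coeff (reflect_poly q) 0" using q(3) by simp
    ultimately show False using * by blast
  qed
  ultimately show ?thesis using vi by simp
qed

end

text \<open>The bad primes are collected in one integer \<open>D\<close>: those of the leading
  coefficient of \<open>h\<close>, of the constant coefficient of an equation for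
  \<open>h'(\<theta>)\<close>, which plays the part of a discriminant, and of the extreme
  coefficients of equations for the elements of \<open>Y\<close>.\<close>

lemma exists_place:
  fixes \<theta> :: "'a::field_char_0"
  assumes alg: "\<And>x :: 'a. algebraic x" and Y: "finite Y" "Y \<subseteq> Q_adjoin \<theta> - {0}"
  shows "\<exists>p v. p > N \<and> is_place (Q_adjoin \<theta>) p v \<and> (\<forall>y\<in>Y. v y = 0)"
proof -
  define P where "P u \<longleftrightarrow> u \<noteq> 0 \<and> ipoly u \<theta> = 0" for u
  define h where "h = arg_min degree P"
  obtain q0 where "P q0" using algebraicE'[OF alg, of \<theta>] unfolding P_def ipoly_def by blast
  then have h: "P h" unfolding h_def by (rule arg_min_natI)
  have min: "degree h \<le> degree u" if "P u" for u unfolding h_def using that by (rule arg_min_nat_le)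
  have dh: "degree h > 0"
  proof (rule ccontr)
    assume "\<not> degree h > 0"
    then obtain a where "h = [:a:]" by (auto elim: degree_eq_zeroE)
    with h show False by (simp add: P_def)
  qed
  have "ipoly (pderiv h) \<theta> \<noteq> 0"
  proof
    assume "ipoly (pderiv h) \<theta> = 0"
    moreover have "pderiv h \<noteq> 0" using dh by (simp add: pderiv_eq_0_iff)
    ultimately have "degree h \<le> degree (pderiv h)" using min by (simp add: P_def)
    with dh show False by (simp add: degree_pderiv)
  qed
  then obtain q1 where q1: "coeff q1 0 \<noteq> 0" "ipoly q1 (ipoly (pderiv h) \<theta>) = 0"
    using algebraicE'_nonzero[OF alg] unfolding ipoly_def by metis
  have "\<forall>y\<in>Y. \<exists>q. q \<noteq> 0 \<and> coeff q 0 \<noteq> 0 \<and> ipoly q y = 0"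
  proof
    fix y assume "y \<in> Y"
    then have "y \<noteq> 0" using Y by blast
    then obtain q where "q \<noteq> 0" "coeff q 0 \<noteq> 0" "poly (map_poly of_int q) y = 0"
      using algebraicE'_nonzero[OF alg] by blast
    then show "\<exists>q. q \<noteq> 0 \<and> coeff q 0 \<noteq> 0 \<and> ipoly q y = 0" unfolding ipoly_def by blast
  qed
  then obtain qy where qy: "\<And>y. y \<in> Y \<Longrightarrow> qy y \<noteq> 0 \<and> coeff (qy y) 0 \<noteq> 0 \<and> ipoly (qy y) y = 0"
    by metis
  define D where "D = lead_coeff h * coeff q1 0 * (\<Prod>y\<in>Y. coeff (qy y) 0 * lead_coeff (qy y))"
  have "D \<noteq> 0" unfolding D_def using h q1 qy Y(1) by (simp add: P_def)
  from prime_divisor_of_values[OF dh this] obtain p n where pn: "prime p" "p > N" "int p dvd poly h n" "\<not> int p dvd D"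
    by blast
  have "int p dvd poly (pcompose q1 (pderiv h)) n \<Longrightarrow> \<not> int p dvd poly (pderiv h) n"
  proof
    assume 1: "int p dvd poly (pcompose q1 (pderiv h)) n" and 2: "int p dvd poly (pderiv h) n"
    obtain q' where q': "q1 = pCons (coeff q1 0) q'" by (metis coeff_pCons_0 pCons_cases)
    have "int p dvd coeff q1 0 + poly (pderiv h) n * poly q' (poly (pderiv h) n)"
      using 1 by (subst (asm) q') (simp add: poly_pcompose)
    then have "int p dvd coeff q1 0" using 2 by (simp add: dvd_add_left_iff)
    with pn(4) show False unfolding D_def by simp
  qed note key = this
  \<comment> \<open>The reduction has to be available before the locale is interpreted, since it is
    what proves that the root is simple modulo \<open>p\<close>.\<close>
  have red: "int p dvd poly u n" if "ipoly u \<theta> = 0" for u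
  proof -
    obtain q r where qr: "pseudo_divmod u h = (q, r)" by (cases "pseudo_divmod u h")
    define c where "c = coeff h (degree h) ^ (Suc (degree u) - degree h)"
    have h0: "h \<noteq> 0" using h by (simp add: P_def)
    have 1: "smult c u = h * q + r" and 2: "r = 0 \<or> degree r < degree h"
      using pseudo_divmod[OF h0 qr] by (simp_all add: c_def)
    have "ipoly r \<theta> = 0" using arg_cong[OF 1, of "\<lambda>z. ipoly z \<theta>"] that h by (simp add: P_def)
    then have "r = 0" using 2 min[of r] unfolding P_def by force
    then have "c * poly u n = poly h n * poly q n" using arg_cong[OF 1, of "\<lambda>z. poly z n"] by simp
    then have "int p dvd c * poly u n" using pn(3) by simp
    moreover have "\<not> int p dvd c" using pn(1,4) prime_dvd_power[of "int p" "lead_coeff h"] unfolding c_def D_def by auto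
    ultimately show ?thesis using pn(1) by (simp add: prime_dvd_mult_iff)
  qed
  interpret degree_one_place \<theta> h p n
  proof
    show "\<not> int p dvd poly (pderiv h) n"
      by (rule key, rule red) (simp add: ipoly_pcompose q1)
    show "\<not> int p dvd lead_coeff h" using pn(4) unfolding D_def by auto
  qed (use alg h min pn in \<open>auto simp: P_def\<close>)
  have "v y = 0" if "y \<in> Y" for y
  proof (rule v_unit)
    have "coeff (qy y) 0 * lead_coeff (qy y) dvd D"
      unfolding D_def using dvd_prodI[OF Y(1) that, of "\<lambda>y. coeff (qy y) 0 * lead_coeff (qy y)"] by simp
    then show "\<not> int p dvd coeff (qy y) 0" "\<not> int p dvd lead_coeff (qy y)"
      using pn(4) by (meson dvd_mult dvd_mult2 dvd_trans)+
  qed (use that Y qy in auto)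
  with is_place_v pn(2) show ?thesis by blast
qed

text \<open>A place carries no information at 0; here 0 counts as infinitely divisible.\<close>

definition vge :: "('a::zero \<Rightarrow> int) \<Rightarrow> 'a \<Rightarrow> int \<Rightarrow> bool" where
  "vge v x k \<longleftrightarrow> x = 0 \<or> v x \<ge> k"

lemma vge_0 [simp]: "vge v 0 k"
  by (simp add: vge_def)

lemma vge_mono: "vge v x k \<Longrightarrow> j \<le> k \<Longrightarrow> vge v x j"
  by (auto simp: vge_def)

lemma polys_over_pConsD:
  assumes "pCons a q \<in> polys_over F"
  shows "a \<in> F" "q \<in> polys_over F"
proof -
  have *: "coeff (pCons a q) i \<in> F" for i using assms by (simp add: polys_over_def)
  show "a \<in> F" using *[of 0] by simp
  show "q \<in> polys_over F" unfolding polys_over_def using *[of "Suc i" for i] by simp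
qed

section \<open>Computing with a place\<close>

context
  fixes F :: "'a::field_char_0 set" and p v
  assumes F: "is_subfield F" and place: "is_place F p v"
begin

lemma place_mult: "x \<in> F \<Longrightarrow> y \<in> F \<Longrightarrow> x \<noteq> 0 \<Longrightarrow> y \<noteq> 0 \<Longrightarrow> v (x * y) = v x + v y"
  using place unfolding is_place_def by blast

lemma place_add: "x \<in> F \<Longrightarrow> y \<in> F \<Longrightarrow> x \<noteq> 0 \<Longrightarrow> y \<noteq> 0 \<Longrightarrow> x + y \<noteq> 0 \<Longrightarrow> v (x + y) \<ge> min (v x) (v y)"
  using place unfolding is_place_def by blast

lemma place_prime: "prime p"
  using place unfolding is_place_def by blast

lemma place_unit_int: "\<not> int p dvd n \<Longrightarrow> v (of_int n) = 0"
  using place unfolding is_place_def by blast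

lemma place_p: "v (of_nat p) = 1"
  using place unfolding is_place_def by blast

lemma place_one: "v 1 = 0"
  using place_unit_int[of 1] prime_gt_1_nat[OF place_prime] by simp

lemma place_minus: "x \<in> F \<Longrightarrow> v (- x) = v x"
proof (cases "x = 0")
  case False
  assume "x \<in> F"
  moreover have "v (of_int (- 1)) = 0"
    using prime_gt_1_nat[OF place_prime] by (intro place_unit_int) simp
  ultimately show ?thesis
    using place_mult[of "- 1" x] False is_subfieldD[OF F] by simp
qed simp

lemma vge_add: "x \<in> F \<Longrightarrow> y \<in> F \<Longrightarrow> vge v x k \<Longrightarrow> vge v y k \<Longrightarrow> vge v (x + y) k"
  using place_add[of x y]
  by (cases "x = 0"; cases "y = 0"; cases "x + y = 0") (auto simp: vge_def min_def split: if_splits)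

lemma vge_mult: "x \<in> F \<Longrightarrow> y \<in> F \<Longrightarrow> vge v x i \<Longrightarrow> vge v y j \<Longrightarrow> vge v (x * y) (i + j)"
  using place_mult[of x y] by (cases "x = 0"; cases "y = 0") (auto simp: vge_def)

lemma vge_minus: "x \<in> F \<Longrightarrow> vge v x k \<Longrightarrow> vge v (- x) k"
  using place_minus[of x] by (auto simp: vge_def)

lemma vge_diff: "x \<in> F \<Longrightarrow> y \<in> F \<Longrightarrow> vge v x k \<Longrightarrow> vge v y k \<Longrightarrow> vge v (x - y) k"
  using vge_add[of x "- y" k] vge_minus[of y k] is_subfieldD(5)[OF F, of y] by simp

lemma vge_of_nat: "vge v (of_nat n) 0"
proof (induction n)
  case (Suc n)
  have "vge v 1 0" by (simp add: vge_def place_one)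
  from vge_add[OF is_subfieldD(2)[OF F] is_subfieldD(10)[OF F] this Suc] show ?case by simp
qed simp

lemma vge_of_int: "vge v (of_int n) 0"
  by (cases n rule: int_cases2) (use vge_of_nat vge_minus is_subfieldD(10)[OF F] in auto)

text \<open>The strict form of the ultrametric inequality, obtained by writing \<open>x\<close> as
  the sum minus \<open>y\<close>.\<close>

lemma place_dominant:
  assumes "x \<in> F" "y \<in> F" "x \<noteq> 0" "vge v y (v x + 1)"
  shows "x + y \<noteq> 0 \<and> v (x + y) = v x"
proof (cases "y = 0")
  case False
  then have vy: "v y \<ge> v x + 1" using assms(4) by (simp add: vge_def)
  have nz: "x + y \<noteq> 0"
  proof
    assume "x + y = 0"
    then have "y = - x" by (simp add: add_eq_0_iff)
    with vy place_minus[OF assms(1)] show False by simp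
  qed
  have 1: "v (x + y) \<ge> v x" using place_add[OF assms(1,2,3) False nz] vy by linarith
  have "v ((x + y) + - y) \<ge> min (v (x + y)) (v (- y))"
    using assms False nz by (intro place_add is_subfieldD[OF F]) auto
  then have "v x \<ge> min (v (x + y)) (v y)" using place_minus[OF assms(2)] by simp
  with 1 vy nz show ?thesis by linarith
qed (use assms in auto)

lemma place_power: "x \<in> F \<Longrightarrow> x \<noteq> 0 \<Longrightarrow> v (x ^ n) = int n * v x"
proof (induction n)
  case (Suc n)
  then show ?case
    using place_mult[of x "x ^ n"] is_subfieldD(9)[OF F, of x n] by (simp add: algebra_simps)
qed (simp add: place_one)

text \<open>Since the residue field is prime, some integer is congruent to \<open>\<rho>\<close>. If
  the difference vanishes or has valuation above 1, adding \<open>p\<close> brings the valuation to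
  exactly 1.\<close>

lemma place_approx:
  assumes "\<rho> \<in> F" "vge v \<rho> 0"
  shows "\<exists>t. of_int t \<noteq> \<rho> \<and> v (of_int t - \<rho>) = 1"
proof -
  have p0: "(of_nat p :: 'a) \<noteq> 0" using prime_gt_0_nat[OF place_prime] by simp
  obtain n where n: "\<rho> = of_int n \<or> v (\<rho> - of_int n) \<ge> 1"
  proof (cases "\<rho> = 0")
    case True
    then have "\<rho> = of_int 0" by simp
    then show ?thesis using that by blast
  next
    case False
    with assms(2) have "v \<rho> \<ge> 0" by (simp add: vge_def)
    with False assms(1) place that show ?thesis unfolding is_place_def by blast
  qed
  let ?d = "of_int n - \<rho>"
  have dF: "?d \<in> F" using assms by (intro is_subfieldD[OF F])
  have d: "vge v ?d 1"
    using n place_minus[OF is_subfieldD(7)[OF F assms(1) is_subfieldD(12)[OF F, of n]]] by (auto simp: vge_def)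
  show ?thesis
  proof (cases "?d \<noteq> 0 \<and> v ?d = 1")
    case True
    then show ?thesis by (intro exI[of _ n]) auto
  next
    case False
    then have "vge v ?d (v (of_nat p) + 1)" using d unfolding vge_def place_p by auto
    from place_dominant[OF is_subfieldD(10)[OF F] dF p0 this]
    have "of_nat p + ?d \<noteq> 0" "v (of_nat p + ?d) = 1" by (simp_all add: place_p)
    moreover have "of_nat p + ?d = of_int (n + int p) - \<rho>" by simp
    ultimately show ?thesis by (intro exI[of _ "n + int p"]) (auto simp: algebra_simps)
  qed
qed

lemma vge_poly:
  assumes "q \<in> polys_over F" "\<And>i. vge v (coeff q i) 0" "x \<in> F" "vge v x 0"
  shows "vge v (poly q x) 0"
  using assms(1,2)
proof (induction q)
  case (pCons a q)
  have q: "q \<in> polys_over F" "\<And>i. vge v (coeff q i) 0"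
    using polys_over_pConsD[OF pCons.prems(1)] pCons.prems(2)[of "Suc i" for i] by auto
  have a: "a \<in> F" "vge v a 0"
    using polys_over_pConsD[OF pCons.prems(1)] pCons.prems(2)[of 0] by auto
  have "vge v (x * poly q x) (0 + 0)"
    by (intro vge_mult poly_in_subfield[OF F] q assms pCons.IH)
  with a q assms show ?case
    by (auto intro!: vge_add is_subfieldD[OF F] poly_in_subfield[OF F])
qed simp

lemma vge_poly_diff:
  assumes "q \<in> polys_over F" "\<And>i. vge v (coeff q i) 0" "x \<in> F" "vge v x 0" "y \<in> F" "vge v y 0" "vge v (x - y) 1"
  shows "vge v (poly q x - poly q y) 1"
  using assms(1,2)
proof (induction q)
  case (pCons a q)
  have q: "q \<in> polys_over F" "\<And>i. vge v (coeff q i) 0"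
    using polys_over_pConsD[OF pCons.prems(1)] pCons.prems(2)[of "Suc i" for i] by auto
  note m = poly_in_subfield[OF F q(1) assms(3)] poly_in_subfield[OF F q(1) assms(5)] assms(3,5)
  have "vge v (x * (poly q x - poly q y)) (0 + 1)"
    by (intro vge_mult is_subfieldD[OF F] m assms pCons.IH q)
  moreover have "vge v ((x - y) * poly q y) (1 + 0)"
    by (intro vge_mult is_subfieldD[OF F] m assms vge_poly q)
  ultimately have "vge v (x * (poly q x - poly q y) + (x - y) * poly q y) 1"
    by (intro vge_add is_subfieldD[OF F] m) simp_all
  then show ?case by (simp add: algebra_simps)
qed simp

end

text \<open>Split off the full power of the linear factor, leaving \<open>q\<close> with
  \<open>poly q \<rho> \<noteq> 0\<close>. The finite set consists of the nonzero ones among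
  \<open>\<rho>\<close>, \<open>poly q \<rho>\<close> and the coefficients of \<open>q\<close>;
  where these are units, \<open>poly q s\<close> is congruent to \<open>poly q \<rho>\<close> and
  hence a unit.\<close>

lemma place_poly_order:
  fixes F :: "'a::field_char_0 set"
  assumes F: "is_subfield F" and G: "G \<in> polys_over F" "G \<noteq> 0" and \<rho>: "\<rho> \<in> F"
  shows "\<exists>Y. finite Y \<and> Y \<subseteq> F - {0} \<and> (\<forall>p v s. is_place F p v \<longrightarrow> (\<forall>y\<in>Y. v y = 0) \<longrightarrow> s \<in> F \<longrightarrow>
     s \<noteq> \<rho> \<longrightarrow> v (s - \<rho>) = 1 \<longrightarrow> poly G s \<noteq> 0 \<and> v (poly G s) = int (Polynomial.order \<rho> G))"
proof -
  define D where "D = [:-\<rho>, 1:] ^ Polynomial.order \<rho> G"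
  have D: "D \<in> polys_over F" "D \<noteq> 0"
    unfolding D_def using \<rho> by (auto intro!: polys_over_intros[OF F] is_subfieldD[OF F])
  obtain q where q: "G = D * q" "\<not> [:-\<rho>, 1:] dvd q" using order_decomp[OF G(2), of \<rho>] unfolding D_def by blast
  \<comment> \<open>Division with remainder over \<open>F\<close> shows that the cofactor
    \<open>q\<close> has its coefficients in \<open>F\<close>.\<close>
  obtain r s where rs: "r \<in> polys_over F" "G = D * r + s" "s = 0 \<or> degree s < degree D"
    using polys_over_division[OF F D G(1)] by blast
  have "D dvd s" using rs(2) q(1) by (metis dvd_add_right_iff dvd_triv_left)
  then have "s = 0" using rs(3) dvd_imp_degree_le by (metis leD)
  then have "q = r" using rs(2) q(1) D(2) by simp
  with q rs(1) have q\<rho>: "poly q \<rho> \<noteq> 0" and qF: "q \<in> polys_over F" by (auto simp: poly_eq_0_iff_dvd)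
  define Y where "Y = (insert \<rho> (insert (poly q \<rho>) (set (coeffs q)))) - {0}"
  have "set (coeffs q) \<subseteq> F" using qF unfolding polys_over_def by (auto simp: coeffs_def)
  then have Y: "finite Y" "Y \<subseteq> F - {0}"
    unfolding Y_def using \<rho> poly_in_subfield[OF F qF \<rho>] by auto
  have "poly G s \<noteq> 0 \<and> v (poly G s) = int (Polynomial.order \<rho> G)"
    if pl: "is_place F p v" and Yv: "\<forall>y\<in>Y. v y = 0" and s: "s \<in> F" "s \<noteq> \<rho>" "v (s - \<rho>) = 1" for p v s
  proof -
    have sF: "s - \<rho> \<in> F" using s \<rho> by (intro is_subfieldD[OF F])
    have c: "vge v (coeff q i) 0" for i
    proof (cases "coeff q i = 0")
      case False
      then have "coeff q i \<in> set (coeffs q)" by (metis coeff_in_coeffs le_degree coeff_0)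
      with False Yv show ?thesis by (simp add: Y_def vge_def)
    qed (simp add: vge_def)
    have \<rho>0: "vge v \<rho> 0" using Yv by (cases "\<rho> = 0") (auto simp: Y_def vge_def)
    have s0: "vge v s 0"
      using vge_add[OF F pl sF \<rho>, of 0] \<rho>0 s(3) by (simp add: vge_def)
    have "vge v (poly q s - poly q \<rho>) 1"
      by (rule vge_poly_diff[OF F pl qF c s(1) s0 \<rho> \<rho>0]) (simp add: vge_def s)
    moreover have v0: "v (poly q \<rho>) = 0" using Yv q\<rho> by (simp add: Y_def)
    ultimately have "poly q \<rho> + (poly q s - poly q \<rho>) \<noteq> 0 \<and> v (poly q \<rho> + (poly q s - poly q \<rho>)) = v (poly q \<rho>)"
      by (intro place_dominant[OF F pl] poly_in_subfield[OF F] qF \<rho> s q\<rho> is_subfieldD[OF F]) auto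
    then have qs: "poly q s \<noteq> 0" "v (poly q s) = 0" using v0 by simp_all
    let ?z = "(s - \<rho>) ^ Polynomial.order \<rho> G"
    have z: "?z \<in> F" "?z \<noteq> 0" "v ?z = int (Polynomial.order \<rho> G)"
      using place_power[OF F pl sF, of "Polynomial.order \<rho> G"] s is_subfieldD(9)[OF F sF] by simp_all
    have Gs: "poly G s = ?z * poly q s"
      using arg_cong[OF q(1), of "\<lambda>z. poly z s"] by (simp add: D_def)
    have "v (?z * poly q s) = v ?z + v (poly q s)"
      by (rule place_mult[OF F pl z(1) poly_in_subfield[OF F qF s(1)] z(2) qs(1)])
    then show ?thesis unfolding Gs z(3) qs(2) using z(2) qs(1) by simp
  qed
  with Y show ?thesis by blast
qed

section \<open>Simultaneous approximation by dyadic fractions\<close>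

lemma crt_int:
  assumes "coprime a (b :: int)"
  shows "\<exists>x. a dvd x - u \<and> b dvd x - w"
proof -
  obtain s t where st: "s * a + t * b = 1" using assms by (metis bezout_int coprime_imp_gcd_eq_1)
  have 1: "z = z * (s * a) + z * (t * b)" for z using st by (metis distrib_left mult.right_neutral)
  have "w * (s * a) + u * (t * b) - u = w * (s * a) - u * (s * a)" using 1[of u] by linarith
  moreover have "a dvd w * (s * a) - u * (s * a)" by (intro dvd_diff) auto
  ultimately have "a dvd w * (s * a) + u * (t * b) - u" by (simp only:)
  have "w * (s * a) + u * (t * b) - w = u * (t * b) - w * (t * b)" using 1[of w] by linarith
  moreover have "b dvd u * (t * b) - w * (t * b)" by (intro dvd_diff) auto
  ultimately have "b dvd w * (s * a) + u * (t * b) - w" by (simp only:)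
  with \<open>a dvd w * (s * a) + u * (t * b) - u\<close> show ?thesis by (intro exI[of _ "w * (s * a) + u * (t * b)"]) simp
qed

text \<open>The congruence is taken modulo the square of \<open>p\<close>: the perturbation of
  \<open>t\<close> then has valuation at least 2, so the valuation 1 survives exactly. Dividing by a
  power of two is harmless at an odd place.\<close>

lemma place_shift:
  fixes F :: "'a::field_char_0 set"
  assumes F: "is_subfield F" and pl: "is_place F p v" "p \<noteq> 2" and \<rho>: "\<rho> \<in> F"
    and t: "of_int t \<noteq> \<rho>" "v (of_int t - \<rho>) = 1" and n: "(int p)\<^sup>2 dvd n - 2 ^ k * t"
  shows "of_int n / 2 ^ k \<noteq> \<rho> \<and> v (of_int n / 2 ^ k - \<rho>) = 1"
proof -
  have prime: "prime p" by (rule place_prime[OF F pl(1)])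
  obtain m where m: "n - 2 ^ k * t = (int p)\<^sup>2 * m" using n by (elim dvdE)
  have p0: "(of_nat p :: 'a) \<noteq> 0" using prime_gt_0_nat[OF prime] by simp
  have "\<not> int p dvd 2"
  proof
    assume "int p dvd 2"
    then have "p dvd 2" by (metis of_nat_dvd_iff of_nat_numeral)
    with prime pl(2) show False using primes_dvd_imp_eq two_is_prime_nat by blast
  qed
  then have "v 2 = 0" using place_unit_int[OF F pl(1), of 2] by simp
  moreover have F2: "2 \<in> F" using is_subfieldD(11)[OF F] .
  ultimately have v2: "v (inverse (2 ^ k)) = 0"
    using place_power[OF F pl(1) F2, of k] place_mult[OF F pl(1), of "2 ^ k" "inverse (2 ^ k)"] place_one[OF F pl(1)]
      is_subfieldD(9)[OF F F2, of k] is_subfieldD(6)[OF F is_subfieldD(9)[OF F F2, of k]] by simp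
  have "of_int (n - 2 ^ k * t) = (of_nat p ^ 2 * of_int m :: 'a)" unfolding m by simp
  then have eq: "of_int n / 2 ^ k - \<rho> = (of_int t - \<rho>) + of_nat p ^ 2 * of_int m * inverse (2 ^ k)"
    by (simp add: field_simps)
  have "v (of_nat p ^ 2) = 2"
    using place_power[OF F pl(1) is_subfieldD(10)[OF F, of p] p0, of 2] place_p[OF F pl(1)] by simp
  then have "vge v (of_nat p ^ 2 * of_int m * inverse (2 ^ k)) (2 + 0 + 0)"
    using v2 by (intro vge_mult[OF F pl(1)] is_subfieldD[OF F] F2 vge_of_int[OF F pl(1)]) (auto simp: vge_def)
  then have "(of_int t - \<rho>) + of_nat p ^ 2 * of_int m * inverse (2 ^ k) \<noteq> 0
      \<and> v ((of_int t - \<rho>) + of_nat p ^ 2 * of_int m * inverse (2 ^ k)) = v (of_int t - \<rho>)"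
    using t by (intro place_dominant[OF F pl(1)] is_subfieldD[OF F] F2 \<rho>) auto
  then show ?thesis unfolding eq[symmetric] using t by auto
qed

lemma simultaneous_approximation:
  fixes F :: "'a::field_char_0 set"
  assumes F: "is_subfield F" and pl1: "is_place F p1 v1" "p1 \<noteq> 2" and pl2: "is_place F p2 v2" "p2 \<noteq> 2"
    and "p1 \<noteq> p2" and \<rho>1: "\<rho>1 \<in> F" "vge v1 \<rho>1 0" and \<rho>2: "\<rho>2 \<in> F" "vge v2 \<rho>2 0"
  shows "\<exists>n. odd n \<and> of_int n / 2 ^ k \<noteq> \<rho>1 \<and> v1 (of_int n / 2 ^ k - \<rho>1) = 1 \<and>
    of_int n / 2 ^ k \<noteq> \<rho>2 \<and> v2 (of_int n / 2 ^ k - \<rho>2) = 1"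
proof -
  obtain t1 where t1: "of_int t1 \<noteq> \<rho>1" "v1 (of_int t1 - \<rho>1) = 1" using place_approx[OF F pl1(1) \<rho>1] by blast
  obtain t2 where t2: "of_int t2 \<noteq> \<rho>2" "v2 (of_int t2 - \<rho>2) = 1" using place_approx[OF F pl2(1) \<rho>2] by blast
  have pr: "prime p1" "prime p2" using place_prime F pl1(1) pl2(1) by blast+
  have "coprime p1 p2" "coprime p1 2" "coprime p2 2"
    using pr assms(3,5,6) primes_coprime two_is_prime_nat by blast+
  then have c: "coprime (int p1) (int p2)" "coprime (int p1) 2" "coprime (int p2) 2"
    by (metis coprime_int_iff of_nat_numeral)+
  obtain x where x: "(int p1)\<^sup>2 dvd x - 2 ^ k * t1" "(int p2)\<^sup>2 dvd x - 2 ^ k * t2"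
    using crt_int[of "(int p1)\<^sup>2" "(int p2)\<^sup>2"] c by auto
  have "coprime ((int p1)\<^sup>2 * (int p2)\<^sup>2) 2" using c by simp
  then obtain n where n: "(int p1)\<^sup>2 * (int p2)\<^sup>2 dvd n - x" "2 dvd n - 1"
    using crt_int by blast
  have "(int p1)\<^sup>2 dvd n - 2 ^ k * t1"
    using dvd_add[OF dvd_mult_left[OF n(1)] x(1)] by simp
  moreover have "(int p2)\<^sup>2 dvd n - 2 ^ k * t2"
    using dvd_add[OF dvd_mult_right[OF n(1)] x(2)] by simp
  moreover have "odd n" using n(2) by presburger
  ultimately show ?thesis
    using place_shift[OF F pl1 \<rho>1(1) t1] place_shift[OF F pl2 \<rho>2(1) t2] by blast
qed

text \<open>The products \<open>b * x ^ i\<close> with \<open>i\<close> below the degree of an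
  equation for \<open>x\<close> over \<open>K\<close> span a finite-dimensional rational space that
  is stable under multiplication by \<open>x\<close> and contains all its powers. Enough powers are
  dependent, unless two of them coincide, which is an equation as well.\<close>

lemma algebraic_over_number_field:
  fixes K :: "'a::field_char_0 set" and x :: 'a
  assumes "number_field K" and "algebraic_extension K"
  shows "algebraic x"
proof -
  interpret V: vector_space "\<lambda>(q::rat) (x::'a). of_rat q * x"
    by unfold_locales (simp_all add: algebra_simps of_rat_add of_rat_mult)
  obtain B where K: "is_subfield K" and B: "finite B" "K = V.span B"
    using assms(1) unfolding number_field_def by blast
  obtain p where p: "p \<noteq> 0" "\<And>i. coeff p i \<in> K" "poly p x = 0"
    using assms(2) unfolding algebraic_extension_def by blast
  define n where "n = degree p"
  have n: "n > 0"
  proof (rule ccontr)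
    assume "\<not> n > 0"
    then obtain a where "p = [:a:]" unfolding n_def by (auto elim: degree_eq_zeroE)
    with p show False by simp
  qed
  define T where "T = (\<lambda>(b, i). b * x ^ i) ` (B \<times> {..<n})"
  have finT: "finite T" unfolding T_def using B(1) by simp
  have KT: "y * x ^ i \<in> V.span T" if y: "y \<in> K" and i: "i < n" for y i
  proof -
    have "y \<in> V.span B" using y B(2) by simp
    then show ?thesis
    proof (rule V.span_induct)
      show "V.subspace {y. y * x ^ i \<in> V.span T}"
        unfolding V.subspace_def
        using V.span_add V.span_scale by (auto simp: V.span_zero distrib_right mult.assoc)
      show "b * x ^ i \<in> V.span T" if "b \<in> B" for b
        using that i by (intro V.span_base) (auto simp: T_def)
    qed
  qed
  have xT: "x * z \<in> V.span T" if "z \<in> V.span T" for z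
    using that
  proof (rule V.span_induct)
    show "V.subspace {z. x * z \<in> V.span T}"
      unfolding V.subspace_def
      using V.span_add V.span_scale by (auto simp: V.span_zero distrib_left mult.left_commute[of x "of_rat c" for c])
    fix z assume "z \<in> T"
    then obtain b i where z: "z = b * x ^ i" "b \<in> B" "i < n" by (auto simp: T_def)
    have bK: "b \<in> K" unfolding B(2) using z(2) by (rule V.span_base)
    show "x * z \<in> V.span T"
    proof (cases "Suc i < n")
      case True
      have "x * z = b * x ^ Suc i" by (simp add: z mult.left_commute)
      then show ?thesis using KT[OF bK True] by (simp only:)
    next
      case False
      then have i: "n = Suc i" using z(3) by simp
      have lc: "coeff p n \<noteq> 0" using p(1) by (simp add: n_def)
      have "(\<Sum>j<n. coeff p j * x ^ j) + coeff p n * x ^ n = 0"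
        using p(3) unfolding poly_altdef n_def[symmetric] by (simp add: lessThan_Suc_atMost[symmetric])
      then have "x ^ n = - (\<Sum>j<n. coeff p j * x ^ j) / coeff p n"
        using lc by (simp add: field_simps eq_neg_iff_add_eq_0)
      then have "x * z = b * (- (\<Sum>j<n. coeff p j * x ^ j) / coeff p n)"
        unfolding z(1) i by (simp add: mult.left_commute)
      also have "\<dots> = (\<Sum>j<n. (- (b * coeff p j / coeff p n)) * x ^ j)"
        by (simp add: sum_distrib_left sum_divide_distrib sum_negf mult.assoc)
      also have "\<dots> \<in> V.span T"
        by (intro V.span_sum KT is_subfieldD[OF K] bK p(2)) auto
      finally show ?thesis .
    qed
  qed
  have pow: "x ^ k \<in> V.span T" for k
  proof (induction k)
    case 0
    show ?case using KT[OF is_subfieldD(2)[OF K] n] by simp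
  next
    case (Suc k)
    then show ?case using xT by simp
  qed
  define N where "N = card T"
  show ?thesis
  proof (cases "inj_on (\<lambda>k. x ^ k) {..N}")
    case True
    define S where "S = (\<lambda>k. x ^ k) ` {..N}"
    have "card S = Suc N" unfolding S_def using True by (simp add: card_image)
    moreover have "S \<subseteq> V.span T" unfolding S_def using pow by blast
    ultimately have "V.dependent S"
      using V.independent_span_bound[OF finT, of S] unfolding N_def by force
    moreover have "finite S" by (simp add: S_def)
    ultimately obtain u y where u: "y \<in> S" "u y \<noteq> 0" "(\<Sum>z\<in>S. of_rat (u z) * z) = 0"
      using V.dependent_finite by auto
    define q where "q = (\<Sum>k\<le>N. monom (of_rat (u (x ^ k)) :: 'a) k)"
    have cq: "coeff q i = (if i \<le> N then of_rat (u (x ^ i)) else 0)" for i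
      by (simp add: q_def coeff_sum)
    obtain k where k: "k \<le> N" "y = x ^ k" using u(1) by (auto simp: S_def)
    have "coeff q k \<noteq> 0" using k u(2) by (simp add: cq)
    then have q0: "q \<noteq> 0" by auto
    have "poly q x = (\<Sum>k\<le>N. of_rat (u (x ^ k)) * x ^ k)"
      by (simp add: q_def poly_sum poly_monom)
    also have "\<dots> = (\<Sum>z\<in>S. of_rat (u z) * z)"
      unfolding S_def by (subst sum.reindex[OF True]) simp
    finally have "poly q x = 0" using u(3) by simp
    moreover have "coeff q i \<in> \<rat>" for i by (simp add: cq)
    ultimately show ?thesis using q0 by (intro algebraicI')
  next
    case False
    then obtain i j where ij: "i \<noteq> j" "x ^ i = x ^ j" unfolding inj_on_def by blast
    define q where "q = (monom 1 i - monom 1 j :: 'a poly)"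
    have "coeff q i \<noteq> 0" using ij(1) by (simp add: q_def)
    then have "q \<noteq> 0" by auto
    then show ?thesis
      using ij(2) by (intro algebraicI'[of q]) (auto simp: q_def poly_monom)
  qed
qed

section \<open>A two-adic valuation ring\<close>

definition is_subring :: "'a::field set \<Rightarrow> bool" where
  "is_subring A \<longleftrightarrow> 1 \<in> A \<and> (\<forall>x\<in>A. \<forall>y\<in>A. x + y \<in> A \<and> x * y \<in> A) \<and> (\<forall>x\<in>A. - x \<in> A)"

lemma is_subringD:
  assumes "is_subring A"
  shows "1 \<in> A" "0 \<in> A" "x \<in> A \<Longrightarrow> y \<in> A \<Longrightarrow> x + y \<in> A" "x \<in> A \<Longrightarrow> y \<in> A \<Longrightarrow> x * y \<in> A"
    "x \<in> A \<Longrightarrow> - x \<in> A" "x \<in> A \<Longrightarrow> y \<in> A \<Longrightarrow> x - y \<in> A" "x \<in> A \<Longrightarrow> x ^ n \<in> A" "of_nat n \<in> A"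
    "numeral k \<in> A" "of_int i \<in> A"
proof -
  show a: "1 \<in> A" "x \<in> A \<Longrightarrow> y \<in> A \<Longrightarrow> x + y \<in> A" "x \<in> A \<Longrightarrow> y \<in> A \<Longrightarrow> x * y \<in> A" "x \<in> A \<Longrightarrow> - x \<in> A" for x y
    using assms unfolding is_subring_def by blast+
  show z: "0 \<in> A" using a(2)[OF a(1) a(4)[OF a(1)]] by simp
  show "x \<in> A \<Longrightarrow> y \<in> A \<Longrightarrow> x - y \<in> A" using a(2)[of x "- y"] a(4)[of y] by simp
  show "x \<in> A \<Longrightarrow> x ^ n \<in> A" by (induction n) (use a in auto)
  show n: "of_nat n \<in> A" for n by (induction n) (use a z in auto)
  show "numeral k \<in> A" using n[of "numeral k"] by simp
  show "of_int i \<in> A" by (cases i rule: int_cases2) (use n a in auto)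
qed

lemma sum_in_subring: "is_subring A \<Longrightarrow> (\<And>i. i \<in> I \<Longrightarrow> g i \<in> A) \<Longrightarrow> sum g I \<in> A"
  by (induction I rule: infinite_finite_induct) (auto simp: is_subringD)

lemma poly_in_subring:
  assumes A: "is_subring A" and "\<And>i. coeff q i \<in> A" "x \<in> A"
  shows "poly q x \<in> A"
  using assms(2)
proof (induction q)
  case (pCons a q)
  have "a \<in> A" "\<And>i. coeff q i \<in> A" using pCons.prems[of 0] pCons.prems[of "Suc i" for i] by simp_all
  with pCons.IH assms(3) show ?case by (auto intro!: is_subringD[OF A])
qed (simp add: is_subringD[OF A])

lemma subring_Union_chain:
  assumes "subset.chain {A :: 'a::field set. is_subring A \<and> z \<notin> A} C" "C \<noteq> {}"
  shows "is_subring (\<Union>C) \<and> z \<notin> \<Union>C"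
proof -
  have C: "is_subring A" "z \<notin> A" if "A \<in> C" for A using assms(1) that unfolding subset.chain_def by auto
  have ch: "A \<subseteq> B \<or> B \<subseteq> A" if "A \<in> C" "B \<in> C" for A B
    using assms(1) that unfolding subset.chain_def by blast
  have "x + y \<in> \<Union>C \<and> x * y \<in> \<Union>C" if xy: "x \<in> \<Union>C" "y \<in> \<Union>C" for x y
  proof -
    obtain A B where AB: "A \<in> C" "x \<in> A" "B \<in> C" "y \<in> B" using xy by blast
    then obtain D where "D \<in> C" "x \<in> D" "y \<in> D" using ch[OF AB(1,3)] by blast
    with is_subringD(3,4)[OF C(1)] show ?thesis by blast
  qed
  moreover have "1 \<in> \<Union>C" using assms(2) is_subringD(1)[OF C(1)] by blast
  moreover have "- x \<in> \<Union>C" if "x \<in> \<Union>C" for x using that is_subringD(5)[OF C(1)] by blast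
  ultimately show ?thesis using C(2) unfolding is_subring_def by blast
qed

lemma subring_adjoin:
  assumes A: "is_subring A"
  shows "is_subring {poly q x | q. \<forall>i. coeff q i \<in> A}" (is "is_subring ?B")
    and "A \<subseteq> {poly q x | q. \<forall>i. coeff q i \<in> A}" and "x \<in> {poly q x | q. \<forall>i. coeff q i \<in> A}"
proof -
  have I: "poly q x \<in> ?B" if "\<And>i. coeff q i \<in> A" for q using that by blast
  have c: "a \<in> ?B" if "a \<in> A" for a
    using I[of "[:a:]"] that is_subringD(2)[OF A] by (simp add: coeff_pCons split: nat.split)
  then show "A \<subseteq> ?B" by blast
  show "x \<in> ?B"
    using I[of "[:0, 1:]"] is_subringD(1,2)[OF A] by (simp add: coeff_pCons split: nat.split)
  have "y + z \<in> ?B \<and> y * z \<in> ?B" if yz: "y \<in> ?B" "z \<in> ?B" for y z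
  proof -
    obtain q r where q: "y = poly q x" "\<forall>i. coeff q i \<in> A" and r: "z = poly r x" "\<forall>i. coeff r i \<in> A"
      using yz by blast
    have "coeff (q + r) i \<in> A" for i using q r is_subringD(3)[OF A] by simp
    moreover have "coeff (q * r) i \<in> A" for i
      unfolding coeff_mult by (intro sum_in_subring[OF A] is_subringD(4)[OF A]) (use q r in auto)
    ultimately show ?thesis using I[of "q + r"] I[of "q * r"] q r by simp
  qed
  moreover have "- y \<in> ?B" if y: "y \<in> ?B" for y
  proof -
    obtain q where q: "y = poly q x" "\<forall>i. coeff q i \<in> A" using y by blast
    then have "coeff (- q) i \<in> A" for i using is_subringD(5)[OF A] by simp
    with I[of "- q"] q show ?thesis by simp
  qed
  ultimately show "is_subring ?B"
    unfolding is_subring_def using c is_subringD(1)[OF A] by blast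
qed

text \<open>A subring maximal among those without \<open>inverse 2\<close> is a valuation ring, by
  Chevalley's argument. Its elements \<open>1 - 2 * a\<close> are units. If neither \<open>x\<close>
  nor its inverse belonged to it, adjoining either would express \<open>inverse 2\<close> as a
  polynomial in it; of two such expressions of minimal degree, the longer one can still be
  shortened.\<close>

lemma exists_two_adic_ring:
  "\<exists>A :: 'a::field_char_0 set. is_subring A \<and> inverse 2 \<notin> A \<and> (\<forall>x. x \<in> A \<or> inverse x \<in> A)"
proof -
  define \<A> where "\<A> = {A :: 'a set. is_subring A \<and> inverse 2 \<notin> A}"
  have "inverse 2 \<notin> (\<int> :: 'a set)"
  proof
    assume "inverse 2 \<in> (\<int> :: 'a set)"
    then obtain n where "inverse 2 = (of_int n :: 'a)" by (elim Ints_cases)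
    then have "(of_int (2 * n) :: 'a) = of_int 1" by (simp add: field_simps)
    then have "2 * n = 1" by (simp only: of_int_eq_iff)
    then show False by presburger
  qed
  then have "\<int> \<in> \<A>" unfolding \<A>_def is_subring_def by auto
  then have "\<A> \<noteq> {}" by blast
  moreover have "\<Union>C \<in> \<A>" if "C \<noteq> {}" "subset.chain \<A> C" for C
    using subring_Union_chain[of "inverse 2" C] that unfolding \<A>_def by blast
  ultimately obtain A where A: "A \<in> \<A>" "\<forall>B\<in>\<A>. A \<subseteq> B \<longrightarrow> B = A"
    using subset_Zorn_nonempty[of \<A>] by blast
  have sr: "is_subring A" and h: "inverse 2 \<notin> A" using A(1) by (auto simp: \<A>_def)
  note d = is_subringD[OF sr]
  have max: "inverse 2 \<in> B" if "is_subring B" "A \<subseteq> B" "x \<in> B" "x \<notin> A" for B x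
    using A(2) that unfolding \<A>_def by blast
  have half: False if "1 = 2 * a" "a \<in> A" for a
  proof -
    have "inverse 2 = a" using that(1) by (intro inverse_unique) simp
    with that h show False by metis
  qed
  have adj: "\<exists>q. (\<forall>i. coeff q i \<in> A) \<and> poly q x = inverse 2" if "x \<notin> A" for x
    using max[OF subring_adjoin[OF sr] that] by auto
  have unit: "inverse (1 - 2 * a) \<in> A" if a: "a \<in> A" for a
  proof (rule ccontr)
    define u where "u = 1 - 2 * a"
    have u0: "u \<noteq> 0" using half[of a] a unfolding u_def by auto
    have u: "u \<in> A" unfolding u_def by (intro d a)
    assume "inverse (1 - 2 * a) \<notin> A"
    then obtain q where q: "\<forall>i. coeff q i \<in> A" "poly q (inverse u) = inverse 2"
      using adj unfolding u_def by blast
    have "poly (reflect_poly q) u = u ^ degree q * poly q (inverse u)"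
      using poly_reflect_poly_nz[OF u0] .
    then have "u ^ degree q = 2 * poly (reflect_poly q) u" using q(2) by (simp add: mult.commute)
    moreover have "coeff (reflect_poly q) i \<in> A" for i using q(1) d(2) by (simp add: coeff_reflect_poly)
    then have "poly (reflect_poly q) u \<in> A" by (intro poly_in_subring[OF sr] u)
    moreover have "\<exists>b\<in>A. u ^ k = 1 - 2 * b" for k
    proof (induction k)
      case 0
      show ?case by (rule bexI[of _ 0]) (simp_all add: d)
    next
      case (Suc k)
      then obtain b where "b \<in> A" "u ^ k = 1 - 2 * b" by blast
      then have "u ^ Suc k = u * (1 - 2 * b)" by simp
      also have "\<dots> = 1 - 2 * (a + b - 2 * a * b)" by (simp add: u_def algebra_simps)
      finally have "u ^ Suc k = 1 - 2 * (a + b - 2 * a * b)" .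
      moreover have "a + b - 2 * a * b \<in> A" using a \<open>b \<in> A\<close> by (intro d)
      ultimately show ?case by blast
    qed
    then obtain b where "b \<in> A" "u ^ degree q = 1 - 2 * b" by blast
    ultimately have "1 = 2 * (poly (reflect_poly q) u + b)" "poly (reflect_poly q) u + b \<in> A"
      using d(3) by (auto simp: algebra_simps)
    then show False by (rule half)
  qed
  \<comment> \<open>\<open>rep x n\<close> records an expression of \<open>inverse 2\<close> as a
    polynomial of degree \<open>n\<close> in \<open>x\<close>. An expression in
    \<open>inverse x\<close> with constant term \<open>b\<close> yields, thanks to the unit
    \<open>1 - 2 * b\<close>, a replacement of \<open>x ^ n\<close> by lower powers.\<close>
  define rep where "rep x n \<longleftrightarrow> (\<exists>q. (\<forall>i. coeff q i \<in> A) \<and> degree q = n \<and> poly q x = inverse 2)" for x n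
  have red: "\<exists>k<n. rep x k" if n: "rep x n" and m: "rep (inverse x) m" and "m \<le> n" "x \<noteq> 0" for x n m
  proof -
    obtain q where q: "\<forall>i. coeff q i \<in> A" "degree q = n" "poly q x = inverse 2" using n unfolding rep_def by blast
    obtain r where r: "\<forall>i. coeff r i \<in> A" "degree r = m" "poly r (inverse x) = inverse 2" using m unfolding rep_def by blast
    have "n \<noteq> 0"
    proof
      assume "n = 0"
      then obtain a where "q = [:a:]" using q(2) by (auto elim: degree_eq_zeroE)
      then have "poly q x = coeff q 0" by simp
      with q h show False by metis
    qed
    define b where "b = coeff r 0"
    have b: "b \<in> A" using r(1) by (simp add: b_def)
    define u where "u = 1 - 2 * b"
    have u0: "u \<noteq> 0" using half[OF _ b] unfolding u_def by auto
    define c where "c = 2 * coeff q n * inverse u"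
    have c: "c \<in> A" unfolding c_def u_def using q(1) unit[OF b] by (intro d) auto
    define w where "w = (\<Sum>j=1..m. monom (coeff r j) (n - j))"
    define q' where "q' = q - monom (coeff q n) n + smult c w"
    have wA: "coeff w i \<in> A" for i
      unfolding w_def coeff_sum using r(1) d(2) by (intro sum_in_subring[OF sr]) (auto simp: coeff_monom)
    have "coeff q' i \<in> A" for i
      unfolding q'_def using q(1) wA c d by (auto simp: coeff_monom)
    moreover have "coeff q' i = 0" if "i \<ge> n" for i
    proof -
      have "coeff w i = 0" unfolding w_def coeff_sum using that \<open>n \<noteq> 0\<close> by (intro sum.neutral) auto
      moreover have "coeff (q - monom (coeff q n) n) i = 0" using that q(2) by (auto simp: coeff_eq_0)
      ultimately show ?thesis unfolding q'_def by simp
    qed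
    then have "degree q' < n" using \<open>n \<noteq> 0\<close> by (metis degree_lessI not_less neq0_conv le_degree leading_coeff_0_iff degree_0)
    moreover have "poly q' x = inverse 2"
    proof -
      have "poly r (inverse x) = (\<Sum>j\<le>m. coeff r j * inverse x ^ j)" unfolding poly_altdef r(2) ..
      also have "\<dots> = b + (\<Sum>j=1..m. coeff r j * inverse x ^ j)"
        by (simp add: b_def atMost_atLeast0 sum.atLeast_Suc_atMost)
      finally have "inverse 2 - b = (\<Sum>j=1..m. coeff r j * inverse x ^ j)" using r(3) by (simp add: algebra_simps)
      then have "(inverse 2 - b) * x ^ n = (\<Sum>j=1..m. coeff r j * inverse x ^ j * x ^ n)"
        by (simp add: sum_distrib_right)
      also have "\<dots> = (\<Sum>j=1..m. coeff r j * x ^ (n - j))"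
      proof (rule sum.cong)
        fix j assume "j \<in> {1..m}"
        then have "x ^ n = x ^ j * x ^ (n - j)" using \<open>m \<le> n\<close> by (simp flip: power_add)
        then show "coeff r j * inverse x ^ j * x ^ n = coeff r j * x ^ (n - j)"
          using \<open>x \<noteq> 0\<close> by (simp add: power_inverse)
      qed simp
      also have "\<dots> = poly w x" by (simp add: w_def poly_sum poly_monom)
      finally have "poly w x = (inverse 2 - b) * x ^ n" by simp
      moreover have "c * (inverse 2 - b) = coeff q n"
        using u0 unfolding c_def u_def by (simp add: field_simps)
      ultimately have "c * poly w x = coeff q n * x ^ n" by (metis mult.assoc)
      then show ?thesis by (simp add: q'_def poly_monom q(3))
    qed
    ultimately show ?thesis unfolding rep_def by blast
  qed
  have "x \<in> A \<or> inverse x \<in> A" for x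
  proof (rule ccontr)
    assume "\<not> (x \<in> A \<or> inverse x \<in> A)"
    then have x: "x \<notin> A" "inverse x \<notin> A" by auto
    then have x0: "x \<noteq> 0" using d(2) by auto
    define n where "n = (LEAST n. rep x n)"
    define m where "m = (LEAST n. rep (inverse x) n)"
    have "\<exists>n. rep x n" "\<exists>n. rep (inverse x) n" using adj x unfolding rep_def by blast+
    then have n: "rep x n" and m: "rep (inverse x) m" unfolding n_def m_def by (auto intro: LeastI_ex)
    show False
    proof (cases "m \<le> n")
      case True
      then obtain k where "k < n" "rep x k" using red[OF n m True x0] by blast
      then show False unfolding n_def by (metis not_less_Least)
    next
      case False
      then obtain k where "k < m" "rep (inverse x) k" using red[of "inverse x" m n] n m x0 by auto
      then show False unfolding m_def by (metis not_less_Least)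
    qed
  qed
  with sr h show ?thesis by blast
qed

section \<open>The maximal ideal and the units of a two-adic ring\<close>

locale two_adic =
  fixes A :: "'a::field_char_0 set"
  assumes subring: "is_subring A" and half: "inverse 2 \<notin> A" and val: "\<And>x. x \<in> A \<or> inverse x \<in> A"
begin

lemmas A_intros = is_subringD[OF subring]

text \<open>The maximal ideal. No valuation function is attached to the ring; size is expressed by
  \<open>mm\<close>, \<open>unit\<close> and membership in \<open>A\<close>.\<close>

definition mm :: "'a \<Rightarrow> bool" where "mm x \<longleftrightarrow> x \<in> A \<and> (x = 0 \<or> inverse x \<notin> A)"

definition unit :: "'a \<Rightarrow> bool" where "unit x \<longleftrightarrow> x \<in> A \<and> x \<noteq> 0 \<and> inverse x \<in> A"

lemma mm_or: "mm x \<or> (x \<noteq> 0 \<and> inverse x \<in> A)"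
  using val[of x] by (auto simp: mm_def)

lemma mm_A: "mm x \<Longrightarrow> x \<in> A"
  by (simp add: mm_def)

lemma mm_mult: "a \<in> A \<Longrightarrow> mm x \<Longrightarrow> mm (a * x)"
proof -
  assume a: "a \<in> A" and x: "mm x"
  have "a * x \<in> A" using a x by (auto simp: mm_def intro: A_intros)
  moreover have "inverse (a * x) \<notin> A" if "a * x \<noteq> 0"
  proof
    assume "inverse (a * x) \<in> A"
    then have "a * inverse (a * x) \<in> A" using a by (intro A_intros)
    moreover have "a * inverse (a * x) = inverse x" using that by simp
    ultimately have "inverse x \<in> A" by (simp only:)
    then show False using x that by (auto simp: mm_def)
  qed
  ultimately show ?thesis by (auto simp: mm_def)
qed

lemma mm_mult2: "a \<in> A \<Longrightarrow> mm x \<Longrightarrow> mm (x * a)"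
  using mm_mult[of a x] by (simp add: mult.commute)

lemma mm_add: "mm x \<Longrightarrow> mm y \<Longrightarrow> mm (x + y)"
proof -
  have *: "mm (x + y)" if "mm x" "x \<noteq> 0" "y / x \<in> A" for x y
  proof -
    have "mm ((1 + y / x) * x)" using that by (intro mm_mult A_intros)
    moreover have "(1 + y / x) * x = x + y" using that by (simp add: field_simps)
    ultimately show ?thesis by simp
  qed
  assume x: "mm x" and y: "mm y"
  show ?thesis
  proof (cases "x = 0 \<or> y = 0")
    case False
    have "inverse (y / x) = x / y" by simp
    then have "y / x \<in> A \<or> x / y \<in> A" using val[of "y / x"] by simp
    then show ?thesis using *[of x y] *[of y x] x y False by (auto simp: add.commute)
  qed (use x y in auto)
qed

lemma mm_minus: "mm x \<Longrightarrow> mm (- x)"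
  using mm_mult[of "- 1" x] A_intros(1,5) by simp

lemma mm_diff: "mm x \<Longrightarrow> mm y \<Longrightarrow> mm (x - y)"
  using mm_add[of x "- y"] mm_minus[of y] by simp

lemma mm_2: "mm 2"
  using half A_intros(9) by (simp add: mm_def)

lemma not_mm_1: "\<not> mm 1"
  using A_intros(1) by (simp add: mm_def)

lemma unit_1_add: "mm x \<Longrightarrow> unit (1 + x)"
proof -
  assume x: "mm x"
  have "\<not> mm (1 + x)"
  proof
    assume "mm (1 + x)"
    then have "mm (1 + x - x)" using x by (rule mm_diff)
    then show False using not_mm_1 by simp
  qed
  moreover have "1 + x \<in> A" using x by (auto simp: mm_def intro: A_intros)
  ultimately show ?thesis by (auto simp: mm_def unit_def)
qed

lemma unit_mult: "unit x \<Longrightarrow> unit y \<Longrightarrow> unit (x * y)"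
  unfolding unit_def by (auto intro: A_intros)

lemma unit_inverse: "unit x \<Longrightarrow> unit (inverse x)"
  unfolding unit_def by auto

lemma unit_divide: "unit x \<Longrightarrow> unit y \<Longrightarrow> unit (x / y)"
  using unit_mult[of x "inverse y"] unit_inverse by (simp add: divide_inverse)

lemma unit_power: "unit x \<Longrightarrow> unit (x ^ n)"
  by (induction n) (use unit_mult A_intros(1) in \<open>auto simp: unit_def\<close>)

lemma unit_not_mm: "unit x \<Longrightarrow> \<not> mm x"
  by (simp add: unit_def mm_def)

text \<open>A root outside \<open>A\<close> would have its inverse in \<open>A\<close>, and dividing
  the equation by the root would exhibit the root as an element of \<open>A\<close>.\<close>

lemma quadratic_in_A:
  assumes "r\<^sup>2 + b * r + c = 0" "b \<in> A" "c \<in> A"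
  shows "r \<in> A"
proof (rule ccontr)
  assume r: "r \<notin> A"
  then have i: "inverse r \<in> A" "r \<noteq> 0" using val[of r] A_intros(2) by auto
  have "r * r + b * r + c = 0" using assms(1) by (simp add: power2_eq_square)
  then have "r = - (b + c * inverse r)" using i(2) by (simp add: field_simps eq_neg_iff_add_eq_0)
  also have "\<dots> \<in> A" by (intro A_intros assms i)
  finally show False using r by blast
qed

lemma sqrt_in_A: "r\<^sup>2 \<in> A \<Longrightarrow> r \<in> A"
  by (rule quadratic_in_A[of r 0 "- r\<^sup>2"]) (auto intro: A_intros)

lemma sqrt_mm: "mm (r\<^sup>2) \<Longrightarrow> mm r"
  using mm_or[of r] A_intros(7)[of "inverse r" 2] by (auto simp: mm_def power_inverse)

lemma quadratic_mm:
  assumes eq: "r\<^sup>2 + b * r = c" and b: "mm b" and c: "mm c"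
  shows "mm r"
proof -
  have "r \<in> A"
    by (rule quadratic_in_A[of r b "- c"]) (use eq mm_A[OF b] mm_A[OF c] in \<open>auto intro: A_intros\<close>)
  then have "mm (c - r * b)" using b c by (intro mm_diff mm_mult)
  moreover have "c - r * b = r\<^sup>2" using eq by (simp add: algebra_simps)
  ultimately show ?thesis using sqrt_mm by simp
qed

lemma odd_inverse_in_A: "odd n \<Longrightarrow> inverse (of_int n) \<in> A"
proof -
  assume "odd n"
  then obtain k where k: "n = 1 + 2 * k" by (metis add.commute oddE)
  have "mm (of_int k * 2)" by (intro mm_mult mm_2 A_intros)
  from unit_1_add[OF this] show ?thesis unfolding k by (simp add: unit_def mult.commute)
qed

text \<open>If \<open>c\<close> is not in \<open>A\<close>, its inverse is, and an integral equation
  for \<open>c\<close>, divided by the next-to-highest power of \<open>c\<close>, shows that the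
  leading coefficient times \<open>c\<close> lies in \<open>A\<close>. The odd part of that
  coefficient is a unit.\<close>

lemma two_power_clears:
  assumes "algebraic c"
  shows "\<exists>k. 2 ^ k * c \<in> A"
proof (cases "c \<in> A")
  case True
  then show ?thesis by (intro exI[of _ 0]) simp
next
  case False
  then have y: "inverse c \<in> A" and c0: "c \<noteq> 0" using val[of c] A_intros(2) by auto
  obtain q where q: "q \<noteq> 0" "poly (map_poly of_int q) c = 0" using algebraicE'[OF assms] by blast
  have "map_poly of_int (reflect_poly q) = reflect_poly (map_poly of_int q :: 'a poly)"
    by (rule poly_eqI) (auto simp: coeff_map_poly coeff_reflect_poly degree_map_poly)
  then have "ipoly (reflect_poly q) (inverse c) = 0"
    using q(2) c0 poly_reflect_poly_nz[of "inverse c" "map_poly of_int q"] by (simp add: ipoly_def)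
  moreover obtain r where r: "reflect_poly q = pCons (lead_coeff q) r"
    by (metis coeff_pCons_0 pCons_cases coeff_0_reflect_poly)
  ultimately have "of_int (lead_coeff q) + inverse c * ipoly r (inverse c) = 0" by simp
  then have "of_int (lead_coeff q) * c = - ipoly r (inverse c)"
    using c0 by (simp add: field_simps eq_neg_iff_add_eq_0)
  moreover have "ipoly r (inverse c) \<in> A"
    unfolding ipoly_def by (intro poly_in_subring[OF subring] y) (auto simp: coeff_map_poly intro: A_intros)
  ultimately have lc: "of_int (lead_coeff q) * c \<in> A" by (auto intro: A_intros)
  have "lead_coeff q \<noteq> 0" using q(1) by simp
  then obtain n where "lead_coeff q = 2 ^ multiplicity 2 (lead_coeff q) * n" "\<not> 2 dvd n"
    by (rule multiplicity_decompose'[of "lead_coeff q" 2]) simp_all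
  then obtain k where kn: "lead_coeff q = 2 ^ k * n" "odd n" by blast
  have "inverse (of_int n) * (of_int (lead_coeff q) * c) \<in> A"
    by (intro A_intros(4) lc odd_inverse_in_A kn)
  moreover have "inverse (of_int n) * (of_int (lead_coeff q) * c) = 2 ^ k * c"
    using kn by (auto simp: field_simps)
  ultimately show ?thesis by metis
qed

end

section \<open>Points with large abscissa\<close>

locale tate_two_adic = two_adic A for A :: "'a::field_char_0 set" +
  fixes E :: "'a weierstrass_curve" and j :: nat
  assumes tate: "a4 E = 0" "a6 E = 0" and ns: "nonsingular_curve E"
    and clear: "2 ^ j * a1 E \<in> A" "2 ^ j * a2 E \<in> A" "2 ^ j * a3 E \<in> A"
begin

text \<open>The factor \<open>8 (2\<^sup>j)\<^sup>2\<close> makes the coefficient terms in the duplication formula negligible.\<close>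

definition large :: "'a \<Rightarrow> bool" where
  "large x \<longleftrightarrow> x \<noteq> 0 \<and> (\<exists>\<tau>\<in>A. inverse x = 8 * (2 ^ j)\<^sup>2 * \<tau>)"

lemma large_unit:
  assumes "large x" and "inverse x' = inverse x * a" "a \<in> A" "x' \<noteq> 0"
  shows "large x'"
proof -
  obtain \<tau> where "\<tau> \<in> A" "inverse x = 8 * (2 ^ j)\<^sup>2 * \<tau>" using assms(1) unfolding large_def by blast
  then have "\<tau> * a \<in> A" "inverse x' = 8 * (2 ^ j)\<^sup>2 * (\<tau> * a)" using assms by (auto intro: A_intros)
  then show ?thesis using assms(4) unfolding large_def by blast
qed

lemma mm_even: "a \<in> A \<Longrightarrow> mm (2 * a)"
  by (rule mm_mult2[OF _ mm_2])

text \<open>With \<open>a4\<close> and \<open>a6\<close> zero, the duplication formula is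
  \<open>x(2P) = x (1 - nn) / (4 (1 + dd))\<close>, where \<open>nn\<close> and \<open>dd\<close>
  collect the lower terms in \<open>t = inverse x\<close>. Largeness puts both into the maximal
  ideal, so doubling multiplies the inverse abscissa by 4 up to a unit.\<close>

lemma double_large:
  assumes P: "on_curve E x y" and x: "large x"
  shows "\<exists>x' y' u. point_add E (Affine x y) (Affine x y) = Affine x' y' \<and> on_curve E x' y' \<and> x' \<noteq> 0 \<and>
    unit u \<and> inverse x' = inverse x * (4 * u)"
proof -
  define g where "g = (2 ^ j :: 'a)"
  obtain \<tau> where \<tau>: "\<tau> \<in> A" "inverse x = 8 * g\<^sup>2 * \<tau>" and x0: "x \<noteq> 0" using x unfolding large_def g_def by blast
  define t where "t = inverse x"
  have tx: "t * x = 1" using x0 by (simp add: t_def)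
  have gA: "g \<in> A" unfolding g_def by (intro A_intros)
  define \<alpha>1 \<alpha>2 \<alpha>3 where \<alpha>: "\<alpha>1 = g * a1 E" "\<alpha>2 = g * a2 E" "\<alpha>3 = g * a3 E"
  have \<alpha>A: "\<alpha>1 \<in> A" "\<alpha>2 \<in> A" "\<alpha>3 \<in> A" unfolding \<alpha> g_def using clear by auto
  define dd where "dd = ((a1 E)\<^sup>2 + 4 * a2 E) * t / 4 + a1 E * a3 E * t\<^sup>2 / 2 + (a3 E)\<^sup>2 * t ^ 3 / 4"
  define nn where "nn = a1 E * a3 E * t\<^sup>2 + 2 * (a3 E)\<^sup>2 * t ^ 3 + a2 E * (a3 E)\<^sup>2 * t ^ 4"
  have dd_eq: "dd = 2 * (\<alpha>1\<^sup>2 * \<tau> + 4 * g * \<alpha>2 * \<tau> + 16 * g\<^sup>2 * \<alpha>1 * \<alpha>3 * \<tau>\<^sup>2 + 64 * g ^ 4 * \<alpha>3\<^sup>2 * \<tau> ^ 3)"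
    unfolding dd_def t_def \<tau>(2) \<alpha> by (simp add: field_simps power2_eq_square power3_eq_cube power4_eq_xxxx)
  have dd: "mm dd" unfolding dd_eq by (intro mm_even A_intros \<alpha>A \<tau>(1) gA)
  have nn_eq: "nn = 2 * (32 * g\<^sup>2 * \<alpha>1 * \<alpha>3 * \<tau>\<^sup>2 + 512 * g ^ 4 * \<alpha>3\<^sup>2 * \<tau> ^ 3 + 2048 * g ^ 5 * \<alpha>2 * \<alpha>3\<^sup>2 * \<tau> ^ 4)"
    unfolding nn_def t_def \<tau>(2) \<alpha> by (simp add: field_simps eval_nat_numeral)
  have nn: "mm nn" unfolding nn_eq by (intro mm_even A_intros \<alpha>A \<tau>(1) gA)
  \<comment> \<open>\<open>N / \<psi>\<close> is the slope of the tangent. The two identities below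
    hold modulo the curve equation \<open>cv\<close>, a multiple of which is carried along
    explicitly.\<close>
  define \<psi> where "\<psi> = 2 * y + a1 E * x + a3 E"
  define N where "N = 3 * x\<^sup>2 + 2 * a2 E * x - a1 E * y"
  have cv: "y\<^sup>2 + a1 E * x * y + a3 E * y - x ^ 3 - a2 E * x\<^sup>2 = 0" using P by (simp add: on_curve_def tate)
  have "\<psi>\<^sup>2 = 4 * x ^ 3 + ((a1 E)\<^sup>2 + 4 * a2 E) * x\<^sup>2 + 2 * a1 E * a3 E * x + (a3 E)\<^sup>2
      + 4 * (y\<^sup>2 + a1 E * x * y + a3 E * y - x ^ 3 - a2 E * x\<^sup>2)"
    unfolding \<psi>_def by (simp add: algebra_simps power2_eq_square)
  also have "\<dots> = 4 * x ^ 3 * (1 + dd)"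
    unfolding cv dd_def t_def using x0 by (simp add: field_simps power2_eq_square power3_eq_cube)
  finally have \<psi>2: "\<psi>\<^sup>2 = 4 * x ^ 3 * (1 + dd)" .
  have "N\<^sup>2 + a1 E * N * \<psi> - (a2 E + 2 * x) * \<psi>\<^sup>2
      = x ^ 4 - a1 E * a3 E * x\<^sup>2 - 2 * (a3 E)\<^sup>2 * x - a2 E * (a3 E)\<^sup>2
        - ((a1 E)\<^sup>2 + 4 * a2 E + 8 * x) * (y\<^sup>2 + a1 E * x * y + a3 E * y - x ^ 3 - a2 E * x\<^sup>2)"
    unfolding \<psi>_def N_def by (simp add: algebra_simps power2_eq_square power3_eq_cube power4_eq_xxxx)
  also have "\<dots> = x ^ 4 * (1 - nn)"
    unfolding cv nn_def t_def using x0 by (simp add: field_simps power2_eq_square power3_eq_cube power4_eq_xxxx)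
  finally have num: "N\<^sup>2 + a1 E * N * \<psi> - (a2 E + 2 * x) * \<psi>\<^sup>2 = x ^ 4 * (1 - nn)" .
  have ud: "unit (1 + dd)" using dd by (rule unit_1_add)
  have un: "unit (1 - nn)" using unit_1_add[OF mm_minus[OF nn]] by simp
  have \<psi>0: "\<psi> \<noteq> 0" using \<psi>2 x0 ud by (auto simp: unit_def)
  define l where "l = N / \<psi>"
  define x' where "x' = l\<^sup>2 + a1 E * l - a2 E - x - x"
  define y' where "y' = - (l + a1 E) * x' - (y - l * x) - a3 E"
  have "x' * \<psi>\<^sup>2 = N\<^sup>2 + a1 E * N * \<psi> - (a2 E + 2 * x) * \<psi>\<^sup>2"
    unfolding x'_def l_def using \<psi>0 by (simp add: field_simps power2_eq_square)
  then have "x' * \<psi>\<^sup>2 = x ^ 4 * (1 - nn)" unfolding num .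
  then have "x' * (4 * x ^ 3 * (1 + dd)) = x ^ 4 * (1 - nn)" unfolding \<psi>2 .
  then have "x ^ 3 * (x' * (4 * (1 + dd))) = x ^ 3 * (x * (1 - nn))" by (simp add: algebra_simps eval_nat_numeral)
  then have x': "x' * (4 * (1 + dd)) = x * (1 - nn)" using x0 by simp
  have nz: "1 + dd \<noteq> 0" "1 - nn \<noteq> 0" using ud un by (auto simp: unit_def)
  have x'0: "x' \<noteq> 0" using x' x0 nz by auto
  have "y + y + a1 E * x + a3 E = \<psi>" by (simp add: \<psi>_def)
  then have add: "point_add E (Affine x y) (Affine x y) = Affine x' y'"
    using \<psi>0 unfolding point_add.simps Let_def x'_def y'_def l_def N_def
    by (simp add: tate \<psi>_def)
  have "inverse x' = inverse x * (4 * ((1 + dd) / (1 - nn)))"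
    using x' x'0 x0 nz by (simp add: field_simps)
  moreover have "unit ((1 + dd) / (1 - nn))" using ud un by (rule unit_divide)
  moreover have "on_curve E x' y'"
    using point_add_closed[OF ns, of "Affine x y" "Affine x y"] P unfolding add by (simp add: Affine_in_rational_points)
  ultimately show ?thesis using add x'0 by blast
qed

abbreviation "G \<equiv> mordell_weil_group E UNIV"

lemma comm_group_G: "comm_group G"
  by (rule comm_group_mordell_weil) (auto simp: is_subfield_def ns)

text \<open>The inverse abscissas of the points \<open>2 ^ i\<close> times \<open>P\<close> differ
  by powers of 4 up to units, so these points are pairwise distinct, whereas a torsion point has
  only finitely many multiples.\<close>

lemma large_not_torsion:
  assumes P: "on_curve E x y" and x: "large x" and N: "N > 0"
  shows "Affine x y [^]\<^bsub>G\<^esub> (N::nat) \<noteq> \<one>\<^bsub>G\<^esub>"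
proof
  interpret comm_group G by (rule comm_group_G)
  let ?P = "Affine x y"
  assume tor: "?P [^]\<^bsub>G\<^esub> N = \<one>\<^bsub>G\<^esub>"
  have Pc: "?P \<in> carrier G" using P by (simp add: mordell_weil_group_def Affine_in_rational_points)
  have x0: "x \<noteq> 0" using x by (simp add: large_def)
  have *: "\<exists>x' y' u. ?P [^]\<^bsub>G\<^esub> (2 ^ i :: nat) = Affine x' y' \<and> on_curve E x' y' \<and> large x' \<and> unit u \<and>
      inverse x' = inverse x * (4 ^ i * u)" for i :: nat
  proof (induction i)
    case 0
    have "unit 1" using A_intros(1) by (simp add: unit_def)
    then show ?case using P x Pc by (intro exI[of _ x] exI[of _ y] exI[of _ 1]) simp
  next
    case (Suc i)
    then obtain x' y' u where i: "?P [^]\<^bsub>G\<^esub> (2 ^ i :: nat) = Affine x' y'" "on_curve E x' y'" "large x'" "unit u"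
      "inverse x' = inverse x * (4 ^ i * u)" by blast
    obtain x'' y'' w where d: "point_add E (Affine x' y') (Affine x' y') = Affine x'' y''" "on_curve E x'' y''"
      "x'' \<noteq> 0" "unit w" "inverse x'' = inverse x' * (4 * w)" using double_large[OF i(2,3)] by blast
    have "?P [^]\<^bsub>G\<^esub> (2 ^ Suc i :: nat) = ?P [^]\<^bsub>G\<^esub> (2 ^ i + 2 ^ i :: nat)" by (simp add: mult_2)
    also have "\<dots> = ?P [^]\<^bsub>G\<^esub> (2 ^ i :: nat) \<otimes>\<^bsub>G\<^esub> ?P [^]\<^bsub>G\<^esub> (2 ^ i :: nat)"
      using Pc by (rule nat_pow_mult[symmetric])
    also have "\<dots> = Affine x'' y''" unfolding i(1) using d(1) by (simp add: mordell_weil_group_def)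
    finally have 1: "?P [^]\<^bsub>G\<^esub> (2 ^ Suc i :: nat) = Affine x'' y''" .
    have "4 * w \<in> A" using d(4) by (auto simp: unit_def intro: A_intros)
    then have 2: "large x''" using large_unit[OF i(3) d(5) _ d(3)] by blast
    have 3: "unit (u * w)" using i(4) d(4) by (rule unit_mult)
    have 4: "inverse x'' = inverse x * (4 ^ Suc i * (u * w))" using d(5) i(5) by simp
    show ?case using 1 d(2) 2 3 4 by blast
  qed
  have distinct: "?P [^]\<^bsub>G\<^esub> (2 ^ i :: nat) \<noteq> ?P [^]\<^bsub>G\<^esub> (2 ^ k :: nat)" if "i < k" for i k :: nat
  proof
    assume eq: "?P [^]\<^bsub>G\<^esub> (2 ^ i :: nat) = ?P [^]\<^bsub>G\<^esub> (2 ^ k :: nat)"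
    obtain x1 y1 u where 1: "?P [^]\<^bsub>G\<^esub> (2 ^ i :: nat) = Affine x1 y1" "unit u" "inverse x1 = inverse x * (4 ^ i * u)"
      using *[of i] by blast
    obtain x2 y2 w where 2: "?P [^]\<^bsub>G\<^esub> (2 ^ k :: nat) = Affine x2 y2" "unit w" "inverse x2 = inverse x * (4 ^ k * w)"
      using *[of k] by blast
    have "x1 = x2" using eq 1(1) 2(1) by simp
    then have "inverse x * (4 ^ i * u) = inverse x * (4 ^ k * w)" using 1(3) 2(3) by (simp only:)
    then have u: "4 ^ i * u = 4 ^ k * w" using x0 by simp
    obtain n where k: "k = i + Suc n" using \<open>i < k\<close> less_iff_Suc_add[of i k] by auto
    have "4 ^ i * u = 4 ^ i * (2 * (2 * 4 ^ n * w))" using u unfolding k by (simp add: power_add)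
    then have "u = 2 * (2 * 4 ^ n * w)" by simp
    moreover have "mm (2 * (2 * 4 ^ n * w))" using 2(2) by (intro mm_even A_intros) (simp add: unit_def)
    ultimately show False using unit_not_mm[OF 1(2)] by simp
  qed
  have md: "?P [^]\<^bsub>G\<^esub> (n::nat) = ?P [^]\<^bsub>G\<^esub> (n mod N)" for n
  proof -
    have "?P [^]\<^bsub>G\<^esub> n = ?P [^]\<^bsub>G\<^esub> (N * (n div N) + n mod N)" by simp
    also have "\<dots> = ?P [^]\<^bsub>G\<^esub> (N * (n div N)) \<otimes>\<^bsub>G\<^esub> ?P [^]\<^bsub>G\<^esub> (n mod N)" using Pc by (rule nat_pow_mult[symmetric])
    also have "?P [^]\<^bsub>G\<^esub> (N * (n div N)) = (?P [^]\<^bsub>G\<^esub> N) [^]\<^bsub>G\<^esub> (n div N)" using Pc by (rule nat_pow_pow[symmetric])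
    finally show ?thesis using Pc by (simp add: tor)
  qed
  have "range (\<lambda>i::nat. ?P [^]\<^bsub>G\<^esub> (2 ^ i :: nat)) \<subseteq> (\<lambda>n::nat. ?P [^]\<^bsub>G\<^esub> n) ` {..<N}"
  proof
    fix Q assume "Q \<in> range (\<lambda>i::nat. ?P [^]\<^bsub>G\<^esub> (2 ^ i :: nat))"
    then obtain i :: nat where "Q = ?P [^]\<^bsub>G\<^esub> (2 ^ i :: nat)" by blast
    then have "Q = ?P [^]\<^bsub>G\<^esub> (2 ^ i mod N)" using md by simp
    then show "Q \<in> (\<lambda>n::nat. ?P [^]\<^bsub>G\<^esub> n) ` {..<N}" using N by (intro image_eqI[of _ _ "2 ^ i mod N"]) auto
  qed
  then have "finite (range (\<lambda>i::nat. ?P [^]\<^bsub>G\<^esub> (2 ^ i :: nat)))" by (rule finite_subset) simp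
  moreover have "inj (\<lambda>i::nat. ?P [^]\<^bsub>G\<^esub> (2 ^ i :: nat))"
    using distinct by (intro injI) (metis linorder_neqE)
  ultimately show False using finite_imageD infinite_UNIV_nat by blast
qed

text \<open>As \<open>z\<close> is negligible against \<open>x\<close>, one gets
  \<open>x' * (1 - \<zeta>)\<^sup>2 = z * (1 + B)\<close> with \<open>\<zeta>\<close> and
  \<open>B\<close> in the maximal ideal: up to a unit the sum has the abscissa \<open>z\<close> of
  the point farther from the identity.\<close>

lemma large_sum:
  assumes P: "on_curve E x y" and Q: "on_curve E z w" and x: "large x" and z: "large z" and zx: "mm (z * inverse x)"
  shows "\<exists>x' y'. point_add E (Affine x y) (Affine z w) = Affine x' y' \<and> on_curve E x' y' \<and> large x'"
proof -
  define g where "g = (2 ^ j :: 'a)"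
  obtain \<tau> where \<tau>: "\<tau> \<in> A" "inverse x = 8 * g\<^sup>2 * \<tau>" and x0: "x \<noteq> 0" using x unfolding large_def g_def by blast
  obtain \<rho> where \<rho>: "\<rho> \<in> A" "inverse z = 8 * g\<^sup>2 * \<rho>" and z0: "z \<noteq> 0" using z unfolding large_def g_def by blast
  define t s where ts: "t = inverse x" "s = inverse z"
  have gA: "g \<in> A" unfolding g_def by (intro A_intros)
  define \<alpha>1 \<alpha>2 \<alpha>3 where \<alpha>: "\<alpha>1 = g * a1 E" "\<alpha>2 = g * a2 E" "\<alpha>3 = g * a3 E"
  have \<alpha>A: "\<alpha>1 \<in> A" "\<alpha>2 \<in> A" "\<alpha>3 \<in> A" unfolding \<alpha> g_def using clear by auto
  have small: "mm (a1 E * q)" "mm (a2 E * q)" "mm (a3 E * q)" "mm ((a1 E)\<^sup>2 * q)" "mm q"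
    if "q = 8 * g\<^sup>2 * \<tau>" "\<tau> \<in> A" for q \<tau>
  proof -
    have eqs: "a1 E * q = 2 * (4 * g * \<alpha>1 * \<tau>)" "a2 E * q = 2 * (4 * g * \<alpha>2 * \<tau>)" "a3 E * q = 2 * (4 * g * \<alpha>3 * \<tau>)"
      "(a1 E)\<^sup>2 * q = 2 * (4 * \<alpha>1\<^sup>2 * \<tau>)" "q = 2 * (4 * g\<^sup>2 * \<tau>)"
      unfolding that \<alpha> by (simp_all add: power2_eq_square)
    show "mm (a1 E * q)" "mm (a2 E * q)" "mm (a3 E * q)" "mm ((a1 E)\<^sup>2 * q)"
      unfolding eqs(1-4) by (intro mm_even A_intros \<alpha>A gA \<open>\<tau> \<in> A\<close>)+
    have "mm (2 * (4 * g\<^sup>2 * \<tau>))" by (intro mm_even A_intros gA \<open>\<tau> \<in> A\<close>)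
    then show "mm q" using eqs(5) by simp
  qed
  note st = small[OF \<tau>(2,1), folded ts] and ss = small[OF \<rho>(2,1), folded ts]
  \<comment> \<open>Ordinates grow like the power 3/2 of the abscissa, so
    \<open>y / x\<^sup>2\<close> is small; its bounds come from the quadratic equation that the
    curve gives for it. The product \<open>a1 E * \<eta>\<close> satisfies a quadratic equation of
    its own with the square of \<open>a1 E\<close> in it, which the factor
    \<open>(2 ^ j)\<^sup>2\<close> in \<open>large\<close> absorbs.\<close>
  have eta: "\<exists>\<alpha>\<in>A. \<eta> \<in> A \<and> mm (a1 E * \<eta>) \<and> \<eta>\<^sup>2 = inverse x * \<alpha>"
    if "on_curve E x y" "x \<noteq> 0" "mm (a1 E * inverse x)" "mm (a2 E * inverse x)" "mm (a3 E * inverse x)"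
      "mm ((a1 E)\<^sup>2 * inverse x)" "mm (inverse x)" "\<eta> = y * (inverse x)\<^sup>2" for x y \<eta>
  proof -
    define q where "q = inverse x"
    have qx: "x = inverse q" and q0: "q \<noteq> 0" using that(2) by (auto simp: q_def)
    note q = that(3-7)[folded q_def]
    have y: "y = \<eta> * x\<^sup>2" using that(2,8) by (simp add: field_simps)
    have "y\<^sup>2 + a1 E * x * y + a3 E * y - x ^ 3 - a2 E * x\<^sup>2 = 0" using that(1) by (simp add: on_curve_def tate)
    moreover have "q ^ 4 * (y\<^sup>2 + a1 E * x * y + a3 E * y - x ^ 3 - a2 E * x\<^sup>2)
        = \<eta>\<^sup>2 + (a1 E * q + a3 E * q\<^sup>2) * \<eta> - q * (1 + a2 E * q)"
      unfolding y qx using q0 by (simp add: field_simps eval_nat_numeral)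
    ultimately have "\<eta>\<^sup>2 + (a1 E * q + a3 E * q\<^sup>2) * \<eta> = q * (1 + a2 E * q)" by simp
    then have eq: "\<eta>\<^sup>2 + (a1 E * q + q * (a3 E * q)) * \<eta> = q * (1 + a2 E * q)" by (simp add: power2_eq_square algebra_simps)
    have b: "mm (a1 E * q + q * (a3 E * q))" by (rule mm_add[OF q(1) mm_mult[OF mm_A[OF q(5)] q(3)]])
    have u: "1 + a2 E * q \<in> A" using q(2) by (auto simp: mm_def intro: A_intros)
    have \<eta>: "\<eta> \<in> A"
      by (rule mm_A, rule quadratic_mm[OF eq b]) (rule mm_mult2[OF u q(5)])
    have b': "mm ((a1 E)\<^sup>2 * q + (a1 E * q) * (a3 E * q))"
      by (rule mm_add[OF q(4) mm_mult[OF mm_A[OF q(1)] q(3)]])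
    have "(a1 E * \<eta>)\<^sup>2 + ((a1 E)\<^sup>2 * q + (a1 E * q) * (a3 E * q)) * (a1 E * \<eta>) = (a1 E)\<^sup>2 * (\<eta>\<^sup>2 + (a1 E * q + q * (a3 E * q)) * \<eta>)"
      by (simp add: power2_eq_square algebra_simps)
    also have "\<dots> = (a1 E)\<^sup>2 * q * (1 + a2 E * q)" unfolding eq by simp
    finally have "mm (a1 E * \<eta>)" using quadratic_mm[OF _ b' mm_mult2[OF u q(4)]] by blast
    moreover have "\<eta>\<^sup>2 = q * ((1 + a2 E * q) - a1 E * \<eta> - (a3 E * q) * \<eta>)"
      using eq by (simp add: power2_eq_square algebra_simps)
    moreover have "(1 + a2 E * q) - a1 E * \<eta> - (a3 E * q) * \<eta> \<in> A"
      by (rule A_intros(6)[OF A_intros(6)[OF u mm_A[OF \<open>mm (a1 E * \<eta>)\<close>]] A_intros(4)[OF mm_A[OF q(3)] \<eta>]])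
    ultimately show ?thesis using \<eta> unfolding q_def by blast
  qed
  define \<eta> where "\<eta> = y * t\<^sup>2"
  define \<omega> where "\<omega> = w * s\<^sup>2"
  obtain \<alpha> where \<eta>: "\<alpha> \<in> A" "\<eta> \<in> A" "mm (a1 E * \<eta>)" "\<eta>\<^sup>2 = t * \<alpha>"
    using eta[OF P x0, of \<eta>] st unfolding ts \<eta>_def by blast
  obtain \<beta> where \<omega>: "\<beta> \<in> A" "\<omega> \<in> A" "mm (a1 E * \<omega>)" "\<omega>\<^sup>2 = s * \<beta>"
    using eta[OF Q z0, of \<omega>] ss unfolding ts \<omega>_def by blast
  define \<zeta> where "\<zeta> = z * t"
  have \<zeta>: "mm \<zeta>" using zx by (simp add: \<zeta>_def ts)
  have sz: "s * z = 1" using z0 by (simp add: ts)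
  \<comment> \<open>This product comes from the mixed term \<open>2 * y * w\<close> of the chord
    formula. Only its square is bounded directly; the factor 2 in \<open>B\<close> then supplies the
    smallness.\<close>
  have "(\<eta> * \<omega> * z)\<^sup>2 = \<eta>\<^sup>2 * \<omega>\<^sup>2 * z\<^sup>2" by (simp only: power_mult_distrib)
  also have "\<dots> = \<alpha> * \<beta> * ((s * z) * (z * t))" unfolding \<eta>(4) \<omega>(4) by (simp add: power2_eq_square)
  also have "\<dots> = \<alpha> * \<beta> * \<zeta>" by (simp add: sz \<zeta>_def)
  also have "\<dots> \<in> A" using \<eta>(1) \<omega>(1) mm_A[OF \<zeta>] by (intro A_intros)
  finally have \<xi>: "\<eta> * \<omega> * z \<in> A" by (rule sqrt_in_A)
  define B where "B = \<zeta> + 2 * (a2 E * t) - (a3 E * s) * \<eta> - (a3 E * t) * (\<omega> * \<zeta>) - 2 * (\<eta> * \<omega> * z) - a1 E * \<eta> - (a1 E * \<omega>) * \<zeta>"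
  have \<zeta>A: "\<zeta> \<in> A" using \<zeta> by (rule mm_A)
  have "mm (2 * (a2 E * t))" by (rule mm_even[OF mm_A[OF st(2)]])
  moreover have "mm ((a3 E * s) * \<eta>)" by (rule mm_mult2[OF \<eta>(2) ss(3)])
  moreover have "mm ((a3 E * t) * (\<omega> * \<zeta>))" by (rule mm_mult2[OF A_intros(4)[OF \<omega>(2) \<zeta>A] st(3)])
  moreover have "mm (2 * (\<eta> * \<omega> * z))" by (rule mm_even[OF \<xi>])
  moreover have "mm ((a1 E * \<omega>) * \<zeta>)" by (rule mm_mult2[OF \<zeta>A \<omega>(3)])
  ultimately have B: "mm B" unfolding B_def using \<zeta> \<eta>(3)
    by (blast intro: mm_diff mm_add)
  have nez: "x \<noteq> z"
  proof
    assume "x = z"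
    then have "\<zeta> = 1" using x0 by (simp add: \<zeta>_def ts)
    then show False using \<zeta> not_mm_1 by simp
  qed
  define l where "l = (w - y) / (z - x)"
  define x' where "x' = l\<^sup>2 + a1 E * l - a2 E - x - z"
  define y' where "y' = - (l + a1 E) * x' - (y - l * x) - a3 E"
  have add: "point_add E (Affine x y) (Affine z w) = Affine x' y'"
    using nez unfolding point_add.simps Let_def x'_def y'_def l_def by simp
  have cx: "y\<^sup>2 = x ^ 3 + a2 E * x\<^sup>2 - a1 E * x * y - a3 E * y" and cz: "w\<^sup>2 = z ^ 3 + a2 E * z\<^sup>2 - a1 E * z * w - a3 E * w"
    using P Q by (simp_all add: on_curve_def tate algebra_simps)
  have lz: "l * (z - x) = w - y" unfolding l_def using nez by simp
  have "x' * (z - x)\<^sup>2 = (l * (z - x))\<^sup>2 + a1 E * (l * (z - x)) * (z - x) - (a2 E + x + z) * (z - x)\<^sup>2"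
    unfolding x'_def by (simp add: algebra_simps power2_eq_square)
  also have "\<dots> = (w - y)\<^sup>2 + a1 E * (w - y) * (z - x) - (a2 E + x + z) * (z - x)\<^sup>2"
    unfolding lz ..
  also have "\<dots> = (w\<^sup>2 - 2 * w * y + y\<^sup>2) + a1 E * (w - y) * (z - x) - (a2 E + x + z) * (z - x)\<^sup>2"
    by (simp add: power2_eq_square algebra_simps)
  also have "\<dots> = x\<^sup>2 * z + x * z\<^sup>2 + 2 * a2 E * x * z - a3 E * (y + w) - 2 * y * w - a1 E * (y * z + w * x)"
    unfolding cx cz by (simp add: power2_eq_square power3_eq_cube algebra_simps)
  also have "\<dots> = x\<^sup>2 * z * (1 + B)"
    unfolding B_def \<eta>_def \<omega>_def \<zeta>_def ts using x0 z0 by (simp add: field_simps power2_eq_square)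
  finally have "x' * (z - x)\<^sup>2 = x\<^sup>2 * z * (1 + B)" .
  moreover have "(z - x)\<^sup>2 = x\<^sup>2 * (1 - \<zeta>)\<^sup>2"
    unfolding \<zeta>_def ts using x0 by (simp add: field_simps power2_eq_square)
  ultimately have "x\<^sup>2 * (x' * (1 - \<zeta>)\<^sup>2) = x\<^sup>2 * (z * (1 + B))" by (simp add: mult_ac)
  then have x': "x' * (1 - \<zeta>)\<^sup>2 = z * (1 + B)" using x0 by simp
  have u1: "unit (1 + B)" using B by (rule unit_1_add)
  have "unit (1 - \<zeta>)" using unit_1_add[OF mm_minus[OF \<zeta>]] by simp
  then have u2: "unit ((1 - \<zeta>)\<^sup>2)" by (rule unit_power)
  have x'0: "x' \<noteq> 0" using x' z0 u1 by (auto simp: unit_def)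
  have "inverse x' = inverse z * ((1 - \<zeta>)\<^sup>2 / (1 + B))"
    using x' x'0 z0 u1 u2 by (auto simp: unit_def field_simps)
  moreover have "(1 - \<zeta>)\<^sup>2 / (1 + B) \<in> A" using unit_divide[OF u2 u1] by (simp add: unit_def)
  ultimately have "large x'" using large_unit[OF z] x'0 by blast
  moreover have "on_curve E x' y'"
    using point_add_closed[OF ns, of "Affine x y" "Affine z w"] P Q unfolding add by (simp add: Affine_in_rational_points)
  ultimately show ?thesis using add by blast
qed

end

section \<open>Conjugate points\<close>

context
  fixes F :: "'a::field_char_0 set" and x1 x2 :: 'a
  assumes F: "is_subfield F"
    and conj: "\<And>u. u \<in> polys_over F \<Longrightarrow> poly u x1 = 0 \<longleftrightarrow> poly u x2 = 0"
begin

text \<open>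
  The graph of the conjugation \<open>x1 \<mapsto> x2\<close> over \<open>F\<close>, as a relation: no field embedding has to be
  constructed.
\<close>

definition crel :: "'a \<Rightarrow> 'a \<Rightarrow> bool" where
  "crel a b \<longleftrightarrow> (\<exists>u\<in>polys_over F. \<exists>w\<in>polys_over F. poly w x1 \<noteq> 0 \<and>
     a = poly u x1 / poly w x1 \<and> b = poly u x2 / poly w x2)"

lemma crelI: "u \<in> polys_over F \<Longrightarrow> w \<in> polys_over F \<Longrightarrow> poly w x1 \<noteq> 0 \<Longrightarrow>
    crel (poly u x1 / poly w x1) (poly u x2 / poly w x2)"
  unfolding crel_def by blast

lemma crel_poly: "u \<in> polys_over F \<Longrightarrow> crel (poly u x1) (poly u x2)"
  using crelI[of u 1] polys_over_intros(2)[OF F] by simp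

lemma crel_const: "a \<in> F \<Longrightarrow> crel a a"
  using crel_poly[of "[:a:]"] polys_over_intros(1,7)[OF F] by simp

lemma crel_gen: "crel x1 x2"
  using crel_poly[of "[:0, 1:]"] polys_over_intros(1,7)[OF F] is_subfieldD(1,2)[OF F] by simp

lemma crelE:
  assumes "crel a b"
  obtains u w where "u \<in> polys_over F" "w \<in> polys_over F" "poly w x1 \<noteq> 0" "poly w x2 \<noteq> 0"
    "a = poly u x1 / poly w x1" "b = poly u x2 / poly w x2"
  using assms conj unfolding crel_def by blast

lemma crel_add: "crel a b \<Longrightarrow> crel a' b' \<Longrightarrow> crel (a + a') (b + b')"
proof -
  assume "crel a b" "crel a' b'"
  then obtain u w u' w' where *: "u \<in> polys_over F" "w \<in> polys_over F" "poly w x1 \<noteq> 0" "poly w x2 \<noteq> 0"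
    "a = poly u x1 / poly w x1" "b = poly u x2 / poly w x2"
    "u' \<in> polys_over F" "w' \<in> polys_over F" "poly w' x1 \<noteq> 0" "poly w' x2 \<noteq> 0"
    "a' = poly u' x1 / poly w' x1" "b' = poly u' x2 / poly w' x2" by (elim crelE)
  have "crel (poly (u * w' + u' * w) x1 / poly (w * w') x1) (poly (u * w' + u' * w) x2 / poly (w * w') x2)"
    using * by (intro crelI polys_over_intros[OF F]) auto
  then show ?thesis using * by (simp add: add_frac_eq)
qed

lemma crel_mult: "crel a b \<Longrightarrow> crel a' b' \<Longrightarrow> crel (a * a') (b * b')"
proof -
  assume "crel a b" "crel a' b'"
  then obtain u w u' w' where *: "u \<in> polys_over F" "w \<in> polys_over F" "poly w x1 \<noteq> 0" "poly w x2 \<noteq> 0"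
    "a = poly u x1 / poly w x1" "b = poly u x2 / poly w x2"
    "u' \<in> polys_over F" "w' \<in> polys_over F" "poly w' x1 \<noteq> 0" "poly w' x2 \<noteq> 0"
    "a' = poly u' x1 / poly w' x1" "b' = poly u' x2 / poly w' x2" by (elim crelE)
  have "crel (poly (u * u') x1 / poly (w * w') x1) (poly (u * u') x2 / poly (w * w') x2)"
    using * by (intro crelI polys_over_intros[OF F]) auto
  then show ?thesis using * by simp
qed

lemma crel_zero_iff: "crel a b \<Longrightarrow> a = 0 \<longleftrightarrow> b = 0"
  using conj by (elim crelE) auto

lemma crel_minus: "crel a b \<Longrightarrow> crel (- a) (- b)"
  using crel_mult[OF crel_const[of "- 1"], of a b] is_subfieldD(2,5)[OF F] by simp

lemma crel_diff: "crel a b \<Longrightarrow> crel a' b' \<Longrightarrow> crel (a - a') (b - b')"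
  using crel_add[of a b "- a'" "- b'"] crel_minus[of a' b'] by simp

lemma crel_inverse: "crel a b \<Longrightarrow> crel (inverse a) (inverse b)"
proof (cases "a = 0")
  case True
  moreover assume "crel a b"
  ultimately show ?thesis using crel_zero_iff[of a b] by simp
next
  case False
  assume "crel a b"
  then obtain u w where *: "u \<in> polys_over F" "w \<in> polys_over F" "poly w x1 \<noteq> 0"
    "a = poly u x1 / poly w x1" "b = poly u x2 / poly w x2" by (elim crelE)
  with False crelI[of w u] show ?thesis by simp
qed

lemma crel_divide: "crel a b \<Longrightarrow> crel a' b' \<Longrightarrow> crel (a / a') (b / b')"
  unfolding divide_inverse by (intro crel_mult crel_inverse)

lemma crel_power: "crel a b \<Longrightarrow> crel (a ^ n) (b ^ n)"
  by (induction n) (auto intro: crel_mult crel_const is_subfieldD(2)[OF F])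

lemma crel_numeral: "crel (numeral k) (numeral k)"
  by (rule crel_const[OF is_subfieldD(11)[OF F]])

lemma crel_eq_iff: "crel a b \<Longrightarrow> crel a' b' \<Longrightarrow> a = a' \<longleftrightarrow> b = b'"
  using crel_zero_iff[OF crel_diff, of a b a' b'] by simp

lemmas crel_intros = crel_add crel_mult crel_minus crel_diff crel_divide crel_power crel_numeral

fun crel_point :: "'a point \<Rightarrow> 'a point \<Rightarrow> bool" where
  "crel_point Infinity Infinity \<longleftrightarrow> True"
| "crel_point (Affine a b) (Affine a' b') \<longleftrightarrow> crel a a' \<and> crel b b'"
| "crel_point _ _ \<longleftrightarrow> False"

text \<open>Every case distinction in the group law is an equation between related quantities, which
  the conjugation preserves and reflects, so both sides follow the same branch.\<close>

lemma crel_point_add: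
  assumes E: "{a1 E, a2 E, a3 E, a4 E, a6 E} \<subseteq> F" and "crel_point P P'" "crel_point Q Q'"
  shows "crel_point (point_add E P Q) (point_add E P' Q')"
proof (cases P; cases P'; cases Q; cases Q')
  fix u1 w1 u1' w1' u2 w2 u2' w2'
  assume PQ: "P = Affine u1 w1" "P' = Affine u1' w1'" "Q = Affine u2 w2" "Q' = Affine u2' w2'"
  have e: "crel (a1 E) (a1 E)" "crel (a2 E) (a2 E)" "crel (a3 E) (a3 E)" "crel (a4 E) (a4 E)"
    using E by (auto intro: crel_const)
  have r: "crel u1 u1'" "crel w1 w1'" "crel u2 u2'" "crel w2 w2'" using assms(2,3) by (auto simp: PQ)
  have xeq: "u1 = u2 \<longleftrightarrow> u1' = u2'" by (rule crel_eq_iff[OF r(1,3)])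
  have yeq: "w1 + w2 + a1 E * u2 + a3 E = 0 \<longleftrightarrow> w1' + w2' + a1 E * u2' + a3 E = 0"
    by (intro crel_zero_iff crel_intros e r)
  let ?L = "\<lambda>x1 y1 x2 y2. if x1 = x2
                 then (3 * x1\<^sup>2 + 2 * a2 E * x1 + a4 E - a1 E * y1) / (2 * y1 + a1 E * x1 + a3 E)
                 else (y2 - y1) / (x2 - x1)"
  have l: "crel (?L u1 w1 u2 w2) (?L u1' w1' u2' w2')"
  proof (cases "u1 = u2")
    case True
    then show ?thesis unfolding if_P[OF True] if_P[OF True[unfolded xeq]] by (intro crel_intros e r)
  next
    case False
    then show ?thesis unfolding if_not_P[OF False] if_not_P[OF False[unfolded xeq]] by (intro crel_intros e r)
  qed
  define l l' where ll: "l = ?L u1 w1 u2 w2" "l' = ?L u1' w1' u2' w2'"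
  have l: "crel l l'" unfolding ll by (rule l)
  show ?thesis
  proof (cases "u1 = u2 \<and> w1 + w2 + a1 E * u2 + a3 E = 0")
    case True
    with xeq yeq show ?thesis by (simp add: PQ)
  next
    case False
    then have False': "\<not> (u1' = u2' \<and> w1' + w2' + a1 E * u2' + a3 E = 0)" using xeq yeq by blast
    show ?thesis unfolding PQ point_add.simps if_not_P[OF False] if_not_P[OF False'] Let_def ll[symmetric] crel_point.simps
      by (intro conjI crel_intros e r l)
  qed
qed (use assms in auto)

text \<open>The conjugation relates the two multiples by \<open>N\<close>, and an element of
  \<open>F\<close> is related only to itself.\<close>

lemma conjugate_multiples:
  assumes E: "{a1 E, a2 E, a3 E, a4 E, a6 E} \<subseteq> F" and s: "s \<in> F" and m: "m \<in> F"
    and N: "Affine x1 (s * x1 + m) [^]\<^bsub>mordell_weil_group E UNIV\<^esub> (N::nat) \<in> rational_points E F"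
  shows "Affine x1 (s * x1 + m) [^]\<^bsub>mordell_weil_group E UNIV\<^esub> N = Affine x2 (s * x2 + m) [^]\<^bsub>mordell_weil_group E UNIV\<^esub> N"
proof -
  let ?G = "mordell_weil_group E UNIV"
  let ?R1 = "Affine x1 (s * x1 + m)" and ?R2 = "Affine x2 (s * x2 + m)"
  have 0: "crel_point ?R1 ?R2" using crel_const[OF s] crel_const[OF m] crel_gen by (auto intro!: crel_intros)
  have "crel_point (?R1 [^]\<^bsub>?G\<^esub> k) (?R2 [^]\<^bsub>?G\<^esub> k)" for k :: nat
  proof (induction k)
    case 0
    show ?case by (simp add: mordell_weil_group_def)
  next
    case (Suc k)
    from crel_point_add[OF E Suc 0] show ?case by (simp add: mordell_weil_group_def)
  qed
  then have c: "crel_point (?R1 [^]\<^bsub>?G\<^esub> N) (?R2 [^]\<^bsub>?G\<^esub> N)" .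
  have "P = Q" if "crel_point P Q" "P \<in> rational_points E F" for P Q
    using that
  proof (cases P; cases Q)
    fix a b a' b' assume PQ: "P = Affine a b" "Q = Affine a' b'"
    then have "crel a a'" "crel b b'" "crel a a" "crel b b"
      using that by (auto simp: Affine_in_rational_points intro: crel_const)
    then show ?thesis using crel_eq_iff[of a a' a a] crel_eq_iff[of b b' b b] by (auto simp: PQ)
  qed auto
  with c N show ?thesis by blast
qed

end

text \<open>In degree two or three, having no root in \<open>F\<close> means being irreducible, so
  the minimal polynomial of \<open>x1\<close> is \<open>g\<close> up to a constant.\<close>

lemma conjugate_roots:
  fixes g :: "'a::field_char_0 poly"
  assumes F: "is_subfield F" and g: "g \<in> polys_over F" "degree g \<in> {2, 3}" and noroot: "\<And>x. x \<in> F \<Longrightarrow> poly g x \<noteq> 0"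
    and x: "poly g x1 = 0" "poly g x2 = 0" and u: "u \<in> polys_over F" "poly u x1 = 0"
  shows "poly u x2 = 0"
proof -
  have g0: "g \<noteq> 0" using g(2) by auto
  obtain \<mu> where \<mu>: "\<mu> \<in> polys_over F" "\<mu> \<noteq> 0" "poly \<mu> x1 = 0"
    "\<And>q. q \<in> polys_over F \<Longrightarrow> poly q x1 = 0 \<Longrightarrow> \<exists>r\<in>polys_over F. q = \<mu> * r"
    using minimal_polynomial[OF F g(1) g0 x(1)] by metis
  obtain r where r: "r \<in> polys_over F" "g = \<mu> * r" using \<mu>(4)[OF g(1) x(1)] by blast
  obtain r' where r': "u = \<mu> * r'" using \<mu>(4)[OF u] by blast
  have deg: "degree g = degree \<mu> + degree r" using r g0 by (simp add: degree_mult_eq)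
  have lin: False if "q \<in> polys_over F" "degree q = 1" "q dvd g" for q
  proof -
    have "\<exists>a b. q = [:a, b:] \<and> b \<noteq> 0" using degree1_coeffs[OF that(2)] by metis
    then obtain a b where ab: "q = [:a, b:]" "b \<noteq> 0" by blast
    have "a \<in> F" "b \<in> F" using that(1) unfolding ab polys_over_def by (auto dest: spec[of _ 0] spec[of _ 1])
    then have "- (a / b) \<in> F" by (intro is_subfieldD(5,8)[OF F])
    moreover have "poly q (- (a / b)) = 0" using ab by simp
    ultimately show False using noroot[of "- (a / b)"] that(3) by (auto elim!: dvdE)
  qed
  have "degree \<mu> \<noteq> 0"
  proof
    assume "degree \<mu> = 0"
    then obtain a where "\<mu> = [:a:]" by (elim degree_eq_zeroE)
    with \<mu>(2,3) show False by simp
  qed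
  moreover have "degree \<mu> \<noteq> 1" using lin[OF \<mu>(1)] r(2) by auto
  moreover have "degree r \<noteq> 1" using lin[OF r(1)] r(2) by auto
  ultimately have "degree r = 0" using deg g(2) by auto
  then obtain c where "r = [:c:]" by (elim degree_eq_zeroE)
  with r(2) g0 have "poly \<mu> x2 = 0" using x(2) by auto
  then show ?thesis by (simp add: r')
qed

section \<open>Groups of finite rank\<close>

lemma (in comm_group) finprod_int_powers_in_subgroup:
  assumes "subgroup H G" "finite S" "S \<subseteq> H"
  shows "finprod G (\<lambda>s. s [^] (c s :: int)) S \<in> H"
  using assms(2,3)
proof (induction S)
  case empty
  then show ?case using subgroup.one_closed[OF assms(1)] by simp
next
  case (insert x S)
  have H: "H \<subseteq> carrier G" using assms(1) by (rule subgroup.subset)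
  then have "finprod G (\<lambda>s. s [^] c s) (insert x S) = x [^] c x \<otimes> finprod G (\<lambda>s. s [^] c s) S"
    using insert by (intro finprod_insert) (auto intro!: int_pow_closed)
  moreover have "x [^] c x \<in> H" using insert.prems subgroup_int_pow_closed[OF assms(1)] by simp
  ultimately show ?case using insert subgroup.m_closed[OF assms(1)] by simp
qed

text \<open>\<open>S\<close> is an independent set of maximal size, so a relation on
  \<open>insert R S\<close> must involve \<open>R\<close>. Quantifying over all subgroups that
  contain \<open>S\<close> allows \<open>H\<close> to be the group of points over a smaller
  field.\<close>

lemma finite_rank_hull:
  fixes G (structure)
  assumes G: "comm_group G" and rank: "abelian_rank G \<noteq> \<infinity>"
  shows "\<exists>S. finite S \<and> S \<subseteq> carrier G \<and>
    (\<forall>R\<in>carrier G. \<exists>N>0. \<forall>H. subgroup H G \<longrightarrow> S \<subseteq> H \<longrightarrow> R [^]\<^bsub>G\<^esub> (N::nat) \<in> H)"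
proof -
  interpret comm_group G by (rule G)
  define P where "P S \<longleftrightarrow> finite S \<and> S \<subseteq> carrier G \<and> int_independent G S" for S
  obtain n where n: "abelian_rank G = enat n" using rank by auto
  have bound: "card S \<le> n" if "P S" for S
  proof -
    have "enat (card S) \<le> abelian_rank G"
      unfolding abelian_rank_def using that unfolding P_def by (intro SUP_upper) auto
    then show ?thesis by (simp add: n)
  qed
  have "P {}" by (simp add: P_def int_independent_def)
  then obtain S where S: "P S" and max: "\<And>T. P T \<Longrightarrow> card T \<le> card S"
    using ex_has_greatest_nat[of P "{}" card "Suc n"] bound by (auto simp: less_Suc_eq_le)
  have fin: "finite S" and sub: "S \<subseteq> carrier G" and ind: "int_independent G S" using S by (auto simp: P_def)
  have "\<exists>N>0. \<forall>H. subgroup H G \<longrightarrow> S \<subseteq> H \<longrightarrow> R [^] (N::nat) \<in> H" if R: "R \<in> carrier G" for R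
  proof (cases "R \<in> S")
    case True
    then show ?thesis using R by (intro exI[of _ 1]) (auto simp: nat_pow_one)
  next
    case False
    then have "\<not> P (insert R S)" using max[of "insert R S"] fin by auto
    then have "\<not> int_independent G (insert R S)" using fin sub R by (simp add: P_def)
    then obtain c where c: "finprod G (\<lambda>s. s [^] (c s :: int)) (insert R S) = \<one>" "\<exists>s\<in>insert R S. c s \<noteq> 0"
      unfolding int_independent_def by blast
    let ?T = "finprod G (\<lambda>s. s [^] c s) S"
    have T: "?T \<in> carrier G" using sub by (intro finprod_closed) auto
    have "finprod G (\<lambda>s. s [^] c s) (insert R S) = R [^] c R \<otimes> ?T"
      using fin False R sub by (intro finprod_insert) auto
    then have eq: "R [^] c R \<otimes> ?T = \<one>" using c(1) by simp
    have cR: "c R \<noteq> 0"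
    proof
      assume "c R = 0"
      then have "?T = \<one>" using eq T by simp
      then have "\<forall>s\<in>S. c s = 0" using ind unfolding int_independent_def by blast
      with c(2) \<open>c R = 0\<close> show False by auto
    qed
    have "R [^] nat \<bar>c R\<bar> \<in> H" if H: "subgroup H G" "S \<subseteq> H" for H
    proof -
      have TH: "?T \<in> H" using finprod_int_powers_in_subgroup[OF H(1) fin H(2)] .
      have "R [^] c R = inv ?T" using eq T R by (metis int_pow_closed inv_equality m_comm)
      then have 1: "R [^] c R \<in> H" using subgroup.m_inv_closed[OF H(1) TH] by simp
      show ?thesis
      proof (cases "c R \<ge> 0")
        case True
        then have "R [^] nat \<bar>c R\<bar> = R [^] c R" by (metis abs_of_nonneg int_nat_eq int_pow_int)
        with 1 show ?thesis by simp
      next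
        case False
        then have "R [^] nat \<bar>c R\<bar> = R [^] (- c R)" by (metis abs_of_neg int_nat_eq int_pow_int linorder_not_le neg_0_le_iff_le less_imp_le)
        also have "\<dots> = inv (R [^] c R)" using R by (rule int_pow_neg)
        finally show ?thesis using subgroup.m_inv_closed[OF H(1) 1] by simp
      qed
    qed
    then show ?thesis using cR by (intro exI[of _ "nat \<bar>c R\<bar>"]) auto
  qed
  with fin sub show ?thesis by blast
qed

section \<open>The pencil of lines in Tate normal form\<close>

text \<open>Over an algebraically closed field the degree is the sum of the orders of the
  roots.\<close>

lemma order_dvd_degree:
  fixes p :: "'a::alg_closed_field poly"
  assumes "p \<noteq> 0" and "\<And>x. k dvd Polynomial.order x p"
  shows "k dvd degree p"
  using assms
proof (induction "degree p" arbitrary: p rule: less_induct)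
  case less
  show ?case
  proof (cases "degree p = 0")
    case False
    then obtain x where x: "poly p x = 0" using alg_closed_imp_poly_has_root[of p] by blast
    define n where "n = Polynomial.order x p"
    obtain q where q: "p = [:-x, 1:] ^ n * q" "\<not> [:-x, 1:] dvd q"
      using order_decomp[OF less.prems(1), of x] unfolding n_def by blast
    have q0: "q \<noteq> 0" using less.prems(1) q(1) by auto
    have n0: "n > 0" using x less.prems(1) by (simp add: n_def order_root)
    have deg: "degree p = n + degree q"
      using q(1) q0 by (simp add: degree_mult_eq degree_power_eq)
    have "k dvd Polynomial.order y q" for y
    proof (cases "y = x")
      case True
      then have "Polynomial.order y q = 0" using q(2) by (simp add: order_0I poly_eq_0_iff_dvd)
      then show ?thesis by simp
    next
      case False
      have "Polynomial.order y p = Polynomial.order y ([:-x, 1:] ^ n) + Polynomial.order y q"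
        unfolding q(1) using q0 by (intro order_mult) auto
      moreover have "Polynomial.order y ([:-x, 1:] ^ n) = 0"
        using False by (intro order_0I) simp
      ultimately show ?thesis using less.prems(2)[of y] by simp
    qed
    then have "k dvd degree q" using less.hyps[of q] deg n0 q0 by simp
    moreover have "k dvd n" using less.prems(2) by (simp add: n_def)
    ultimately show ?thesis by (simp add: deg)
  qed simp
qed

lemma even_order_imp_square:
  fixes p :: "'a::alg_closed_field poly"
  assumes "p \<noteq> 0" and "\<And>x. even (Polynomial.order x p)"
  shows "\<exists>r. p = r\<^sup>2"
  using assms
proof (induction "degree p" arbitrary: p rule: less_induct)
  case less
  show ?case
  proof (cases "degree p = 0")
    case True
    then obtain a where "p = [:a:]" by (elim degree_eq_zeroE)
    moreover obtain b where "b\<^sup>2 = a" using nth_root_exists[of 2 a] by auto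
    ultimately have "p = [:b:]\<^sup>2" by (simp add: power2_eq_square)
    then show ?thesis by blast
  next
    case False
    then obtain x where x: "poly p x = 0" using alg_closed_imp_poly_has_root[of p] by blast
    define n where "n = Polynomial.order x p"
    obtain q where q: "p = [:-x, 1:] ^ n * q" "\<not> [:-x, 1:] dvd q"
      using order_decomp[OF less.prems(1), of x] unfolding n_def by blast
    have q0: "q \<noteq> 0" using less.prems(1) q(1) by auto
    have n0: "n > 0" using x less.prems(1) by (simp add: n_def order_root)
    have deg: "degree p = n + degree q"
      using q(1) q0 by (simp add: degree_mult_eq degree_power_eq)
    have "even (Polynomial.order y q)" for y
    proof (cases "y = x")
      case True
      then have "Polynomial.order y q = 0" using q(2) by (simp add: order_0I poly_eq_0_iff_dvd)
      then show ?thesis by simp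
    next
      case False
      have "Polynomial.order y p = Polynomial.order y ([:-x, 1:] ^ n) + Polynomial.order y q"
        unfolding q(1) using q0 by (intro order_mult) auto
      moreover have "Polynomial.order y ([:-x, 1:] ^ n) = 0"
        using False by (intro order_0I) simp
      ultimately show ?thesis using less.prems(2)[of y] by simp
    qed
    then obtain r where r: "q = r\<^sup>2" using less.hyps[of q] deg n0 q0 by auto
    obtain k where "n = 2 * k" using less.prems(2)[of x] unfolding n_def by (elim evenE)
    then have "p = ([:-x, 1:] ^ k * r)\<^sup>2" using q(1) r by (simp add: power_mult_distrib power_mult[symmetric] mult.commute)
    then show ?thesis by blast
  qed
qed

locale tate_curve =
  fixes A1 A2 c :: "'a::{alg_closed_field, field_char_0}"
  assumes A2: "A2 \<noteq> 0" and c: "c \<noteq> 0"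
    and smooth: "\<And>x y. y\<^sup>2 + A1 * x * y + c * y = x ^ 3 + A2 * x\<^sup>2 \<Longrightarrow> 2 * y + A1 * x + c = 0 \<Longrightarrow>
      3 * x\<^sup>2 + 2 * A2 * x = A1 * y \<Longrightarrow> False"
begin

text \<open>
  On the line \<open>y = sx + m\<close> the abscissas are the roots of \<open>x\<^sup>3 + B x\<^sup>2 - (e m + c s) x - (m\<^sup>2 + c m)\<close>, and
  \<open>d\<close> is the discriminant of the quadratic left for \<open>m = 0\<close>. The parabola
  \<open>V = c s + n\<^sub>1/(s d) m + n\<^sub>2/(2 c s\<^sup>3 d\<^sup>2) m\<^sup>2\<close> is chosen so that \<open>d V\<^sup>2\<close> agrees with the discriminant of the
  cubic up to order \<open>m\<^sup>2\<close>; the remaining linear equation for \<open>m\<close> has the solution \<open>nump / Denp\<close>.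
\<close>

definition Bp where "Bp = [:A2, - A1, - 1:]"
definition ep where "ep = [:A1, 2:]"
definition sp :: "'a poly" where "sp = [:0, 1:]"
definition dp where "dp = Bp\<^sup>2 + smult (4 * c) sp"
definition q2p where "q2p = Bp\<^sup>2 * ep\<^sup>2 + smult (12 * c) (sp * ep\<^sup>2) + 4 * Bp ^ 3 - [:27 * c\<^sup>2:]
  + smult (18 * c) (Bp * (sp + ep))"
definition q3p where "q3p = 4 * ep ^ 3 - [:54 * c:] + 18 * Bp * ep"
definition n1p where "n1p = dp * (sp * ep + 2 * Bp) + smult c (sp * (2 * sp * ep + Bp))"
definition n2p where "n2p = sp\<^sup>2 * dp * q2p - n1p\<^sup>2"
definition Np where "Np = smult c (sp ^ 4 * dp\<^sup>2 * q3p) - n1p * n2p"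
definition Denp where "Denp = smult (108 * c\<^sup>2) (sp ^ 6 * dp ^ 3) + n2p\<^sup>2"
definition nump where "nump = smult (4 * c) (sp\<^sup>2 * dp * Np)"

lemma eval_simps:
  "poly Bp s = A2 - s\<^sup>2 - A1 * s" "poly ep s = 2 * s + A1" "poly sp s = s"
  "poly dp s = (poly Bp s)\<^sup>2 + 4 * c * s"
  "poly q2p s = (poly Bp s)\<^sup>2 * (poly ep s)\<^sup>2 + 12 * c * s * (poly ep s)\<^sup>2 + 4 * (poly Bp s) ^ 3
     - 27 * c\<^sup>2 + 18 * c * poly Bp s * (s + poly ep s)"
  "poly q3p s = 4 * (poly ep s) ^ 3 - 54 * c + 18 * poly Bp s * poly ep s"
  "poly n1p s = poly dp s * (s * poly ep s + 2 * poly Bp s) + c * s * (2 * s * poly ep s + poly Bp s)"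
  "poly n2p s = s\<^sup>2 * poly dp s * poly q2p s - (poly n1p s)\<^sup>2"
  "poly Np s = c * s ^ 4 * (poly dp s)\<^sup>2 * poly q3p s - poly n1p s * poly n2p s"
  "poly Denp s = 108 * c\<^sup>2 * s ^ 6 * (poly dp s) ^ 3 + (poly n2p s)\<^sup>2"
  "poly nump s = 4 * c * s\<^sup>2 * poly dp s * poly Np s"
proof -
  show "poly Bp s = A2 - s\<^sup>2 - A1 * s" by (simp add: Bp_def power2_eq_square algebra_simps)
  show "poly ep s = 2 * s + A1" by (simp add: ep_def)
  show sp: "poly sp s = s" by (simp add: sp_def)
  show "poly dp s = (poly Bp s)\<^sup>2 + 4 * c * s" by (simp add: dp_def sp)
  show "poly q2p s = (poly Bp s)\<^sup>2 * (poly ep s)\<^sup>2 + 12 * c * s * (poly ep s)\<^sup>2 + 4 * (poly Bp s) ^ 3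
     - 27 * c\<^sup>2 + 18 * c * poly Bp s * (s + poly ep s)" by (simp add: q2p_def sp)
  show "poly q3p s = 4 * (poly ep s) ^ 3 - 54 * c + 18 * poly Bp s * poly ep s" by (simp add: q3p_def)
  show "poly n1p s = poly dp s * (s * poly ep s + 2 * poly Bp s) + c * s * (2 * s * poly ep s + poly Bp s)"
    by (simp add: n1p_def sp)
  show "poly n2p s = s\<^sup>2 * poly dp s * poly q2p s - (poly n1p s)\<^sup>2" by (simp add: n2p_def sp)
  show "poly Np s = c * s ^ 4 * (poly dp s)\<^sup>2 * poly q3p s - poly n1p s * poly n2p s" by (simp add: Np_def sp)
  show "poly Denp s = 108 * c\<^sup>2 * s ^ 6 * (poly dp s) ^ 3 + (poly n2p s)\<^sup>2" by (simp add: Denp_def sp)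
  show "poly nump s = 4 * c * s\<^sup>2 * poly dp s * poly Np s" by (simp add: nump_def sp)
qed

lemma coeffs_in_subfield:
  assumes F: "is_subfield F" and "A1 \<in> F" "A2 \<in> F" "c \<in> F"
  shows "dp \<in> polys_over F" "Denp \<in> polys_over F" "nump \<in> polys_over F"
proof -
  note pi = polys_over_intros[OF F] is_subfieldD[OF F] assms(2-4)
  have 1: "Bp \<in> polys_over F" "ep \<in> polys_over F" "sp \<in> polys_over F"
    unfolding Bp_def ep_def sp_def by (intro pi)+
  show 2: "dp \<in> polys_over F" unfolding dp_def by (intro pi 1)
  have 3: "q2p \<in> polys_over F" "q3p \<in> polys_over F" "n1p \<in> polys_over F"
    unfolding q2p_def q3p_def n1p_def by (intro pi 1 2)+
  have 4: "n2p \<in> polys_over F" unfolding n2p_def by (intro pi 1 2 3)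
  show "Denp \<in> polys_over F" unfolding Denp_def by (intro pi 1 2 3 4)
  have "Np \<in> polys_over F" unfolding Np_def by (intro pi 1 2 3 4)
  then show "nump \<in> polys_over F" unfolding nump_def by (intro pi 1 2)
qed

lemma degree_dp: "degree dp = 4" "lead_coeff dp = 1"
proof -
  have "dp = [:A2\<^sup>2, 4 * c - 2 * A1 * A2, A1\<^sup>2 - 2 * A2, 2 * A1, 1:]"
    by (simp add: dp_def Bp_def sp_def power2_eq_square algebra_simps)
  then show "degree dp = 4" "lead_coeff dp = 1" by simp_all
qed

text \<open>The leading terms cancel: \<open>ep\<^sup>2 + 4 * Bp\<close> is the constant
  \<open>A1\<^sup>2 + 4 * A2\<close>, and \<open>sp * ep + 2 * Bp\<close> has degree at most one.
  The expansion lets the degree 10 and the leading coefficient \<open>4 * A2\<close> be read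
  off.\<close>

lemma n2p_explicit: "n2p = [:- 4 * A2 ^ 6, 20 * A1 * A2 ^ 5 - 36 * A2 ^ 4 * c, - 40 * A1 ^ 2 * A2 ^ 4 + 120 * A1 * A2 ^ 3 *
      c + 20 * A2 ^ 5 - 108 * A2 ^ 2 * c ^ 2, 40 * A1 ^ 3 * A2 ^ 3 - 140 * A1 ^ 2 * A2 ^ 2 * c -
      80 * A1 * A2 ^ 4 + 180 * A1 * A2 * c ^ 2 + 130 * A2 ^ 3 * c - 108 * c ^ 3, - 20 * A1 ^ 4 *
      A2 ^ 2 + 64 * A1 ^ 3 * A2 * c + 120 * A1 ^ 2 * A2 ^ 3 - 60 * A1 ^ 2 * c ^ 2 - 302 * A1 *
      A2 ^ 2 * c - 40 * A2 ^ 4 + 216 * A2 * c ^ 2, 4 * A1 ^ 5 * A2 - 8 * A1 ^ 4 * c - 80 * A1 ^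
      3 * A2 ^ 2 + 206 * A1 ^ 2 * A2 * c + 120 * A1 * A2 ^ 3 - 132 * A1 * c ^ 2 - 158 * A2 ^ 2 *
      c, 20 * A1 ^ 4 * A2 - 34 * A1 ^ 3 * c - 120 * A1 ^ 2 * A2 ^ 2 + 212 * A1 * A2 * c + 40 *
      A2 ^ 3 - 60 * c ^ 2, 40 * A1 ^ 3 * A2 - 50 * A1 ^ 2 * c - 80 * A1 * A2 ^ 2 + 70 * A2 * c,
      40 * A1 ^ 2 * A2 - 30 * A1 * c - 20 * A2 ^ 2, 20 * A1 * A2 - 6 * c, 4 * A2:]"
proof -
  have "poly n2p s = poly ([:- 4 * A2 ^ 6, 20 * A1 * A2 ^ 5 - 36 * A2 ^ 4 * c, - 40 * A1 ^ 2 * A2 ^ 4 + 120 * A1 * A2 ^ 3 *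
      c + 20 * A2 ^ 5 - 108 * A2 ^ 2 * c ^ 2, 40 * A1 ^ 3 * A2 ^ 3 - 140 * A1 ^ 2 * A2 ^ 2 * c -
      80 * A1 * A2 ^ 4 + 180 * A1 * A2 * c ^ 2 + 130 * A2 ^ 3 * c - 108 * c ^ 3, - 20 * A1 ^ 4 *
      A2 ^ 2 + 64 * A1 ^ 3 * A2 * c + 120 * A1 ^ 2 * A2 ^ 3 - 60 * A1 ^ 2 * c ^ 2 - 302 * A1 *
      A2 ^ 2 * c - 40 * A2 ^ 4 + 216 * A2 * c ^ 2, 4 * A1 ^ 5 * A2 - 8 * A1 ^ 4 * c - 80 * A1 ^
      3 * A2 ^ 2 + 206 * A1 ^ 2 * A2 * c + 120 * A1 * A2 ^ 3 - 132 * A1 * c ^ 2 - 158 * A2 ^ 2 *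
      c, 20 * A1 ^ 4 * A2 - 34 * A1 ^ 3 * c - 120 * A1 ^ 2 * A2 ^ 2 + 212 * A1 * A2 * c + 40 *
      A2 ^ 3 - 60 * c ^ 2, 40 * A1 ^ 3 * A2 - 50 * A1 ^ 2 * c - 80 * A1 * A2 ^ 2 + 70 * A2 * c,
      40 * A1 ^ 2 * A2 - 30 * A1 * c - 20 * A2 ^ 2, 20 * A1 * A2 - 6 * c, 4 * A2:]) s"
    for s unfolding eval_simps poly_pCons poly_0 by Groebner_Basis.algebra
  then show ?thesis by (simp add: poly_eq_poly_eq_iff[symmetric] fun_eq_iff)
qed

lemma degree_Denp: "degree Denp = 20"
proof -
  have n2: "degree n2p = 10" "n2p \<noteq> 0" unfolding n2p_explicit using A2 by simp_all
  have "degree (n2p\<^sup>2) = 20" using n2 by (simp add: degree_power_eq)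
  moreover have "degree (smult (108 * c\<^sup>2) (sp ^ 6 * dp ^ 3)) < 20"
  proof -
    have "dp \<noteq> 0" "sp \<noteq> 0" "degree sp = 1" using degree_dp by (auto simp: sp_def)
    then have "degree (sp ^ 6 * dp ^ 3) = 18" using degree_dp by (simp add: degree_mult_eq degree_power_eq)
    then show ?thesis using degree_smult_le[of "108 * c\<^sup>2" "sp ^ 6 * dp ^ 3"] by simp
  qed
  ultimately show ?thesis unfolding Denp_def by (simp add: degree_add_eq_right)
qed

lemma Denp_nonzero: "Denp \<noteq> 0"
  using degree_Denp by auto

text \<open>Otherwise \<open>dp\<close> is a square \<open>r\<^sup>2\<close>, and
  \<open>r - Bp\<close>, \<open>r + Bp\<close> have a product of degree one; but their difference is
  \<open>2 * Bp\<close>, of degree two.\<close>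

lemma dp_odd_root: "\<exists>\<rho>. odd (Polynomial.order \<rho> dp)"
proof (rule ccontr)
  assume "\<nexists>\<rho>. odd (Polynomial.order \<rho> dp)"
  moreover have "dp \<noteq> 0" using degree_dp by auto
  ultimately obtain r where r: "dp = r\<^sup>2" using even_order_imp_square[of dp] by blast
  have eq: "(r - Bp) * (r + Bp) = [:0, 4 * c:]"
    using r unfolding dp_def sp_def by (simp add: power2_eq_square algebra_simps)
  then have nz: "r - Bp \<noteq> 0" "r + Bp \<noteq> 0" using c by auto
  have "degree (r - Bp) + degree (r + Bp) = 1"
    using degree_mult_eq[OF nz] c unfolding eq by simp
  then have "degree (r + Bp) \<le> 1" "degree (r - Bp) \<le> 1" by linarith+
  then have "degree ((r + Bp) - (r - Bp)) \<le> 1" by (rule degree_diff_le)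
  moreover have "(r + Bp) - (r - Bp) = smult 2 Bp"
    by (rule poly_eqI) (simp only: coeff_add coeff_diff coeff_smult mult_2 add_diff_eq diff_diff_eq2 add_diff_cancel_left', simp)
  ultimately show False by (simp add: Bp_def)
qed

lemma dp_at_0: "poly dp 0 \<noteq> 0" using A2 by (simp add: eval_simps)

lemma Denp_at_0: "poly Denp 0 \<noteq> 0"
  using A2 by (simp add: eval_simps)

text \<open>At a zero of \<open>dp\<close> the line of slope \<open>s\<close> through the origin
  touches the curve. If \<open>Denp\<close> vanishes as well, so does \<open>n1p\<close>, which puts
  the point of contact at abscissa \<open>s * e\<close> and makes the curve singular there.\<close>

lemma dp_Denp_coprime:
  assumes d: "poly dp s = 0" and D: "poly Denp s = 0"
  shows False
proof -
  define B e where "B = poly Bp s" and "e = poly ep s"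
  have s0: "s \<noteq> 0" using d dp_at_0 by auto
  have B2: "B\<^sup>2 = - 4 * c * s" using d unfolding eval_simps(4) B_def by Groebner_Basis.algebra
  have "poly n2p s = 0" using D d by (simp add: eval_simps(10))
  then have "poly n1p s = 0" using d by (simp add: eval_simps(8))
  then have "c * s * (2 * s * e + B) = 0" using d by (simp add: eval_simps(7) B_def e_def)
  then have "2 * s * e + B = 0" using c s0 by simp
  then have B: "B = - 2 * s * e" by Groebner_Basis.algebra
  have "s * (c + s * e\<^sup>2) = 0" using B2 unfolding B by Groebner_Basis.algebra
  then have "c + s * e\<^sup>2 = 0" using s0 by simp
  then have cc: "c = - s * e\<^sup>2" by Groebner_Basis.algebra
  have e: "A1 = e - 2 * s" by (simp add: e_def eval_simps)
  have a2: "A2 = - 2 * s * e + s\<^sup>2 + A1 * s" using B unfolding B_def eval_simps(1) by Groebner_Basis.algebra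
  show False
  proof (rule smooth[of "s\<^sup>2 * e" "s * e"])
    show "(s\<^sup>2 * e)\<^sup>2 + A1 * (s * e) * (s\<^sup>2 * e) + c * (s\<^sup>2 * e) = (s * e) ^ 3 + A2 * (s * e)\<^sup>2"
      unfolding a2 cc e by Groebner_Basis.algebra
    show "2 * (s\<^sup>2 * e) + A1 * (s * e) + c = 0" unfolding cc e by Groebner_Basis.algebra
    show "3 * (s * e)\<^sup>2 + 2 * A2 * (s * e) = A1 * (s\<^sup>2 * e)" unfolding a2 e by Groebner_Basis.algebra
  qed
qed

section \<open>The discriminant along the pencil\<close>

definition disc :: "'a \<Rightarrow> 'a \<Rightarrow> 'a" where
  "disc s m = (let B = poly Bp s; C = - (poly ep s * m + c * s); D = - (m\<^sup>2 + c * m)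
     in B\<^sup>2 * C\<^sup>2 - 4 * C ^ 3 - 4 * B ^ 3 * D - 27 * D\<^sup>2 + 18 * B * C * D)"

text \<open>The polynomials \<open>n1p\<close>, \<open>q2p\<close> and \<open>q3p\<close> originate
  in this expansion. Its constant term is \<open>dp\<close> times a square.\<close>

lemma disc_expand:
  "disc s m = c\<^sup>2 * s\<^sup>2 * poly dp s + 2 * c * poly n1p s * m + poly q2p s * m\<^sup>2 + poly q3p s * m ^ 3 - 27 * m ^ 4"
  unfolding disc_def Let_def eval_simps(3-7) by Groebner_Basis.algebra

text \<open>In terms of \<open>v1\<close> and \<open>v2\<close>, the discriminant minus
  \<open>d * V\<^sup>2\<close> is \<open>m ^ 3\<close> times
  \<open>q3 - 2 * d * v1 * v2 - (27 + d * v2\<^sup>2) * m\<close>, and \<open>m\<close> is the zero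
  of the last factor. \<open>Denp\<close> and \<open>nump\<close> are the coefficients of this
  linear equation multiplied by \<open>4 * c\<^sup>2 * s ^ 6 * d ^ 3\<close>.\<close>

lemma disc_square:
  assumes s: "s \<noteq> 0" "poly dp s \<noteq> 0" "poly Denp s \<noteq> 0"
  defines "m \<equiv> poly nump s / poly Denp s"
  defines "V \<equiv> c * s + poly n1p s / (s * poly dp s) * m + poly n2p s / (2 * c * s ^ 3 * (poly dp s)\<^sup>2) * m\<^sup>2"
  shows "disc s m = poly dp s * V\<^sup>2"
proof -
  define d n1 n2 where "d = poly dp s" and "n1 = poly n1p s" and "n2 = poly n2p s"
  have nz: "s \<noteq> 0" "d \<noteq> 0" "c \<noteq> 0" using s c by (auto simp: d_def)
  define v1 v2 where "v1 = n1 / (s * d)" and "v2 = n2 / (2 * c * s ^ 3 * d\<^sup>2)"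
  have 1: "s * d * v1 = n1" using nz by (simp add: v1_def)
  have 2: "2 * c * s ^ 3 * d\<^sup>2 * v2 = n2" using nz by (simp add: v2_def)
  have Den: "poly Denp s = 4 * c\<^sup>2 * s ^ 6 * d ^ 3 * (27 + d * v2\<^sup>2)"
    unfolding eval_simps(10) d_def[symmetric] n2_def[symmetric] 2[symmetric] by Groebner_Basis.algebra
  have N: "poly Np s = c * s ^ 4 * d\<^sup>2 * (poly q3p s - 2 * d * v1 * v2)"
    unfolding eval_simps(9) d_def[symmetric] n1_def[symmetric] n2_def[symmetric] 1[symmetric] 2[symmetric] by Groebner_Basis.algebra
  have "poly Denp s * m = poly nump s" using s(3) by (simp add: m_def)
  then have "4 * c\<^sup>2 * s ^ 6 * d ^ 3 * (27 + d * v2\<^sup>2) * m = 4 * c * s\<^sup>2 * d * (c * s ^ 4 * d\<^sup>2 * (poly q3p s - 2 * d * v1 * v2))"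
    unfolding Den eval_simps(11) N d_def[symmetric] .
  then have "(4 * c\<^sup>2 * s ^ 6 * d ^ 3) * ((27 + d * v2\<^sup>2) * m) = (4 * c\<^sup>2 * s ^ 6 * d ^ 3) * (poly q3p s - 2 * d * v1 * v2)"
    by Groebner_Basis.algebra
  then have key: "(27 + d * v2\<^sup>2) * m = poly q3p s - 2 * d * v1 * v2"
    using nz by simp
  have "s\<^sup>2 * d * poly q2p s = n2 + n1\<^sup>2" unfolding n2_def n1_def d_def eval_simps(8) by simp
  also have "\<dots> = s\<^sup>2 * d * (2 * c * s * d * v2 + d * v1\<^sup>2)" unfolding 1[symmetric] 2[symmetric] by Groebner_Basis.algebra
  finally have q2: "poly q2p s = 2 * c * s * d * v2 + d * v1\<^sup>2" using nz by simp
  have "disc s m = c\<^sup>2 * s\<^sup>2 * d + 2 * c * n1 * m + poly q2p s * m\<^sup>2 + poly q3p s * m ^ 3 - 27 * m ^ 4"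
    unfolding disc_expand d_def n1_def ..
  also have "\<dots> = d * (c * s + v1 * m + v2 * m\<^sup>2)\<^sup>2 + m ^ 3 * ((poly q3p s - 2 * d * v1 * v2) - (27 + d * v2\<^sup>2) * m)"
    unfolding q2 1[symmetric] by Groebner_Basis.algebra
  also have "\<dots> = d * (c * s + v1 * m + v2 * m\<^sup>2)\<^sup>2" unfolding key by simp
  finally show ?thesis unfolding V_def v1_def v2_def d_def n1_def n2_def .
qed

text \<open>The hypotheses say that the discriminant, as a polynomial in \<open>m\<close>, is
  \<open>-27 * (m\<^sup>2 + \<alpha> * m + \<beta>)\<^sup>2\<close>. The depressed cubic has
  coefficients \<open>p = p0 - e * m\<close> and \<open>q = - m\<^sup>2 + Q1 * m + Q0\<close>, so
  \<open>-4 * p ^ 3\<close> is 27 times a difference of two squares. If \<open>e \<noteq> 0\<close>,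
  both factors of that difference are powers of \<open>p\<close> up to constants, which forces a
  singular point. If \<open>e = 0\<close>, comparing coefficients gives
  \<open>p0 = 0\<close>.\<close>

lemma quartic_square_degenerate:
  assumes c1: "- 54 * \<alpha> = poly q3p s" and c2: "- 27 * (\<alpha>\<^sup>2 + 2 * \<beta>) = poly q2p s"
    and c3: "- 54 * \<alpha> * \<beta> = 2 * c * poly n1p s" and c4: "- 27 * \<beta>\<^sup>2 = c\<^sup>2 * s\<^sup>2 * poly dp s"
  shows "poly ep s = 0 \<and> (poly Bp s)\<^sup>2 = - 3 * c * s"
proof -
  define B e where "B = poly Bp s" and "e = poly ep s"
  define p0 Q1 Q0 where "p0 = - (c * s) - B\<^sup>2 / 3" and "Q1 = B * e / 3 - c" and "Q0 = 2 * B ^ 3 / 27 + B * c * s / 3"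
  have p0: "3 * p0 = - 3 * c * s - B\<^sup>2" and Q1: "3 * Q1 = B * e - 3 * c" and Q0: "27 * Q0 = 2 * B ^ 3 + 9 * B * c * s"
    by (simp_all add: p0_def Q1_def Q0_def field_simps)
  have e3: "4 * e ^ 3 = - 54 * (Q1 + \<alpha>)"
    using c1 Q1 unfolding eval_simps(6) B_def[symmetric] e_def[symmetric] by Groebner_Basis.algebra
  have e2: "- 12 * e\<^sup>2 * p0 = 27 * (Q1\<^sup>2 - 2 * Q0 - \<alpha>\<^sup>2 - 2 * \<beta>)"
    using c2 p0 Q1 Q0 unfolding eval_simps(5) B_def[symmetric] e_def[symmetric] by Groebner_Basis.algebra
  have e1: "12 * e * p0\<^sup>2 = 54 * (Q1 * Q0 - \<alpha> * \<beta>)"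
    using c3 p0 Q1 Q0 unfolding eval_simps(7,4) B_def[symmetric] e_def[symmetric] by Groebner_Basis.algebra
  have e0: "- 4 * p0 ^ 3 = 27 * (Q0\<^sup>2 - \<beta>\<^sup>2)"
    using c4 p0 Q0 unfolding eval_simps(4) B_def[symmetric] e_def[symmetric] by Groebner_Basis.algebra
  have "e = 0"
  proof (rule ccontr)
    assume e: "e \<noteq> 0"
    \<comment> \<open>The shift \<open>m = n + M\<close> turns \<open>p\<close> into
      \<open>- e * n\<close>; then \<open>r1\<close>, \<open>r0\<close> and \<open>a\<close>,
      \<open>b\<close> are the lower coefficients of the two squared quadratics in
      \<open>n\<close>.\<close>
    define M where "M = p0 / e"
    have M: "p0 = e * M" using e by (simp add: M_def)
    define r1 r0 a b where "r1 = Q1 - 2 * M" and "r0 = - M\<^sup>2 + Q1 * M + Q0" and "a = \<alpha> + 2 * M"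
      and "b = M\<^sup>2 + \<alpha> * M + \<beta>"
    have f3: "2 * e ^ 3 = - 27 * (r1 + a)" using e3 unfolding r1_def a_def by Groebner_Basis.algebra
    have f2: "r1\<^sup>2 - 2 * r0 = a\<^sup>2 + 2 * b"
      using e2 e3 unfolding r1_def r0_def a_def b_def M by Groebner_Basis.algebra
    have f1: "r1 * r0 = a * b"
      using e1 e2 e3 unfolding r1_def r0_def a_def b_def M by Groebner_Basis.algebra
    have f0: "r0\<^sup>2 = b\<^sup>2"
      using e0 e1 e2 e3 unfolding r0_def b_def M by Groebner_Basis.algebra
    have ra: "r1 + a \<noteq> 0"
    proof
      assume z: "r1 + a = 0"
      have "2 * e ^ 3 = 0" using f3 unfolding z by simp
      with e show False by simp
    qed
    have r: "r0 = 0 \<and> r1 = a"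
    proof -
      have "(r0 - b) * (r0 + b) = 0" using f0 by Groebner_Basis.algebra
      then consider "r0 = b" | "b = - r0" by (auto simp: add_eq_0_iff)
      then show ?thesis
      proof cases
        case 1
        have "r0 * (r1 - a) = 0" using f1 1 by (simp add: algebra_simps)
        moreover have "(r1 - a) * (r1 + a) = 4 * r0" using f2 1 by (simp add: power2_eq_square algebra_simps)
        ultimately show ?thesis using ra by auto
      next
        case 2
        have "(r1 - a) * (r1 + a) = 0" using f2 2 by (simp add: power2_eq_square algebra_simps)
        then have 3: "r1 = a" using ra by simp
        then have "2 * a * r0 = 0" using f1 2 by (simp add: algebra_simps)
        with 3 ra show ?thesis by auto
      qed
    qed
    have r1e: "27 * r1 = - (e ^ 3)" using f3 r by Groebner_Basis.algebra
    \<comment> \<open>The singular point in shifted coordinates: with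
      \<open>27 * r1 = - (e ^ 3)\<close>, the polynomial
      \<open>X ^ 3 - e * n * X - n\<^sup>2 + r1 * n\<close> and both its partial derivatives vanish
      here.\<close>
    define X n where "X = - e\<^sup>2 / 9" and "n = e ^ 3 / 27"
    define x m where "x = X - B / 3" and "m = n + M"
    have Xn: "9 * X = - e\<^sup>2" "27 * n = e ^ 3" by (simp_all add: X_def n_def)
    have x: "3 * x = 3 * X - B" by (simp add: x_def)
    have A1: "A1 = e - 2 * s" by (simp add: e_def eval_simps)
    have A2: "A2 = B + s\<^sup>2 + A1 * s" by (simp add: B_def eval_simps)
    have r1': "r1 = Q1 - 2 * M" and r0': "0 = - M\<^sup>2 + Q1 * M + Q0" using r r1_def r0_def by auto
    have gy: "2 * (s * x + m) + A1 * x + c = 0"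
      using r1e r1' Q1 Xn x unfolding A1 m_def by Groebner_Basis.algebra
    have gx': "3 * x\<^sup>2 + 2 * B * x - (e * m + c * s) = 0"
      using p0 Xn x unfolding m_def M by Groebner_Basis.algebra
    have F: "x ^ 3 + B * x\<^sup>2 - (e * m + c * s) * x - (m\<^sup>2 + c * m) = 0"
      using p0 Q1 Q0 r1e r1' r0' Xn x unfolding m_def M by Groebner_Basis.algebra
    show False
    proof (rule smooth[of "s * x + m" x])
      show "(s * x + m)\<^sup>2 + A1 * x * (s * x + m) + c * (s * x + m) = x ^ 3 + A2 * x\<^sup>2"
        using F unfolding A2 A1 by Groebner_Basis.algebra
      show "2 * (s * x + m) + A1 * x + c = 0" by (rule gy)
      show "3 * x\<^sup>2 + 2 * A2 * x = A1 * (s * x + m)"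
        using gx' gy unfolding A2 A1 by Groebner_Basis.algebra
    qed
  qed
  moreover have "p0 = 0"
  proof -
    have "\<alpha> = - Q1" using e3 \<open>e = 0\<close> by Groebner_Basis.algebra
    then have "\<beta> = - Q0" using e2 \<open>e = 0\<close> by Groebner_Basis.algebra
    then have "p0 ^ 3 = 0" using e0 by Groebner_Basis.algebra
    then show ?thesis by simp
  qed
  then have "B\<^sup>2 = - 3 * c * s" using p0 by Groebner_Basis.algebra
  ultimately show ?thesis by (simp add: B_def e_def)
qed

text \<open>At a common zero the linear equation for \<open>m\<close> holds identically, so the
  discriminant is \<open>d * V\<^sup>2\<close> for every \<open>m\<close>. As
  \<open>d * v2\<^sup>2 = - 27\<close>, it is -27 times the square of a monic quadratic.\<close>

lemma common_root:
  assumes D: "poly Denp s = 0" and n: "poly nump s = 0"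
  shows "poly ep s = 0 \<and> (poly Bp s)\<^sup>2 = - 3 * c * s"
proof -
  have s0: "s \<noteq> 0" using D Denp_at_0 by auto
  have d0: "poly dp s \<noteq> 0" using dp_Denp_coprime D by blast
  define d n1 n2 where "d = poly dp s" and "n1 = poly n1p s" and "n2 = poly n2p s"
  have nz: "s \<noteq> 0" "d \<noteq> 0" "c \<noteq> 0" using s0 d0 c by (auto simp: d_def)
  define v1 v2 where "v1 = n1 / (s * d)" and "v2 = n2 / (2 * c * s ^ 3 * d\<^sup>2)"
  have 1: "s * d * v1 = n1" using nz by (simp add: v1_def)
  have 2: "2 * c * s ^ 3 * d\<^sup>2 * v2 = n2" using nz by (simp add: v2_def)
  have "4 * c\<^sup>2 * s ^ 6 * d ^ 3 * (27 + d * v2\<^sup>2) = 0"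
    using D unfolding eval_simps(10) d_def[symmetric] n2_def[symmetric] 2[symmetric] by Groebner_Basis.algebra
  then have "27 + d * v2\<^sup>2 = 0" using nz by simp
  then have dv: "d * v2\<^sup>2 = - 27" by Groebner_Basis.algebra
  have "poly Np s = 0" using n nz d0 unfolding eval_simps(11) by simp
  then have "c * s ^ 4 * d\<^sup>2 * (poly q3p s - 2 * d * v1 * v2) = 0"
    unfolding eval_simps(9) d_def[symmetric] n1_def[symmetric] n2_def[symmetric] 1[symmetric] 2[symmetric] by Groebner_Basis.algebra
  then have q3: "poly q3p s = 2 * d * v1 * v2" using nz by simp
  have "s\<^sup>2 * d * poly q2p s = n2 + n1\<^sup>2" unfolding n2_def n1_def d_def eval_simps(8) by simp
  also have "\<dots> = s\<^sup>2 * d * (2 * c * s * d * v2 + d * v1\<^sup>2)" unfolding 1[symmetric] 2[symmetric] by Groebner_Basis.algebra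
  finally have q2: "poly q2p s = 2 * c * s * d * v2 + d * v1\<^sup>2" using nz by simp
  have v2: "v2 \<noteq> 0" using dv by auto
  define \<alpha> \<beta> where "\<alpha> = v1 / v2" and "\<beta> = c * s / v2"
  have v: "v1 = \<alpha> * v2" "c * s = \<beta> * v2" using v2 by (simp_all add: \<alpha>_def \<beta>_def)
  show ?thesis
  proof (rule quartic_square_degenerate[of \<alpha> _ \<beta>])
    show "- 54 * \<alpha> = poly q3p s" unfolding q3 v using dv by Groebner_Basis.algebra
    show "- 27 * (\<alpha>\<^sup>2 + 2 * \<beta>) = poly q2p s" using q2 v dv by Groebner_Basis.algebra
    show "- 54 * \<alpha> * \<beta> = 2 * c * poly n1p s" unfolding n1_def[symmetric] 1[symmetric] using v dv by Groebner_Basis.algebra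
    show "- 27 * \<beta>\<^sup>2 = c\<^sup>2 * s\<^sup>2 * poly dp s" unfolding d_def[symmetric] using v dv by Groebner_Basis.algebra
  qed
qed

end

text \<open>The identity behind the exceptional family, parametrized by \<open>g\<close> and
  \<open>h\<close>. Here \<open>f = s + 3 * g\<close> is the distance from the common zero, and its
  cube splits off. Writing \<open>n1\<close> and \<open>n2\<close> in powers of \<open>f\<close>
  breaks the expansion into smaller identities.\<close>

lemma Denp_j_zero:
  fixes g h f :: "'a::field_char_0"
  assumes "A1 = 6 * g" "A2 = 3 * g * (h - 3 * g)" "c = g * h\<^sup>2" "s = f - 3 * g" "e = 2 * f"
    and "B = A2 - s\<^sup>2 - A1 * s" "d = B\<^sup>2 + 4 * c * s"
    and "n1 = d * (s * e + 2 * B) + c * s * (2 * s * e + B)"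
    and "q2 = B\<^sup>2 * e\<^sup>2 + 12 * c * s * e\<^sup>2 + 4 * B ^ 3 - 27 * c\<^sup>2 + 18 * c * B * (s + e)"
    and "n2 = s\<^sup>2 * d * q2 - n1\<^sup>2"
  shows "108 * c\<^sup>2 * s ^ 6 * d ^ 3 + n2\<^sup>2 = f ^ 3 * poly
     [:- 3779136 * g ^ 12 * h ^ 9 + 2204496 * g ^ 11 * h ^ 10 - 314928 * g ^ 10 * h ^ 11,
       7558272 * g ^ 12 * h ^ 8 + 5668704 * g ^ 11 * h ^ 9 - 5668704 * g ^ 10 * h ^ 10 + 944784 * g ^ 9 * h ^ 11,
       - 30233088 * g ^ 11 * h ^ 8 + 11337408 * g ^ 10 * h ^ 9 + 2834352 * g ^ 9 * h ^ 10 - 944784 * g ^ 8 * h ^ 11,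
       18895680 * g ^ 11 * h ^ 7 + 15851376 * g ^ 10 * h ^ 8 - 19560528 * g ^ 9 * h ^ 9 + 2531088 * g ^ 8 * h ^ 10 + 221616 * g ^ 7 * h ^ 11 + 11664 * g ^ 6 * h ^ 12,
       - 24354432 * g ^ 10 * h ^ 7 + 25684128 * g ^ 9 * h ^ 8 - 979776 * g ^ 8 * h ^ 9 - 419904 * g ^ 7 * h ^ 10 - 139968 * g ^ 6 * h ^ 11,
       1679616 * g ^ 10 * h ^ 6 - 30233088 * g ^ 9 * h ^ 7 + 6053616 * g ^ 8 * h ^ 8 - 1749600 * g ^ 7 * h ^ 9 + 524880 * g ^ 6 * h ^ 10,
       41885424 * g ^ 9 * h ^ 6 - 16201296 * g ^ 8 * h ^ 7 + 4494528 * g ^ 7 * h ^ 8 - 844992 * g ^ 6 * h ^ 9 + 19872 * g ^ 5 * h ^ 10,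
       - 19105632 * g ^ 9 * h ^ 5 + 14136768 * g ^ 8 * h ^ 6 - 5031072 * g ^ 7 * h ^ 7 + 1289520 * g ^ 6 * h ^ 8 - 154224 * g ^ 5 * h ^ 9,
       - 16376256 * g ^ 8 * h ^ 5 + 7457184 * g ^ 7 * h ^ 6 - 2426112 * g ^ 6 * h ^ 7 + 396576 * g ^ 5 * h ^ 8,
       11722320 * g ^ 8 * h ^ 4 - 5470416 * g ^ 7 * h ^ 5 + 2511648 * g ^ 6 * h ^ 6 - 510624 * g ^ 5 * h ^ 7 + 10080 * g ^ 4 * h ^ 8,
       2682720 * g ^ 7 * h ^ 4 - 2270592 * g ^ 6 * h ^ 5 + 607824 * g ^ 5 * h ^ 6 - 51120 * g ^ 4 * h ^ 7,
       - 3265920 * g ^ 7 * h ^ 3 + 1741824 * g ^ 6 * h ^ 4 - 575424 * g ^ 5 * h ^ 5 + 84384 * g ^ 4 * h ^ 6,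
       - 186624 * g ^ 6 * h ^ 3 + 347328 * g ^ 5 * h ^ 4 - 81216 * g ^ 4 * h ^ 5 + 2016 * g ^ 3 * h ^ 6,
       489888 * g ^ 6 * h ^ 2 - 314928 * g ^ 5 * h ^ 3 + 70416 * g ^ 4 * h ^ 4 - 5904 * g ^ 3 * h ^ 5,
       3888 * g ^ 5 * h ^ 2 - 22896 * g ^ 4 * h ^ 3 + 5472 * g ^ 3 * h ^ 4,
       - 38880 * g ^ 5 * h + 27216 * g ^ 4 * h ^ 2 - 4752 * g ^ 3 * h ^ 3 + 144 * g ^ 2 * h ^ 4,
       432 * g ^ 3 * h ^ 2 - 144 * g ^ 2 * h ^ 3,
       1296 * g ^ 4 - 864 * g ^ 3 * h + 144 * g ^ 2 * h ^ 2:] f"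
proof -
  have B: "B = 3 * g * h - f\<^sup>2"
    unfolding assms(1-6) by Groebner_Basis.algebra
  have d: "d = f ^ 4 - 6 * f\<^sup>2 * g * h + 4 * f * g * h\<^sup>2 - 3 * g\<^sup>2 * h\<^sup>2"
    unfolding assms(7) B assms(3,4) by Groebner_Basis.algebra
  have n1: "n1 = - 27 * g ^ 3 * h ^ 3 + f * (54 * g ^ 3 * h ^ 2 + 27 * g ^ 2 * h ^ 3 + f * (- 81 * g ^ 2 * h ^ 2
      + f * (36 * g ^ 2 * h + 3 * g * h ^ 2 + f * (6 * g * h + f * (- 6 * g)))))"
    unfolding assms(8) d B assms(3,4,5) by Groebner_Basis.algebra
  have n2: "n2 = 1458 * g ^ 7 * h ^ 5 + f * (- 4374 * g ^ 6 * h ^ 5 + f * (4374 * g ^ 6 * h ^ 4 + 4374 * g ^ 5 *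
      h ^ 5 + f * (- 8586 * g ^ 5 * h ^ 4 - 1026 * g ^ 4 * h ^ 5 - 108 * g ^ 3 * h ^ 6 + f *
      (4050 * g ^ 5 * h ^ 3 + 1458 * g ^ 4 * h ^ 4 + 648 * g ^ 3 * h ^ 5 + f * (1782 * g ^ 4 * h
      ^ 3 - 1134 * g ^ 3 * h ^ 4 + f * (- 2754 * g ^ 4 * h ^ 2 + 486 * g ^ 3 * h ^ 3 - 60 * g ^
      2 * h ^ 4 + f * (- 54 * g ^ 3 * h ^ 2 + 210 * g ^ 2 * h ^ 3 + f * (540 * g ^ 3 * h - 198 *
      g ^ 2 * h ^ 2 + f * (- 6 * g * h ^ 2 + f * (- 36 * g ^ 2 + 12 * g * h))))))))))"
    unfolding assms(9,10) n1 d B assms(3,4,5) by Groebner_Basis.algebra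
  show ?thesis unfolding n2 d assms(3,4) poly_pCons poly_0 by Groebner_Basis.algebra
qed

context tate_curve begin

text \<open>
  \<open>Denp\<close> has degree 20, so some root has order prime to three; it is a pole unless it cancels, which
  happens only for \<open>j = 0\<close> and then only for a factor of degree three.
\<close>

lemma good_pole: "\<exists>\<rho>. \<not> 3 dvd Polynomial.order \<rho> Denp \<and> poly nump \<rho> \<noteq> 0"
proof (cases "\<exists>s. poly Denp s = 0 \<and> poly nump s = 0")
  case False
  have "\<not> 3 dvd degree Denp" using degree_Denp by simp
  then obtain \<rho> where "\<not> 3 dvd Polynomial.order \<rho> Denp" using order_dvd_degree[OF Denp_nonzero, of 3] by blast
  moreover from this have "poly Denp \<rho> = 0" using order_root[of Denp \<rho>] by (metis dvd_0_right)
  ultimately show ?thesis using False by blast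
next
  case True
  then obtain s1 where s1: "poly Denp s1 = 0" "poly nump s1 = 0" by blast
  from common_root[OF this] have e: "2 * s1 + A1 = 0" and B2: "(poly Bp s1)\<^sup>2 = - 3 * c * s1"
    by (simp_all add: eval_simps)
  have s10: "s1 \<noteq> 0" using s1 Denp_at_0 by auto
  \<comment> \<open>Normalization: \<open>ep\<close> vanishes at \<open>- A1 / 2 = - 3 * g\<close>.
    With \<open>h\<close> defined by \<open>poly Bp s1 = 3 * g * h\<close>, the relation
    \<open>B\<^sup>2 = - 3 * c * s1\<close> becomes \<open>c = g * h\<^sup>2\<close>.\<close>
  define g where "g = A1 / 6"
  have A1: "A1 = 6 * g" by (simp add: g_def)
  have s1g: "s1 = - 3 * g" using e unfolding A1 by Groebner_Basis.algebra
  have g0: "g \<noteq> 0" using s10 s1g by auto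
  define h where "h = poly Bp s1 / (3 * g)"
  have Bh: "poly Bp s1 = 3 * g * h" using g0 by (simp add: h_def)
  have "9 * g * (g * h\<^sup>2) = 9 * g * c" using B2[unfolded Bh] s1g by Groebner_Basis.algebra
  then have cg: "c = g * h\<^sup>2" using g0 by simp
  have A2g: "A2 = 3 * g * (h - 3 * g)" using Bh[unfolded eval_simps(1)] s1g A1 by Groebner_Basis.algebra
  have h0: "h \<noteq> 0" and h3: "h - 3 * g \<noteq> 0" using c A2 cg A2g by auto
  \<comment> \<open>For \<open>h = 4 * g\<close> the curve is singular at abscissa
    \<open>- 4 * g\<^sup>2\<close> and ordinate \<open>4 * g ^ 3\<close>.\<close>
  have h4: "h - 4 * g \<noteq> 0"
  proof
    assume "h - 4 * g = 0"
    then have h: "h = 4 * g" by simp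
    show False
      by (rule smooth[of "4 * g ^ 3" "- 4 * g\<^sup>2"]; unfold A1 A2g cg h; Groebner_Basis.algebra)
  qed
  define R0 where "R0 = [:- 3779136 * g ^ 12 * h ^ 9 + 2204496 * g ^ 11 * h ^ 10 - 314928 * g ^ 10 * h ^ 11,
       7558272 * g ^ 12 * h ^ 8 + 5668704 * g ^ 11 * h ^ 9 - 5668704 * g ^ 10 * h ^ 10 + 944784 * g ^ 9 * h ^ 11,
       - 30233088 * g ^ 11 * h ^ 8 + 11337408 * g ^ 10 * h ^ 9 + 2834352 * g ^ 9 * h ^ 10 - 944784 * g ^ 8 * h ^ 11,
       18895680 * g ^ 11 * h ^ 7 + 15851376 * g ^ 10 * h ^ 8 - 19560528 * g ^ 9 * h ^ 9 + 2531088 * g ^ 8 * h ^ 10 + 221616 * g ^ 7 * h ^ 11 + 11664 * g ^ 6 * h ^ 12,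
       - 24354432 * g ^ 10 * h ^ 7 + 25684128 * g ^ 9 * h ^ 8 - 979776 * g ^ 8 * h ^ 9 - 419904 * g ^ 7 * h ^ 10 - 139968 * g ^ 6 * h ^ 11,
       1679616 * g ^ 10 * h ^ 6 - 30233088 * g ^ 9 * h ^ 7 + 6053616 * g ^ 8 * h ^ 8 - 1749600 * g ^ 7 * h ^ 9 + 524880 * g ^ 6 * h ^ 10,
       41885424 * g ^ 9 * h ^ 6 - 16201296 * g ^ 8 * h ^ 7 + 4494528 * g ^ 7 * h ^ 8 - 844992 * g ^ 6 * h ^ 9 + 19872 * g ^ 5 * h ^ 10,
       - 19105632 * g ^ 9 * h ^ 5 + 14136768 * g ^ 8 * h ^ 6 - 5031072 * g ^ 7 * h ^ 7 + 1289520 * g ^ 6 * h ^ 8 - 154224 * g ^ 5 * h ^ 9,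
       - 16376256 * g ^ 8 * h ^ 5 + 7457184 * g ^ 7 * h ^ 6 - 2426112 * g ^ 6 * h ^ 7 + 396576 * g ^ 5 * h ^ 8,
       11722320 * g ^ 8 * h ^ 4 - 5470416 * g ^ 7 * h ^ 5 + 2511648 * g ^ 6 * h ^ 6 - 510624 * g ^ 5 * h ^ 7 + 10080 * g ^ 4 * h ^ 8,
       2682720 * g ^ 7 * h ^ 4 - 2270592 * g ^ 6 * h ^ 5 + 607824 * g ^ 5 * h ^ 6 - 51120 * g ^ 4 * h ^ 7,
       - 3265920 * g ^ 7 * h ^ 3 + 1741824 * g ^ 6 * h ^ 4 - 575424 * g ^ 5 * h ^ 5 + 84384 * g ^ 4 * h ^ 6,
       - 186624 * g ^ 6 * h ^ 3 + 347328 * g ^ 5 * h ^ 4 - 81216 * g ^ 4 * h ^ 5 + 2016 * g ^ 3 * h ^ 6,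
       489888 * g ^ 6 * h ^ 2 - 314928 * g ^ 5 * h ^ 3 + 70416 * g ^ 4 * h ^ 4 - 5904 * g ^ 3 * h ^ 5,
       3888 * g ^ 5 * h ^ 2 - 22896 * g ^ 4 * h ^ 3 + 5472 * g ^ 3 * h ^ 4,
       - 38880 * g ^ 5 * h + 27216 * g ^ 4 * h ^ 2 - 4752 * g ^ 3 * h ^ 3 + 144 * g ^ 2 * h ^ 4,
       432 * g ^ 3 * h ^ 2 - 144 * g ^ 2 * h ^ 3,
       1296 * g ^ 4 - 864 * g ^ 3 * h + 144 * g ^ 2 * h ^ 2:]"
  define R where "R = pcompose R0 [:3 * g, 1:]"
  have "poly Denp s = poly ([:3 * g, 1:] ^ 3 * R) s" for s
  proof -
    have e': "poly ep s = 2 * (s + 3 * g)" unfolding eval_simps(2) using A1 by simp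
    have "poly Denp s = (s + 3 * g) ^ 3 * poly R0 (s + 3 * g)"
      unfolding R0_def eval_simps(10)
      by (rule Denp_j_zero[OF A1 A2g cg _ e' eval_simps(1,4,7,5,8)]) simp
    also have "\<dots> = poly ([:3 * g, 1:] ^ 3 * R) s"
      by (simp add: R_def poly_pcompose add.commute)
    finally show ?thesis .
  qed
  then have DR: "Denp = [:3 * g, 1:] ^ 3 * R" by (simp add: poly_eq_poly_eq_iff[symmetric] fun_eq_iff)
  have R0: "R \<noteq> 0" using DR Denp_nonzero by auto
  have "degree ([:3 * g, 1:] ^ 3) = 3" using degree_power_eq[of "[:3 * g, 1:]" 3] by simp
  then have "degree R = 17" using degree_Denp degree_mult_eq[of "[:3 * g, 1:] ^ 3" R] R0 DR by simp
  then have "\<not> 3 dvd degree R" by simp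
  then obtain \<rho> where \<rho>: "\<not> 3 dvd Polynomial.order \<rho> R" using order_dvd_degree[OF R0, of 3] by blast
  \<comment> \<open>The cofactor does not vanish at the common zero, so a root of \<open>R\<close>
    whose order is prime to three is another point, and there \<open>nump\<close> is
    nonzero.\<close>
  have "poly R s1 = 314928 * (g ^ 10 * h ^ 9 * (h - 3 * g) * (4 * g - h))"
    unfolding R_def R0_def poly_pcompose s1g by (simp, Groebner_Basis.algebra)
  then have Rs1: "poly R s1 \<noteq> 0" using g0 h0 h3 h4 by auto
  then have ne: "\<rho> \<noteq> s1" using \<rho> by (auto simp: order_0I)
  have "Polynomial.order \<rho> Denp = Polynomial.order \<rho> ([:3 * g, 1:] ^ 3) + Polynomial.order \<rho> R"
    unfolding DR using R0 by (intro order_mult) auto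
  moreover have "poly ([:3 * g, 1:] ^ 3) \<rho> \<noteq> 0" using ne unfolding s1g by (simp add: add_eq_0_iff)
  ultimately have ord: "Polynomial.order \<rho> Denp = Polynomial.order \<rho> R" by (simp add: order_0I)
  then have "poly Denp \<rho> = 0" using \<rho> order_root[of Denp \<rho>] by (metis dvd_0_right)
  have "poly nump \<rho> \<noteq> 0"
  proof
    assume "poly nump \<rho> = 0"
    from common_root[OF \<open>poly Denp \<rho> = 0\<close> this] have "2 * \<rho> + A1 = 0" by (simp add: eval_simps)
    then have "\<rho> = s1" using e by (metis add_right_cancel mult_cancel_left zero_neq_numeral)
    with ne show False by blast
  qed
  with \<rho> ord show ?thesis by (intro exI[of _ \<rho>]) simp
qed

end

section \<open>Points on lines\<close>

lemma cubic_roots: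
  fixes B C D :: "'a::alg_closed_field"
  obtains x1 x2 x3 where "B = - (x1 + x2 + x3)" "C = x1 * x2 + x1 * x3 + x2 * x3" "D = - (x1 * x2 * x3)"
proof -
  have "degree [:D, C, B, 1:] > 0" by simp
  then obtain x1 where x1: "poly [:D, C, B, 1:] x1 = 0" using alg_closed_imp_poly_has_root by blast
  have "degree [:C + x1 * (B + x1), B + x1, 1:] > 0" by simp
  then obtain x2 where x2: "poly [:C + x1 * (B + x1), B + x1, 1:] x2 = 0" using alg_closed_imp_poly_has_root by blast
  have D: "D + x1 * (C + x1 * (B + x1)) = 0" using x1 by simp
  have C: "C + x1 * (B + x1) + x2 * (B + x1 + x2) = 0" using x2 by simp
  show ?thesis
  proof (rule that[of x1 x2 "- (B + x1 + x2)"])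
    show "B = - (x1 + x2 + - (B + x1 + x2))" by simp
    show "C = x1 * x2 + x1 * - (B + x1 + x2) + x2 * - (B + x1 + x2)" using C by Groebner_Basis.algebra
    show "D = - (x1 * x2 * - (B + x1 + x2))" using C D by Groebner_Basis.algebra
  qed
qed

lemma galois_groupD:
  assumes "\<sigma> \<in> galois_group K"
  shows "\<sigma> (x + y) = \<sigma> x + \<sigma> y" "\<sigma> (x * y) = \<sigma> x * \<sigma> y" "\<sigma> 0 = 0" "\<sigma> 1 = 1" "\<sigma> (- x) = - \<sigma> x"
    "\<sigma> (x - y) = \<sigma> x - \<sigma> y" "\<sigma> (x ^ n) = \<sigma> x ^ n" "inj \<sigma>" "\<sigma> (inverse x) = inverse (\<sigma> x)" "x \<in> K \<Longrightarrow> \<sigma> x = x"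
proof -
  show a: "\<sigma> (x + y) = \<sigma> x + \<sigma> y" and m: "\<sigma> (x * y) = \<sigma> x * \<sigma> y" and o: "\<sigma> 1 = 1" and "inj \<sigma>"
    and "x \<in> K \<Longrightarrow> \<sigma> x = x" for x y
    using assms unfolding galois_group_def bij_def by auto
  show z: "\<sigma> 0 = 0" using a[of 0 0] by (metis add.right_neutral add_left_cancel)
  show n: "\<sigma> (- x) = - \<sigma> x" for x using a[of x "- x"] z by (simp add: eq_neg_iff_add_eq_0 add.commute)
  show "\<sigma> (x - y) = \<sigma> x - \<sigma> y" using a[of x "- y"] n[of y] by simp
  show "\<sigma> (x ^ n) = \<sigma> x ^ n" by (induction n) (simp_all add: m o)
  show "\<sigma> (inverse x) = inverse (\<sigma> x)"
  proof (cases "x = 0")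
    case False
    then have "\<sigma> x * \<sigma> (inverse x) = 1" using m[of x "inverse x"] o by simp
    then show ?thesis by (simp add: inverse_unique)
  qed (simp add: z)
qed

lemma subfield_fixed_field: "\<sigma> \<in> galois_group K \<Longrightarrow> is_subfield (fixed_field \<sigma>)"
  unfolding is_subfield_def fixed_field_def by (auto simp: galois_groupD)

text \<open>Without a fixed root the permutation is a 3-cycle, which is even and leaves the product
  of differences unchanged.\<close>

lemma odd_permutation_fixes_root:
  fixes x1 x2 x3 :: "'a::field_char_0"
  assumes "\<sigma> \<in> galois_group K" and perm: "\<And>x. x \<in> {x1, x2, x3} \<Longrightarrow> \<sigma> x \<in> {x1, x2, x3}"
    and "x1 \<noteq> x2" "x1 \<noteq> x3" "x2 \<noteq> x3"
    and odd: "\<sigma> ((x1 - x2) * (x2 - x3) * (x1 - x3)) = - ((x1 - x2) * (x2 - x3) * (x1 - x3))"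
  shows "\<exists>x\<in>{x1, x2, x3}. \<sigma> x = x"
proof (rule ccontr)
  assume "\<not> ?thesis"
  then have f: "\<sigma> x1 \<noteq> x1" "\<sigma> x2 \<noteq> x2" "\<sigma> x3 \<noteq> x3" by auto
  note g = galois_groupD[OF assms(1)]
  have inj: "\<sigma> x1 \<noteq> \<sigma> x2" "\<sigma> x1 \<noteq> \<sigma> x3" "\<sigma> x2 \<noteq> \<sigma> x3" using g(8) assms(3-5) by (auto dest: injD)
  have "(\<sigma> x1 = x2 \<and> \<sigma> x2 = x3 \<and> \<sigma> x3 = x1) \<or> (\<sigma> x1 = x3 \<and> \<sigma> x2 = x1 \<and> \<sigma> x3 = x2)"
    using perm[of x1] perm[of x2] perm[of x3] f inj by auto
  then have "\<sigma> ((x1 - x2) * (x2 - x3) * (x1 - x3)) = (x1 - x2) * (x2 - x3) * (x1 - x3)"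
    unfolding g(2,6) by (elim disjE conjE; simp add: algebra_simps)
  with odd have "2 * ((x1 - x2) * (x2 - x3) * (x1 - x3)) = 0" by Groebner_Basis.algebra
  with assms(3-5) show False by simp
qed

text \<open>The Newton polygon has a single edge: the constant term has valuation
  \<open>-2 * \<alpha>\<close>, and the middle coefficients lie above the edge to the leading term.
  A root would have valuation \<open>-2 * \<alpha> / 3\<close>, which is no integer; for any other
  valuation the cube or the constant term dominates.\<close>

lemma cubic_no_root_at_place:
  fixes F :: "'a::field_char_0 set"
  assumes F: "is_subfield F" and pl: "is_place F p v"
    and B: "B \<in> F" "vge v B 0" and e: "e \<in> F" "vge v e 0" and c: "c \<in> F" "vge v c 0" and s: "s \<in> F" "vge v s 0"
    and m: "m \<in> F" "m \<noteq> 0" "v m = - int \<alpha>" and \<alpha>: "\<not> 3 dvd \<alpha>" and x: "x \<in> F"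
  shows "x ^ 3 + B * x\<^sup>2 + (- (e * m + c * s)) * x + (- (m\<^sup>2 + c * m)) \<noteq> 0"
proof
  assume eq: "x ^ 3 + B * x\<^sup>2 + (- (e * m + c * s)) * x + (- (m\<^sup>2 + c * m)) = 0"
  have \<alpha>0: "\<alpha> > 0" using \<alpha> by (cases \<alpha>) auto
  note Fi = is_subfieldD[OF F]
  note mul = vge_mult[OF F pl] and dom = place_dominant[OF F pl]
  have vm: "vge v m (- int \<alpha>)" using m by (simp add: vge_def)
  have C: "vge v (e * m + c * s) (- int \<alpha>)"
  proof (intro vge_add[OF F pl] Fi e c s m)
    show "vge v (e * m) (- int \<alpha>)" using mul[OF e(1) m(1) e(2) vm] by simp
    show "vge v (c * s) (- int \<alpha>)" using mul[OF c(1) s(1) c(2) s(2)] by (rule vge_mono) simp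
  qed
  have CF: "e * m + c * s \<in> F" by (intro Fi e c s m)
  have "v (m\<^sup>2) = - 2 * int \<alpha>" "m\<^sup>2 \<noteq> 0" using place_power[OF F pl m(1,2), of 2] m by simp_all
  moreover have "vge v (c * m) (- 2 * int \<alpha> + 1)"
    using mul[OF c(1) m(1) c(2) vm] by (rule vge_mono) (use \<alpha>0 in simp)
  ultimately have D: "m\<^sup>2 + c * m \<noteq> 0" "v (m\<^sup>2 + c * m) = - 2 * int \<alpha>"
    using dom[of "m\<^sup>2" "c * m"] Fi c m by auto
  have DF: "m\<^sup>2 + c * m \<in> F" by (intro Fi c m)
  have x0: "x \<noteq> 0"
  proof
    assume "x = 0"
    then have "m\<^sup>2 + c * m = 0" using eq by Groebner_Basis.algebra
    with D show False by blast
  qed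
  define \<xi> where "\<xi> = v x"
  have vx: "vge v x \<xi>" by (simp add: vge_def \<xi>_def)
  have x3: "v (x ^ 3) = 3 * \<xi>" "x ^ 3 \<noteq> 0" "v (x\<^sup>2) = 2 * \<xi>"
    using place_power[OF F pl x x0, of 3] place_power[OF F pl x x0, of 2] x0 by (simp_all add: \<xi>_def)
  have Bx: "vge v (B * x\<^sup>2) (2 * \<xi>)"
    using mul[OF B(1) Fi(9)[OF x] B(2), of 2 "2 * \<xi>"] x3(3) by (simp add: vge_def)
  have Cx: "vge v ((e * m + c * s) * x) (\<xi> - int \<alpha>)" using mul[OF CF x C vx] by (simp add: algebra_simps)
  have BxF: "B * x\<^sup>2 \<in> F" and CxF: "(e * m + c * s) * x \<in> F" by (intro Fi B x CF)+
  have "3 * \<xi> \<noteq> - 2 * int \<alpha>"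
  proof
    assume "3 * \<xi> = - 2 * int \<alpha>"
    then have "int 3 dvd int \<alpha>" by presburger
    with \<alpha> show False by (simp only: of_nat_dvd_iff)
  qed
  then consider "3 * \<xi> < - 2 * int \<alpha>" | "3 * \<xi> > - 2 * int \<alpha>" by linarith
  then show False
  proof cases
    case 1
    have "vge v (B * x\<^sup>2 - (e * m + c * s) * x - (m\<^sup>2 + c * m)) (3 * \<xi> + 1)"
    proof (intro vge_diff[OF F pl] Fi(7) BxF CxF DF)
      show "vge v (B * x\<^sup>2) (3 * \<xi> + 1)" using Bx by (rule vge_mono) (use 1 \<alpha>0 in linarith)
      show "vge v ((e * m + c * s) * x) (3 * \<xi> + 1)" using Cx by (rule vge_mono) (use 1 \<alpha>0 in linarith)
      show "vge v (m\<^sup>2 + c * m) (3 * \<xi> + 1)" using D 1 by (simp add: vge_def)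
    qed
    then have "x ^ 3 + (B * x\<^sup>2 - (e * m + c * s) * x - (m\<^sup>2 + c * m)) \<noteq> 0"
      using dom[OF Fi(9)[OF x, of 3] _ x3(2)] Fi(7) BxF CxF DF x3(1) by simp
    then show False using eq by Groebner_Basis.algebra
  next
    case 2
    have TF: "x ^ 3 + B * x\<^sup>2 - (e * m + c * s) * x \<in> F" by (rule Fi(7)[OF Fi(3)[OF Fi(9)[OF x] BxF] CxF])
    have T: "vge v (x ^ 3 + B * x\<^sup>2 - (e * m + c * s) * x) (- 2 * int \<alpha> + 1)"
    proof (intro vge_diff[OF F pl] vge_add[OF F pl] Fi(3,7) Fi(9) x BxF CxF)
      show "vge v (x ^ 3) (- 2 * int \<alpha> + 1)" using x3(1) 2 by (simp add: vge_def)
      show "vge v (B * x\<^sup>2) (- 2 * int \<alpha> + 1)" using Bx by (rule vge_mono) (use 2 \<alpha>0 in linarith)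
      show "vge v ((e * m + c * s) * x) (- 2 * int \<alpha> + 1)" using Cx by (rule vge_mono) (use 2 \<alpha>0 in linarith)
    qed
    have "m\<^sup>2 + c * m + - (x ^ 3 + B * x\<^sup>2 - (e * m + c * s) * x) \<noteq> 0"
      using dom[OF DF Fi(5)[OF TF] D(1)] vge_minus[OF F pl TF T] D(2) by simp
    then show False using eq by Groebner_Basis.algebra
  qed
qed

lemma nat_pow_mordell_weil: "P [^]\<^bsub>mordell_weil_group E L\<^esub> (n::nat) = P [^]\<^bsub>mordell_weil_group E UNIV\<^esub> n"
  by (induction n) (simp_all add: mordell_weil_group_def)

section \<open>The two alternatives for one slope\<close>

locale infinite_rank_setup = tate_two_adic A E j + tate_curve "a1 E" "a2 E" "a3 E"
  for A :: "'a::{alg_closed_field, field_char_0} set" and E j +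
  fixes K F :: "'a set" and \<sigma> :: "'a \<Rightarrow> 'a"
  assumes K: "is_subfield K" and EK: "a1 E \<in> K" "a2 E \<in> K" "a3 E \<in> K" and \<sigma>: "\<sigma> \<in> galois_group K"
    and F: "is_subfield F" and EF: "a1 E \<in> F" "a2 E \<in> F" "a3 E \<in> F"
    and hull: "\<And>R. R \<in> rational_points E (fixed_field \<sigma>) \<Longrightarrow> \<exists>N>0. R [^]\<^bsub>G\<^esub> (N::nat) \<in> rational_points E F"
begin

lemma E_sub_F: "{a1 E, a2 E, a3 E, a4 E, a6 E} \<subseteq> F"
  using EF tate is_subfieldD(1)[OF F] by simp

lemma K_fixed: "K \<subseteq> fixed_field \<sigma>"
  using galois_groupD(10)[OF \<sigma>] by (auto simp: fixed_field_def)

lemma on_curve_line: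
  "on_curve E x (s * x + m) \<longleftrightarrow> x ^ 3 + poly Bp s * x\<^sup>2 + (- (poly ep s * m + a3 E * s)) * x + (- (m\<^sup>2 + a3 E * m)) = 0"
proof -
  have eq: "x ^ 3 + poly Bp s * x\<^sup>2 + (- (poly ep s * m + a3 E * s)) * x + (- (m\<^sup>2 + a3 E * m))
     = (x ^ 3 + a2 E * x\<^sup>2 + a4 E * x + a6 E) - ((s * x + m)\<^sup>2 + a1 E * x * (s * x + m) + a3 E * (s * x + m))"
    unfolding eval_simps tate by Groebner_Basis.algebra
  show ?thesis unfolding on_curve_def eq right_minus_eq by (rule eq_commute)
qed

lemma line_sum:
  assumes "x1 \<noteq> x2" and "x1 + x2 + x3 = - poly Bp s"
  shows "point_add E (Affine x1 (s * x1 + m)) (Affine x2 (s * x2 + m)) = Affine x3 (- (s * x3 + m) - a1 E * x3 - a3 E)"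
proof -
  have l: "(s * x2 + m - (s * x1 + m)) / (x2 - x1) = s" using assms(1) by (simp add: field_simps)
  have x3: "s\<^sup>2 + a1 E * s - a2 E - x1 - x2 = x3" using assms(2) unfolding eval_simps by Groebner_Basis.algebra
  have "point_add E (Affine x1 (s * x1 + m)) (Affine x2 (s * x2 + m))
      = Affine x3 (- (s + a1 E) * x3 - (s * x1 + m - s * x1) - a3 E)"
    unfolding point_add.simps Let_def by (simp only: assms(1) simp_thms if_False l x3)
  then show ?thesis by (simp add: algebra_simps)
qed

lemma carrier_G: "Affine x y \<in> carrier G \<longleftrightarrow> on_curve E x y"
  by (simp add: mordell_weil_group_def Affine_in_rational_points)

context
  fixes s :: 'a
  assumes s0: "s \<noteq> 0" and sA: "mm (a1 E * inverse s)" "mm (a2 E * (inverse s)\<^sup>2)" "a3 E * (inverse s) ^ 3 \<in> A"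
    and s_large: "large (s\<^sup>2)"
begin

lemma Bp_ratio: "unit (- poly Bp s * inverse (s\<^sup>2))"
proof -
  have "- poly Bp s * inverse (s\<^sup>2) = 1 + (a1 E * inverse s - a2 E * (inverse s)\<^sup>2)"
    using s0 unfolding eval_simps by (simp add: field_simps power2_eq_square)
  with unit_1_add[OF mm_diff[OF sA(1,2)]] show ?thesis by simp
qed

lemma large_of_not_mm:
  assumes "\<not> mm (x * inverse (s\<^sup>2))"
  shows "large x \<and> inverse x * s\<^sup>2 \<in> A"
proof -
  have "x \<noteq> 0" "inverse (x * inverse (s\<^sup>2)) \<in> A" using mm_or[of "x * inverse (s\<^sup>2)"] assms by auto
  then have 1: "inverse x * s\<^sup>2 \<in> A" by simp
  moreover have "inverse x = inverse (s\<^sup>2) * (inverse x * s\<^sup>2)" using s0 by (simp add: field_simps)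
  ultimately show ?thesis using large_unit[OF s_large] \<open>x \<noteq> 0\<close> by blast
qed

text \<open>The three abscissas add up to a unit times \<open>s\<^sup>2\<close>, so they cannot all
  be small against it.\<close>

lemma cubic_large_root:
  assumes "x1 + x2 + x3 = - poly Bp s"
  shows "\<exists>x\<in>{x1, x2, x3}. large x"
proof (rule ccontr)
  assume "\<not> ?thesis"
  then have "mm (x1 * inverse (s\<^sup>2))" "mm (x2 * inverse (s\<^sup>2))" "mm (x3 * inverse (s\<^sup>2))"
    using large_of_not_mm by auto
  then have "mm (x1 * inverse (s\<^sup>2) + x2 * inverse (s\<^sup>2) + x3 * inverse (s\<^sup>2))" by (intro mm_add)
  moreover have "x1 * inverse (s\<^sup>2) + x2 * inverse (s\<^sup>2) + x3 * inverse (s\<^sup>2) = - poly Bp s * inverse (s\<^sup>2)"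
    unfolding assms[symmetric] by (simp add: distrib_right)
  ultimately show False using unit_not_mm[OF Bp_ratio] by (simp only:)
qed

lemma irrational_cubic_impossible:
  assumes sF: "s \<in> F" and mF: "m \<in> F" and mK: "m \<in> K" and sK: "s \<in> K"
    and noroot: "\<And>x. x \<in> F \<Longrightarrow> x ^ 3 + poly Bp s * x\<^sup>2 + (- (poly ep s * m + a3 E * s)) * x + (- (m\<^sup>2 + a3 E * m)) \<noteq> 0"
    and disc: "disc s m = w\<^sup>2 * V\<^sup>2" and V: "V \<in> K" and w: "\<sigma> w = - w"
  shows False
proof -
  interpret comm_group G by (rule comm_group_G)
  define B C D where "B = poly Bp s" and "C = - (poly ep s * m + a3 E * s)" and "D = - (m\<^sup>2 + a3 E * m)"
  obtain x1 x2 x3 where BCD: "B = - (x1 + x2 + x3)" "C = x1 * x2 + x1 * x3 + x2 * x3" "D = - (x1 * x2 * x3)"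
    by (rule cubic_roots)
  define g where "g = [:D, C, B, 1:]"
  have gx: "poly g x = x ^ 3 + B * x\<^sup>2 + C * x + D" for x
    by (simp add: g_def algebra_simps power2_eq_square power3_eq_cube)
  have groots: "poly g x = (x - x1) * (x - x2) * (x - x3)" for x
    unfolding gx BCD by Groebner_Basis.algebra
  have in_F: "B \<in> F" "C \<in> F" "D \<in> F" and in_K: "B \<in> K" "C \<in> K" "D \<in> K"
    unfolding B_def C_def D_def eval_simps by (intro is_subfieldD[OF F] is_subfieldD[OF K] EF EK sF mF sK mK)+
  have gF: "g \<in> polys_over F" unfolding g_def by (intro polys_over_intros[OF F] is_subfieldD[OF F] in_F)
  have dg: "degree g \<in> {2, 3}" by (simp add: g_def)
  have nr: "poly g x \<noteq> 0" if "x \<in> F" for x using noroot[OF that] unfolding gx B_def C_def D_def .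
  have conj: "poly u y = 0" if "u \<in> polys_over F" "poly u x = 0" "x \<in> {x1, x2, x3}" "y \<in> {x1, x2, x3}" for u x y
    by (rule conjugate_roots[OF F gF dg nr _ _ that(1,2)]) (use that in \<open>auto simp: groots\<close>)
  \<comment> \<open>Distinct roots are required by the parity argument and by the chord formula. As
    \<open>u\<close> is the derivative of \<open>g\<close>, conjugacy turns a double root into the
    triple root \<open>- (B / 3)\<close>, which lies in \<open>F\<close>.\<close>
  have no_double: False if xy: "x \<in> {x1, x2, x3}" "y \<in> {x1, x2, x3}" and gd: "\<And>t. poly g t = (t - x)\<^sup>2 * (t - y)" for x y
  proof -
    define u where "u = [:C, 2 * B, 3:]"
    have uF: "u \<in> polys_over F" unfolding u_def by (intro polys_over_intros[OF F] is_subfieldD[OF F] in_F)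
    have "poly g t = poly ([:-x, 1:]\<^sup>2 * [:-y, 1:]) t" for t
      unfolding gd by (simp add: algebra_simps)
    then have "g = [:-x, 1:]\<^sup>2 * [:-y, 1:]" by (intro poly_eq_poly_eq_iff[THEN iffD1] ext)
    then have cf: "B = - (2 * x + y)" "C = x\<^sup>2 + 2 * x * y" by (simp_all add: g_def power2_eq_square algebra_simps)
    have "poly u x = 0" unfolding u_def cf by (simp add: power2_eq_square algebra_simps)
    then have "poly u y = 0" by (rule conj[OF uF _ xy])
    moreover have "poly u y = (y - x)\<^sup>2" unfolding u_def cf by (simp add: power2_eq_square algebra_simps)
    ultimately have "x = y" by simp
    then have "x = - (B / 3)" unfolding cf by simp
    moreover have "- (B / 3) \<in> F" by (intro is_subfieldD[OF F] in_F)
    moreover have "poly g x = 0" using gd by simp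
    ultimately show False using nr by simp
  qed
  have ne: "x1 \<noteq> x2" "x1 \<noteq> x3" "x2 \<noteq> x3"
    using no_double[of x1 x3] no_double[of x1 x2] no_double[of x2 x1]
    by (auto simp: groots power2_eq_square mult_ac)
  \<comment> \<open>Up to sign \<open>\<delta>\<close> is \<open>w * V\<close> with \<open>V\<close>
    fixed by \<open>\<sigma>\<close>, so it inherits the sign change of \<open>w\<close>.\<close>
  define \<delta> where "\<delta> = (x1 - x2) * (x2 - x3) * (x1 - x3)"
  have "\<delta>\<^sup>2 = B\<^sup>2 * C\<^sup>2 - 4 * C ^ 3 - 4 * B ^ 3 * D - 27 * D\<^sup>2 + 18 * B * C * D"
    unfolding \<delta>_def BCD by Groebner_Basis.algebra
  also have "\<dots> = disc s m" unfolding disc_def Let_def B_def C_def D_def ..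
  finally have "\<delta>\<^sup>2 = w\<^sup>2 * V\<^sup>2" unfolding disc .
  then have "(\<delta> - w * V) * (\<delta> + w * V) = 0" by Groebner_Basis.algebra
  then have "\<delta> = w * V \<or> \<delta> = - (w * V)" by (auto simp: eq_neg_iff_add_eq_0)
  then have \<delta>: "\<sigma> \<delta> = - \<delta>"
    using w galois_groupD(10)[OF \<sigma> V] by (auto simp: galois_groupD(2,5)[OF \<sigma>])
  have perm: "\<sigma> x \<in> {x1, x2, x3}" if "x \<in> {x1, x2, x3}" for x
  proof -
    have "x ^ 3 + B * x\<^sup>2 + C * x + D = 0" using that groots[of x] unfolding gx by auto
    then have "\<sigma> (x ^ 3 + B * x\<^sup>2 + C * x + D) = 0" by (simp add: galois_groupD(3)[OF \<sigma>])
    then have "poly g (\<sigma> x) = 0"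
      unfolding gx by (simp add: galois_groupD(1,2,7)[OF \<sigma>] galois_groupD(10)[OF \<sigma>] in_K)
    then show ?thesis by (auto simp: groots)
  qed
  obtain x where x: "x \<in> {x1, x2, x3}" "\<sigma> x = x"
    using odd_permutation_fixes_root[OF \<sigma> perm ne \<delta>[unfolded \<delta>_def]] by blast
  define pt where "pt x = Affine x (s * x + m)" for x
  have oc: "on_curve E z (s * z + m)" if "z \<in> {x1, x2, x3}" for z
    using that groots[of z] unfolding on_curve_line gx B_def C_def D_def by auto
  then have ptc: "pt z \<in> carrier G" if "z \<in> {x1, x2, x3}" for z using that by (simp add: pt_def carrier_G)
  have "s \<in> fixed_field \<sigma>" "m \<in> fixed_field \<sigma>" "x \<in> fixed_field \<sigma>"
    using sK mK K_fixed x(2) by (auto simp: fixed_field_def)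
  then have "pt x \<in> rational_points E (fixed_field \<sigma>)"
    unfolding pt_def Affine_in_rational_points using oc[OF x(1)] is_subfieldD(3,4)[OF subfield_fixed_field[OF \<sigma>]] by blast
  then obtain N where N: "N > 0" "pt x [^]\<^bsub>G\<^esub> (N::nat) \<in> rational_points E F" using hull by blast
  have all_eq: "pt z [^]\<^bsub>G\<^esub> N = pt x [^]\<^bsub>G\<^esub> N" if z: "z \<in> {x1, x2, x3}" for z
    unfolding pt_def
    by (rule conjugate_multiples[OF F _ E_sub_F sF mF N(2)[unfolded pt_def], symmetric]) (use conj x(1) z in blast)
  have sum: "x1 + x2 + x3 = - poly Bp s" using BCD(1) unfolding B_def by simp
  have "pt x1 \<otimes>\<^bsub>G\<^esub> pt x2 = point_neg E (pt x3)"
    using line_sum[OF ne(1) sum, of m] unfolding pt_def by (simp add: mordell_weil_group_def)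
  then have one: "pt x1 \<otimes>\<^bsub>G\<^esub> pt x2 \<otimes>\<^bsub>G\<^esub> pt x3 = \<one>\<^bsub>G\<^esub>"
    using point_add_neg(1)[of E "pt x3"] by (simp add: mordell_weil_group_def)
  have "(pt x1 \<otimes>\<^bsub>G\<^esub> pt x2 \<otimes>\<^bsub>G\<^esub> pt x3) [^]\<^bsub>G\<^esub> N = pt x1 [^]\<^bsub>G\<^esub> N \<otimes>\<^bsub>G\<^esub> pt x2 [^]\<^bsub>G\<^esub> N \<otimes>\<^bsub>G\<^esub> pt x3 [^]\<^bsub>G\<^esub> N"
    using ptc by (simp add: nat_pow_distrib)
  then have three: "pt x [^]\<^bsub>G\<^esub> N \<otimes>\<^bsub>G\<^esub> pt x [^]\<^bsub>G\<^esub> N \<otimes>\<^bsub>G\<^esub> pt x [^]\<^bsub>G\<^esub> N = \<one>\<^bsub>G\<^esub>"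
    using all_eq unfolding one by simp
  obtain z where z: "z \<in> {x1, x2, x3}" "large z" using cubic_large_root[OF sum] by blast
  have "pt z [^]\<^bsub>G\<^esub> (N + N + N) = \<one>\<^bsub>G\<^esub>"
    using three all_eq[OF z(1)] ptc[OF z(1)] by (simp add: nat_pow_mult[symmetric])
  then show False
    using large_not_torsion[OF oc[OF z(1)] z(2), of "N + N + N"] N(1) unfolding pt_def by simp
qed

text \<open>The third point of the line is the origin \<open>P\<close>, so the two conjugate points
  add up to \<open>- P\<close>, which is \<open>Affine 0 (- a3 E)\<close>. The comparison of
  \<open>x\<close> with \<open>s\<^sup>2\<close> in both directions makes points for slopes of
  different size comparable.\<close>

lemma quadratic_point:
  assumes sF: "s \<in> F" and sK: "s \<in> K" and w: "w\<^sup>2 = poly dp s" "\<sigma> w = w" and wF: "w \<notin> F"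
  shows "\<exists>x N. N > 0 \<and> large x \<and> on_curve E x (s * x) \<and> inverse x * s\<^sup>2 \<in> A \<and> x * inverse (s\<^sup>2) \<in> A \<and>
    Affine x (s * x) [^]\<^bsub>G\<^esub> (2 * N) = Affine 0 (- a3 E) [^]\<^bsub>G\<^esub> (N::nat)"
proof -
  interpret comm_group G by (rule comm_group_G)
  define B where "B = poly Bp s"
  have B_in: "B \<in> F" "B \<in> K" unfolding B_def eval_simps by (intro is_subfieldD[OF F] is_subfieldD[OF K] EF EK sF sK)+
  define g where "g = [:- (a3 E * s), B, 1:]"
  have gF: "g \<in> polys_over F" unfolding g_def by (intro polys_over_intros[OF F] is_subfieldD[OF F] B_in EF sF)
  have dg: "degree g \<in> {2, 3}" by (simp add: g_def)
  have gx: "poly g x = x\<^sup>2 + B * x - a3 E * s" for x by (simp add: g_def algebra_simps power2_eq_square)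
  have dpB: "poly dp s = B\<^sup>2 + 4 * a3 E * s" unfolding eval_simps(4) B_def ..
  have gw: "4 * poly g x = (2 * x + B - w) * (2 * x + B + w)" for x
    using w(1) unfolding gx dpB by Groebner_Basis.algebra
  have nr: "poly g x \<noteq> 0" if "x \<in> F" for x
  proof
    assume "poly g x = 0"
    then consider "2 * x + B - w = 0" | "2 * x + B + w = 0" using gw[of x] by auto
    then have "w = 2 * x + B \<or> w = - (2 * x + B)" by cases (Groebner_Basis.algebra, Groebner_Basis.algebra)
    moreover have "2 * x + B \<in> F" "- (2 * x + B) \<in> F"
      by (rule is_subfieldD[OF F] B_in that)+
    ultimately show False using wF by auto
  qed
  define r1 r2 where "r1 = (w - B) / 2" and "r2 = (- w - B) / 2"
  have sum: "r1 + r2 + 0 = - poly Bp s" by (simp add: r1_def r2_def B_def field_simps)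
  have "2 * r1 + B - w = 0" "2 * r2 + B + w = 0" by (simp_all add: r1_def r2_def field_simps)
  then have "4 * poly g r1 = 0" "4 * poly g r2 = 0" unfolding gw by simp_all
  then have roots: "poly g r1 = 0" "poly g r2 = 0" by simp_all
  have w0: "w \<noteq> 0" using wF is_subfieldD(1)[OF F] by auto
  then have ne: "r1 \<noteq> r2" by (simp add: r1_def r2_def field_simps)
  have "\<not> large 0" by (simp add: large_def)
  then obtain x x' where xx: "{x, x'} = {r1, r2}" and big: "\<not> mm (x * inverse (s\<^sup>2))"
  proof -
    have "\<not> (mm (r1 * inverse (s\<^sup>2)) \<and> mm (r2 * inverse (s\<^sup>2)))"
    proof
      assume "mm (r1 * inverse (s\<^sup>2)) \<and> mm (r2 * inverse (s\<^sup>2))"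
      then have "mm (r1 * inverse (s\<^sup>2) + r2 * inverse (s\<^sup>2))" using mm_add by blast
      moreover have "r1 * inverse (s\<^sup>2) + r2 * inverse (s\<^sup>2) = - poly Bp s * inverse (s\<^sup>2)"
        unfolding sum[symmetric] by (simp add: distrib_right)
      ultimately show False using unit_not_mm[OF Bp_ratio] by (simp only:)
    qed
    then show ?thesis using that[of r1 r2] that[of r2 r1] by blast
  qed
  have gxx: "poly g x = 0" "poly g x' = 0" and xne: "x \<noteq> x'" and sum': "x + x' + 0 = - poly Bp s"
    using xx roots ne sum by (auto simp: doubleton_eq_iff add.commute)
  have oc: "on_curve E z (s * z + 0)" if "poly g z = 0" for z
  proof -
    have "z ^ 3 + poly Bp s * z\<^sup>2 + (- (poly ep s * 0 + a3 E * s)) * z + (- (0\<^sup>2 + a3 E * 0)) = z * poly g z"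
      unfolding gx B_def by (simp add: algebra_simps power2_eq_square power3_eq_cube)
    then show ?thesis unfolding on_curve_line that by simp
  qed
  have "\<sigma> x = x"
  proof -
    have "w \<in> fixed_field \<sigma>" "B \<in> fixed_field \<sigma>" using w(2) B_in(2) K_fixed by (auto simp: fixed_field_def)
    then have "r1 \<in> fixed_field \<sigma>" "r2 \<in> fixed_field \<sigma>"
      unfolding r1_def r2_def by (auto intro!: is_subfieldD[OF subfield_fixed_field[OF \<sigma>]])
    then show ?thesis using xx by (auto simp: doubleton_eq_iff fixed_field_def)
  qed
  then have "x \<in> fixed_field \<sigma>" "s * x + 0 \<in> fixed_field \<sigma>"
    using galois_groupD(10)[OF \<sigma> sK] by (auto simp: fixed_field_def galois_groupD(2)[OF \<sigma>])
  then have "Affine x (s * x + 0) \<in> rational_points E (fixed_field \<sigma>)"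
    unfolding Affine_in_rational_points using oc[OF gxx(1)] by blast
  then obtain N where N: "N > 0" "Affine x (s * x + 0) [^]\<^bsub>G\<^esub> (N::nat) \<in> rational_points E F" using hull by blast
  have conj: "poly u x = 0 \<longleftrightarrow> poly u x' = 0" if "u \<in> polys_over F" for u
    using conjugate_roots[OF F gF dg nr gxx that] conjugate_roots[OF F gF dg nr gxx(2,1) that] by blast
  have eq: "Affine x (s * x + 0) [^]\<^bsub>G\<^esub> N = Affine x' (s * x' + 0) [^]\<^bsub>G\<^esub> N"
    by (rule conjugate_multiples[OF F conj E_sub_F sF is_subfieldD(1)[OF F] N(2)])
  have c: "Affine x (s * x + 0) \<in> carrier G" "Affine x' (s * x' + 0) \<in> carrier G"
    using oc gxx by (simp_all only: carrier_G)
  have add: "Affine x (s * x + 0) \<otimes>\<^bsub>G\<^esub> Affine x' (s * x' + 0) = Affine 0 (- a3 E)"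
    using line_sum[OF xne sum', of 0] by (simp add: mordell_weil_group_def)
  have "Affine x (s * x + 0) [^]\<^bsub>G\<^esub> (2 * N) = Affine x (s * x + 0) [^]\<^bsub>G\<^esub> N \<otimes>\<^bsub>G\<^esub> Affine x (s * x + 0) [^]\<^bsub>G\<^esub> N"
    unfolding mult_2 using c(1) by (rule nat_pow_mult[symmetric])
  also have "\<dots> = Affine x (s * x + 0) [^]\<^bsub>G\<^esub> N \<otimes>\<^bsub>G\<^esub> Affine x' (s * x' + 0) [^]\<^bsub>G\<^esub> N" by (simp only: eq)
  also have "\<dots> = (Affine x (s * x + 0) \<otimes>\<^bsub>G\<^esub> Affine x' (s * x' + 0)) [^]\<^bsub>G\<^esub> N" using c by (rule nat_pow_distrib[symmetric])
  finally have "Affine x (s * x) [^]\<^bsub>G\<^esub> (2 * N) = Affine 0 (- a3 E) [^]\<^bsub>G\<^esub> N" unfolding add by simp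
  moreover have "x * inverse (s\<^sup>2) \<in> A"
  proof (rule quadratic_in_A)
    show "(x * inverse (s\<^sup>2))\<^sup>2 + (- (- poly Bp s * inverse (s\<^sup>2))) * (x * inverse (s\<^sup>2)) + (- (a3 E * (inverse s) ^ 3)) = 0"
    proof -
      have "(x * inverse (s\<^sup>2))\<^sup>2 + (- (- poly Bp s * inverse (s\<^sup>2))) * (x * inverse (s\<^sup>2)) + (- (a3 E * (inverse s) ^ 3))
        = (inverse (s\<^sup>2))\<^sup>2 * (x\<^sup>2 + B * x - a3 E * s)"
        unfolding B_def using s0 by (simp add: field_simps power2_eq_square power3_eq_cube)
      then show ?thesis using gxx(1) unfolding gx by simp
    qed
    show "- (- poly Bp s * inverse (s\<^sup>2)) \<in> A" using Bp_ratio by (intro A_intros(5)) (simp add: unit_def)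
    show "- (a3 E * (inverse s) ^ 3) \<in> A" using sA(3) by (rule A_intros(5))
  qed
  moreover have "on_curve E x (s * x)" using oc[OF gxx(1)] by simp
  ultimately show ?thesis using N(1) large_of_not_mm[OF big] by blast
qed

end

end

section \<open>Choice of the slopes and the contradiction\<close>

context infinite_rank_setup begin

text \<open>Only the quadratic alternative appears in the conclusion because the cubic one is
  contradictory. The place \<open>v1\<close> keeps the square root of \<open>poly dp s\<close> out
  of \<open>F\<close>, and \<open>v2\<close> keeps the roots of the cubic out of it.\<close>

lemma dichotomy_point:
  assumes pl1: "is_place F p1 v1" and pl2: "is_place F p2 v2"
    and \<rho>: "\<rho>1 \<in> F" "\<rho>2 \<in> F" and odd1: "odd (Polynomial.order \<rho>1 dp)"
    and ord2: "\<not> 3 dvd Polynomial.order \<rho>2 Denp" and num2: "poly nump \<rho>2 \<noteq> 0"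
    and d_val: "poly dp s \<noteq> 0" "v1 (poly dp s) = int (Polynomial.order \<rho>1 dp)"
    and Den_val: "poly Denp s \<noteq> 0" "v2 (poly Denp s) = int (Polynomial.order \<rho>2 Denp)"
    and num_val: "poly nump s \<noteq> 0" "v2 (poly nump s) = 0"
    and int2: "vge v2 (a1 E) 0" "vge v2 (a2 E) 0" "vge v2 (a3 E) 0" "vge v2 s 0"
    and s: "s \<in> K" "s \<in> F" "s \<noteq> 0" "mm (a1 E * inverse s)" "mm (a2 E * (inverse s)\<^sup>2)" "a3 E * (inverse s) ^ 3 \<in> A"
    and s_large: "large (s\<^sup>2)"
  shows "\<exists>x N. N > 0 \<and> large x \<and> on_curve E x (s * x) \<and> inverse x * s\<^sup>2 \<in> A \<and> x * inverse (s\<^sup>2) \<in> A \<and>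
    Affine x (s * x) [^]\<^bsub>G\<^esub> (2 * N) = Affine 0 (- a3 E) [^]\<^bsub>G\<^esub> (N::nat)"
proof -
  obtain w where w: "w\<^sup>2 = poly dp s" using nth_root_exists[of 2 "poly dp s"] by auto
  have wF: "w \<notin> F"
  proof
    assume "w \<in> F"
    moreover have "w \<noteq> 0" using w d_val(1) by auto
    ultimately have "v1 (w\<^sup>2) = 2 * v1 w" using place_power[OF F pl1, of w 2] by simp
    then have "even (int (Polynomial.order \<rho>1 dp))" using d_val(2) w by simp
    with odd1 show False by simp
  qed
  have polysK: "poly dp s \<in> K" "poly Denp s \<in> K" "poly nump s \<in> K"
    and polysF: "poly dp s \<in> F" "poly Denp s \<in> F" "poly nump s \<in> F"
    using coeffs_in_subfield[OF K EK] coeffs_in_subfield[OF F EF] poly_in_subfield[OF K _ s(1)] poly_in_subfield[OF F _ s(2)]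
    by blast+
  have "\<sigma> w * \<sigma> w = w * w"
    using galois_groupD(2)[OF \<sigma>, of w w] galois_groupD(10)[OF \<sigma> polysK(1)] w by (simp add: power2_eq_square)
  then have "\<sigma> w = w \<or> \<sigma> w = - w" by (simp add: square_eq_iff)
  then show ?thesis
  proof
    assume "\<sigma> w = w"
    from quadratic_point[OF s(3-6) s_large s(2,1) w this wF] show ?thesis .
  next
    assume \<sigma>w: "\<sigma> w = - w"
    define \<alpha> where "\<alpha> = Polynomial.order \<rho>2 Denp"
    define m where "m = poly nump s / poly Denp s"
    have mK: "m \<in> K" and mF: "m \<in> F" unfolding m_def using polysK polysF is_subfieldD(8)[OF K] is_subfieldD(8)[OF F] by blast+
    have m0: "m \<noteq> 0" using num_val(1) Den_val(1) by (simp add: m_def)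
    have "v2 (m * poly Denp s) = v2 m + v2 (poly Denp s)" using place_mult[OF F pl2 mF polysF(2) m0 Den_val(1)] .
    moreover have "m * poly Denp s = poly nump s" using Den_val(1) by (simp add: m_def)
    ultimately have vm: "v2 m = - int \<alpha>" using num_val(2) Den_val(2) by (simp add: \<alpha>_def)
    have Bv: "poly Bp s \<in> F" "vge v2 (poly Bp s) 0" and ev: "poly ep s \<in> F" "vge v2 (poly ep s) 0"
    proof -
      note fi = is_subfieldD[OF F] EF s(2)
      have s2: "vge v2 (s\<^sup>2) 0" unfolding power2_eq_square using vge_mult[OF F pl2 s(2) s(2) int2(4) int2(4)] by simp
      have as: "vge v2 (a1 E * s) 0" using vge_mult[OF F pl2 EF(1) s(2) int2(1) int2(4)] by simp
      have two: "vge v2 (2 * s) 0" using vge_mult[OF F pl2 _ s(2) _ int2(4), of 2 0] vge_of_nat[OF F pl2, of 2] is_subfieldD(11)[OF F] by simp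
      show "poly Bp s \<in> F" "poly ep s \<in> F" unfolding eval_simps by (intro fi)+
      show "vge v2 (poly Bp s) 0" unfolding eval_simps
        by (intro vge_diff[OF F pl2] int2 s2 as) (intro fi)+
      show "vge v2 (poly ep s) 0" unfolding eval_simps by (intro vge_add[OF F pl2] int2 two) (intro fi)+
    qed
    have noroot: "x ^ 3 + poly Bp s * x\<^sup>2 + (- (poly ep s * m + a3 E * s)) * x + (- (m\<^sup>2 + a3 E * m)) \<noteq> 0" if "x \<in> F" for x
      by (rule cubic_no_root_at_place[OF F pl2 Bv ev EF(3) int2(3) s(2) int2(4) mF m0 vm ord2[folded \<alpha>_def] that])
    define V where "V = a3 E * s + poly n1p s / (s * poly dp s) * m + poly n2p s / (2 * a3 E * s ^ 3 * (poly dp s)\<^sup>2) * m\<^sup>2"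
    have disc: "disc s m = w\<^sup>2 * V\<^sup>2"
      unfolding w V_def m_def by (rule disc_square[OF s(3) d_val(1) Den_val(1)])
    have "poly n1p s \<in> K" "poly n2p s \<in> K"
      unfolding eval_simps(7,8,5,4) unfolding eval_simps by (intro is_subfieldD[OF K] EK s(1))+
    then have VK: "V \<in> K" unfolding V_def by (intro is_subfieldD[OF K] EK s(1) mK polysK)
    from irrational_cubic_impossible[OF s(3-6) s_large s(2) mF mK s(1) noroot disc VK \<sigma>w]
    show ?thesis by blast
  qed
qed

text \<open>The bounds against the squares of the slopes make \<open>x / x'\<close> small, so the
  difference of the two points is large. Yet it is killed by \<open>2 * N * N'\<close>, because this
  multiple of either point is the same multiple of \<open>- P\<close>.\<close>

lemma two_large_points_impossible:
  assumes s: "s \<noteq> 0" "s' \<noteq> 0" "mm (s * inverse s')"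
    and 1: "N > 0" "large x" "on_curve E x (s * x)" "x * inverse (s\<^sup>2) \<in> A"
      "Affine x (s * x) [^]\<^bsub>G\<^esub> (2 * N) = Affine 0 (- a3 E) [^]\<^bsub>G\<^esub> (N::nat)"
    and 2: "N' > 0" "large x'" "on_curve E x' (s' * x')" "inverse x' * s'\<^sup>2 \<in> A"
      "Affine x' (s' * x') [^]\<^bsub>G\<^esub> (2 * N') = Affine 0 (- a3 E) [^]\<^bsub>G\<^esub> (N'::nat)"
  shows False
proof -
  interpret comm_group G by (rule comm_group_G)
  let ?Q = "Affine x (s * x)" and ?Q' = "Affine x' (s' * x')" and ?M = "Affine 0 (- a3 E)"
  let ?n = "point_neg E ?Q"
  have c: "?Q \<in> carrier G" "?Q' \<in> carrier G" "?n \<in> carrier G"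
    using 1(3) 2(3) by (simp_all add: carrier_G on_curve_neg)
  have M: "?M \<in> carrier G" by (simp add: carrier_G on_curve_def tate power2_eq_square)
  have "mm ((x * inverse (s\<^sup>2)) * (inverse x' * s'\<^sup>2) * (s * inverse s') * (s * inverse s'))"
    by (rule mm_mult[OF A_intros(4)[OF A_intros(4)[OF 1(4) 2(4)] mm_A[OF s(3)]] s(3)])
  moreover have "(x * inverse (s\<^sup>2)) * (inverse x' * s'\<^sup>2) * (s * inverse s') * (s * inverse s') = x * inverse x'"
    using s(1,2) by (simp add: field_simps power2_eq_square)
  ultimately have "mm (x * inverse x')" by (simp only:)
  then obtain x3 y3 where T: "point_add E ?Q' ?n = Affine x3 y3" "on_curve E x3 y3" "large x3"
    using large_sum[OF 2(3) _ 2(2) 1(2), of "- (s * x) - a1 E * x - a3 E"] 1(3) by (auto simp: on_curve_neg)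
  have inv: "inv\<^bsub>G\<^esub> ?Q = ?n"
    using point_add_neg(1)[of E ?Q] c by (intro inv_equality) (simp_all add: mordell_weil_group_def)
  have "?Q [^]\<^bsub>G\<^esub> (2 * N * N') = (?Q [^]\<^bsub>G\<^esub> (2 * N)) [^]\<^bsub>G\<^esub> N'" using c(1) by (rule nat_pow_pow[symmetric])
  also have "\<dots> = ?M [^]\<^bsub>G\<^esub> (N * N')" unfolding 1(5) using M by (rule nat_pow_pow)
  also have "\<dots> = ?M [^]\<^bsub>G\<^esub> (N' * N)" by (simp only: mult.commute)
  also have "\<dots> = (?Q' [^]\<^bsub>G\<^esub> (2 * N')) [^]\<^bsub>G\<^esub> N" unfolding 2(5) using M by (rule nat_pow_pow[symmetric])
  also have "\<dots> = ?Q' [^]\<^bsub>G\<^esub> (2 * N' * N)" using c(2) by (rule nat_pow_pow)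
  also have "2 * N' * N = 2 * N * N'" by simp
  finally have eq: "?Q [^]\<^bsub>G\<^esub> (2 * N * N') = ?Q' [^]\<^bsub>G\<^esub> (2 * N * N')" .
  have "Affine x3 y3 = ?Q' \<otimes>\<^bsub>G\<^esub> ?n" using T(1) by (simp add: mordell_weil_group_def)
  then have "Affine x3 y3 [^]\<^bsub>G\<^esub> (2 * N * N') = ?Q' [^]\<^bsub>G\<^esub> (2 * N * N') \<otimes>\<^bsub>G\<^esub> ?n [^]\<^bsub>G\<^esub> (2 * N * N')"
    using c by (simp only: nat_pow_distrib)
  also have "?n [^]\<^bsub>G\<^esub> (2 * N * N') = inv\<^bsub>G\<^esub> (?Q [^]\<^bsub>G\<^esub> (2 * N * N'))"
    unfolding inv[symmetric] using c(1) by (rule nat_pow_inv)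
  also have "?Q' [^]\<^bsub>G\<^esub> (2 * N * N') \<otimes>\<^bsub>G\<^esub> inv\<^bsub>G\<^esub> (?Q [^]\<^bsub>G\<^esub> (2 * N * N')) = \<one>\<^bsub>G\<^esub>"
    unfolding eq using c(2) by (intro r_inv nat_pow_closed)
  finally show False using large_not_torsion[OF T(2,3), of "2 * N * N'"] 1(1) 2(1) by simp
qed

text \<open>With exponent at least \<open>j + 3\<close>, the inverse of \<open>s\<close> is
  divisible by \<open>8 * 2 ^ j\<close>; this covers the denominators of the coefficients and the
  constant in \<open>large\<close>.\<close>

lemma dyadic_large:
  assumes n: "odd n" and k: "k \<ge> j + 3" and s: "s = of_int n / 2 ^ k"
  shows "s \<noteq> 0 \<and> mm (a1 E * inverse s) \<and> mm (a2 E * (inverse s)\<^sup>2) \<and> a3 E * (inverse s) ^ 3 \<in> A \<and> large (s\<^sup>2)"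
proof -
  define \<nu> where "\<nu> = inverse (of_int n :: 'a)"
  have \<nu>: "\<nu> \<in> A" unfolding \<nu>_def using n by (rule odd_inverse_in_A)
  have n0: "n \<noteq> 0" using n by auto
  then have s0: "s \<noteq> 0" by (simp add: s)
  obtain i where i: "k = j + 3 + i" using k by (metis le_iff_add)
  define g q where "g = (2 ^ j :: 'a)" and "q = (2 ^ i :: 'a)"
  have gq: "g \<in> A" "q \<in> A" unfolding g_def q_def by (intro A_intros)+
  have inv_s: "inverse s = 8 * g * q * \<nu>" using n0 by (simp add: s i power_add \<nu>_def g_def q_def field_simps)
  have cl: "g * a1 E \<in> A" "g * a2 E \<in> A" "g * a3 E \<in> A" unfolding g_def using clear by auto
  have "a1 E * inverse s = 2 * (4 * q * \<nu> * (g * a1 E))" unfolding inv_s by simp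
  moreover have "mm (2 * (4 * q * \<nu> * (g * a1 E)))" by (rule mm_even[OF A_intros(4)[OF _ cl(1)]]) (intro A_intros gq \<nu>)
  ultimately have 1: "mm (a1 E * inverse s)" by (simp only:)
  have "a2 E * (inverse s)\<^sup>2 = 2 * (32 * g * q\<^sup>2 * \<nu>\<^sup>2 * (g * a2 E))" unfolding inv_s by (simp add: power2_eq_square)
  moreover have "mm (2 * (32 * g * q\<^sup>2 * \<nu>\<^sup>2 * (g * a2 E)))" by (rule mm_even[OF A_intros(4)[OF _ cl(2)]]) (intro A_intros gq \<nu>)
  ultimately have 2: "mm (a2 E * (inverse s)\<^sup>2)" by (simp only:)
  have "a3 E * (inverse s) ^ 3 = 512 * g\<^sup>2 * q ^ 3 * \<nu> ^ 3 * (g * a3 E)" unfolding inv_s by (simp add: power2_eq_square power3_eq_cube)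
  moreover have "512 * g\<^sup>2 * q ^ 3 * \<nu> ^ 3 * (g * a3 E) \<in> A" by (rule A_intros(4)[OF _ cl(3)]) (intro A_intros gq \<nu>)
  ultimately have 3: "a3 E * (inverse s) ^ 3 \<in> A" by (simp only:)
  have "inverse (s\<^sup>2) = 8 * (2 ^ j)\<^sup>2 * (8 * q\<^sup>2 * \<nu>\<^sup>2)"
    unfolding power_inverse[symmetric] inv_s g_def[symmetric] by (simp add: power2_eq_square)
  moreover have "8 * q\<^sup>2 * \<nu>\<^sup>2 \<in> A" by (intro A_intros gq \<nu>)
  ultimately have "large (s\<^sup>2)" unfolding large_def using power_not_zero[OF s0, of 2] by blast
  with 1 2 3 s0 show ?thesis by blast
qed

end

text \<open>The order of the choices matters: \<open>F\<close> has to contain the zero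
  \<open>\<rho>1\<close> and the pole \<open>\<rho>2\<close>, the places are then chosen to avoid
  finitely many elements of \<open>F\<close>, and only after that is a numerator \<open>n\<close>
  found for each exponent \<open>k\<close>.\<close>

lemma finite_hull_impossible:
  fixes E :: "'a::{alg_closed_field, field_char_0} weierstrass_curve"
  assumes alg: "\<And>x :: 'a. algebraic x" and K: "is_subfield K" and \<sigma>: "\<sigma> \<in> galois_group K"
    and EK: "a1 E \<in> K" "a2 E \<in> K" "a3 E \<in> K" and tate: "a4 E = 0" "a6 E = 0" "a2 E \<noteq> 0" "a3 E \<noteq> 0"
    and ns: "nonsingular_curve E" and X: "finite X"
    and hull: "\<And>F R. is_subfield F \<Longrightarrow> X \<subseteq> F \<Longrightarrow> R \<in> rational_points E (fixed_field \<sigma>) \<Longrightarrow>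
      \<exists>N>0. R [^]\<^bsub>mordell_weil_group E UNIV\<^esub> (N::nat) \<in> rational_points E F"
  shows False
proof -
  interpret tate_curve "a1 E" "a2 E" "a3 E"
    using tate(3,4) ns[unfolded nonsingular_curve_def on_curve_def tate(1,2)] by unfold_locales auto
  obtain \<rho>1 where \<rho>1: "odd (Polynomial.order \<rho>1 dp)" using dp_odd_root by blast
  obtain \<rho>2 where \<rho>2: "\<not> 3 dvd Polynomial.order \<rho>2 Denp" "poly nump \<rho>2 \<noteq> 0" using good_pole by blast
  obtain \<theta> where \<theta>: "X \<union> {a1 E, a2 E, a3 E, \<rho>1, \<rho>2} \<subseteq> Q_adjoin \<theta>"
    using finite_subset_Q_adjoin[OF alg, of "X \<union> {a1 E, a2 E, a3 E, \<rho>1, \<rho>2}"] X by auto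
  define F where "F = Q_adjoin \<theta>"
  have F: "is_subfield F" unfolding F_def by (rule subfield_Q_adjoin)
  have in_F: "X \<subseteq> F" "a1 E \<in> F" "a2 E \<in> F" "a3 E \<in> F" "\<rho>1 \<in> F" "\<rho>2 \<in> F" using \<theta> by (auto simp: F_def)
  note polysF = coeffs_in_subfield[OF F in_F(2-4)]
  have nz: "dp \<noteq> 0" "nump \<noteq> 0" using degree_dp \<rho>2(2) by auto
  obtain Y1 where Y1: "finite Y1" "Y1 \<subseteq> F - {0}" "\<And>p v s. is_place F p v \<Longrightarrow> (\<forall>y\<in>Y1. v y = 0) \<Longrightarrow> s \<in> F \<Longrightarrow>
     s \<noteq> \<rho>1 \<Longrightarrow> v (s - \<rho>1) = 1 \<Longrightarrow> poly dp s \<noteq> 0 \<and> v (poly dp s) = int (Polynomial.order \<rho>1 dp)"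
    using place_poly_order[OF F polysF(1) nz(1) in_F(5)] by metis
  obtain Y2 where Y2: "finite Y2" "Y2 \<subseteq> F - {0}" "\<And>p v s. is_place F p v \<Longrightarrow> (\<forall>y\<in>Y2. v y = 0) \<Longrightarrow> s \<in> F \<Longrightarrow>
     s \<noteq> \<rho>2 \<Longrightarrow> v (s - \<rho>2) = 1 \<Longrightarrow> poly Denp s \<noteq> 0 \<and> v (poly Denp s) = int (Polynomial.order \<rho>2 Denp)"
    using place_poly_order[OF F polysF(2) Denp_nonzero in_F(6)] by metis
  obtain Y3 where Y3: "finite Y3" "Y3 \<subseteq> F - {0}" "\<And>p v s. is_place F p v \<Longrightarrow> (\<forall>y\<in>Y3. v y = 0) \<Longrightarrow> s \<in> F \<Longrightarrow>
     s \<noteq> \<rho>2 \<Longrightarrow> v (s - \<rho>2) = 1 \<Longrightarrow> poly nump s \<noteq> 0 \<and> v (poly nump s) = int (Polynomial.order \<rho>2 nump)"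
    using place_poly_order[OF F polysF(3) nz(2) in_F(6)] by metis
  have num0: "Polynomial.order \<rho>2 nump = 0" using \<rho>2(2) by (rule order_0I)
  define Y where "Y = Y1 \<union> Y2 \<union> Y3 \<union> ({a1 E, a2 E, a3 E, \<rho>1, \<rho>2} - {0})"
  have Y: "finite Y" "Y \<subseteq> Q_adjoin \<theta> - {0}"
    unfolding Y_def F_def[symmetric] using Y1(1,2) Y2(1,2) Y3(1,2) in_F by auto
  obtain p1 v1 where 1: "p1 > 2" "is_place F p1 v1" "\<forall>y\<in>Y. v1 y = 0"
    using exists_place[OF alg Y, of 2] unfolding F_def by blast
  obtain p2 v2 where 2: "p2 > p1" "is_place F p2 v2" "\<forall>y\<in>Y. v2 y = 0"
    using exists_place[OF alg Y, of p1] unfolding F_def by blast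
  have int: "vge v x 0" if "x \<in> {a1 E, a2 E, a3 E, \<rho>1, \<rho>2}" "\<forall>y\<in>Y. v y = 0" for v x
  proof (cases "x = 0")
    case False
    then have "x \<in> Y" using that(1) by (auto simp: Y_def)
    with that(2) show ?thesis by (simp add: vge_def)
  qed (simp add: vge_def)
  obtain A :: "'a set" where A: "is_subring A" "inverse 2 \<notin> A" "\<And>x. x \<in> A \<or> inverse x \<in> A"
    using exists_two_adic_ring by blast
  interpret two_adic A using A by unfold_locales auto
  obtain j where j: "2 ^ j * a1 E \<in> A" "2 ^ j * a2 E \<in> A" "2 ^ j * a3 E \<in> A"
  proof -
    obtain k1 k2 k3 where k: "2 ^ k1 * a1 E \<in> A" "2 ^ k2 * a2 E \<in> A" "2 ^ k3 * a3 E \<in> A"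
      using two_power_clears[OF alg] by metis
    have up: "2 ^ (k + l) * a \<in> A" if "2 ^ k * a \<in> A" for k l a
    proof -
      have "2 ^ l * (2 ^ k * a) \<in> A" by (rule A_intros(4)[OF _ that]) (intro A_intros)
      then show ?thesis by (simp add: power_add mult_ac)
    qed
    show ?thesis
      by (rule that[of "k1 + k2 + k3"]) (use up[OF k(1), of "k2 + k3"] up[OF k(2), of "k1 + k3"] up[OF k(3), of "k1 + k2"]
        in \<open>simp_all add: add_ac\<close>)
  qed
  interpret infinite_rank_setup A E j K F \<sigma>
    by unfold_locales (use tate ns j K EK \<sigma> F in_F hull[OF F in_F(1)] in auto)
  have step: "\<exists>n x N. odd n \<and> N > 0 \<and> large x \<and> on_curve E x (of_int n / 2 ^ k * x)
      \<and> inverse x * (of_int n / 2 ^ k)\<^sup>2 \<in> A \<and> x * inverse ((of_int n / 2 ^ k)\<^sup>2) \<in> A \<and>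
      Affine x (of_int n / 2 ^ k * x) [^]\<^bsub>G\<^esub> (2 * N) = Affine 0 (- a3 E) [^]\<^bsub>G\<^esub> (N::nat)" if k: "k \<ge> j + 3" for k
  proof -
    obtain n where n: "odd n" "of_int n / 2 ^ k \<noteq> \<rho>1" "v1 (of_int n / 2 ^ k - \<rho>1) = 1"
      "of_int n / 2 ^ k \<noteq> \<rho>2" "v2 (of_int n / 2 ^ k - \<rho>2) = 1"
      using simultaneous_approximation[OF F 1(2) _ 2(2) _ _ in_F(5) int[OF _ 1(3)] in_F(6) int[OF _ 2(3)], of k] 1(1) 2(1) by auto
    define s where "s = (of_int n / 2 ^ k :: 'a)"
    have sK: "s \<in> K" and sF: "s \<in> F" unfolding s_def by (intro is_subfieldD[OF K] is_subfieldD[OF F])+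
    have d: "poly dp s \<noteq> 0 \<and> v1 (poly dp s) = int (Polynomial.order \<rho>1 dp)"
      by (rule Y1(3)[OF 1(2)]) (use 1(3) n sF in \<open>auto simp: Y_def s_def\<close>)
    have D: "poly Denp s \<noteq> 0 \<and> v2 (poly Denp s) = int (Polynomial.order \<rho>2 Denp)"
      by (rule Y2(3)[OF 2(2)]) (use 2(3) n sF in \<open>auto simp: Y_def s_def\<close>)
    have M: "poly nump s \<noteq> 0 \<and> v2 (poly nump s) = int (Polynomial.order \<rho>2 nump)"
      by (rule Y3(3)[OF 2(2)]) (use 2(3) n sF in \<open>auto simp: Y_def s_def\<close>)
    have "vge v2 ((s - \<rho>2) + \<rho>2) 0"
      by (rule vge_add[OF F 2(2)]) (use n(5) int[OF _ 2(3), of \<rho>2] sF in_F is_subfieldD(7)[OF F] in \<open>auto simp: vge_def s_def\<close>)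
    then have vs: "vge v2 s 0" by simp
    have lg: "s \<noteq> 0 \<and> mm (a1 E * inverse s) \<and> mm (a2 E * (inverse s)\<^sup>2) \<and> a3 E * (inverse s) ^ 3 \<in> A \<and> large (s\<^sup>2)"
      by (rule dyadic_large[OF n(1) k s_def])
    have "\<exists>x N. N > 0 \<and> large x \<and> on_curve E x (s * x) \<and> inverse x * s\<^sup>2 \<in> A \<and> x * inverse (s\<^sup>2) \<in> A \<and>
      Affine x (s * x) [^]\<^bsub>G\<^esub> (2 * N) = Affine 0 (- a3 E) [^]\<^bsub>G\<^esub> (N::nat)"
      by (rule dichotomy_point[OF 1(2) 2(2) in_F(5,6) \<rho>1 \<rho>2])
        (use d D M num0 int[OF _ 2(3)] vs sK sF lg in auto)
    then show ?thesis unfolding s_def using n(1) by blast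
  qed
  \<comment> \<open>Two consecutive exponents suffice: the quotient of the slopes is 2 times a
    quotient of odd integers, hence in the maximal ideal.\<close>
  obtain n x N where q: "odd n" "N > 0" "large x" "on_curve E x (of_int n / 2 ^ (j + 3) * x)"
      "x * inverse ((of_int n / 2 ^ (j + 3))\<^sup>2) \<in> A"
      "Affine x (of_int n / 2 ^ (j + 3) * x) [^]\<^bsub>G\<^esub> (2 * N) = Affine 0 (- a3 E) [^]\<^bsub>G\<^esub> (N::nat)"
    using step[of "j + 3"] by blast
  obtain n' x' N' where q': "odd n'" "N' > 0" "large x'" "on_curve E x' (of_int n' / 2 ^ (j + 4) * x')"
      "inverse x' * (of_int n' / 2 ^ (j + 4))\<^sup>2 \<in> A"
      "Affine x' (of_int n' / 2 ^ (j + 4) * x') [^]\<^bsub>G\<^esub> (2 * N') = Affine 0 (- a3 E) [^]\<^bsub>G\<^esub> (N'::nat)"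
    using step[of "j + 4"] by auto
  have n0: "n \<noteq> 0" "n' \<noteq> 0" using q(1) q'(1) by auto
  have "mm (2 * (of_int n * inverse (of_int n')))" by (intro mm_even A_intros odd_inverse_in_A q'(1))
  moreover have "2 * (of_int n * inverse (of_int n')) = (of_int n / 2 ^ (j + 3)) * inverse (of_int n' / 2 ^ (j + 4) :: 'a)"
    using n0 by (simp add: field_simps power_add)
  ultimately have "mm ((of_int n / 2 ^ (j + 3)) * inverse (of_int n' / 2 ^ (j + 4)))" by (simp only:)
  then show False
    using two_large_points_impossible[of "of_int n / 2 ^ (j + 3)" "of_int n' / 2 ^ (j + 4)" N x N' x'] q q' n0 by simp
qed

section \<open>Infinite rank\<close>

lemma shift_point_nat_pow:
  fixes E :: "'a::field_char_0 weierstrass_curve"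
  assumes ns: "nonsingular_curve E" and R: "R \<in> rational_points E UNIV"
  shows "shift_point r l t (R [^]\<^bsub>mordell_weil_group E UNIV\<^esub> (n::nat)) =
    shift_point r l t R [^]\<^bsub>mordell_weil_group (shift_curve r l t E) UNIV\<^esub> n"
    and "R [^]\<^bsub>mordell_weil_group E UNIV\<^esub> n \<in> rational_points E UNIV"
proof -
  show closed: "R [^]\<^bsub>mordell_weil_group E UNIV\<^esub> n \<in> rational_points E UNIV" for n :: nat
    by (induction n) (use point_add_closed[OF ns _ R] in \<open>simp_all add: mordell_weil_group_def\<close>)
  show "shift_point r l t (R [^]\<^bsub>mordell_weil_group E UNIV\<^esub> (n::nat)) =
      shift_point r l t R [^]\<^bsub>mordell_weil_group (shift_curve r l t E) UNIV\<^esub> n"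
  proof (induction n)
    case (Suc n)
    have "shift_point r l t (point_add E (R [^]\<^bsub>mordell_weil_group E UNIV\<^esub> n) R) =
        point_add (shift_curve r l t E) (shift_point r l t R [^]\<^bsub>mordell_weil_group (shift_curve r l t E) UNIV\<^esub> n) (shift_point r l t R)"
      unfolding Suc.IH[symmetric] by (rule shift_point_add[OF closed R, symmetric])
    then show ?case by (simp add: mordell_weil_group_def)
  qed (simp add: mordell_weil_group_def)
qed

theorem theorem5p3:
  fixes K :: "'a::{alg_closed_field, field_char_0} set"
    and E :: "'a weierstrass_curve"
    and P :: "'a point"
    and \<sigma> :: "'a \<Rightarrow> 'a"
  assumes "number_field K"
    and "algebraic_extension K"
    and "elliptic_curve_over K E"
    and "P \<in> carrier (mordell_weil_group E K)"
    and "P [^]\<^bsub>mordell_weil_group E K\<^esub> (2::nat) \<noteq> \<one>\<^bsub>mordell_weil_group E K\<^esub>"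
    and "P [^]\<^bsub>mordell_weil_group E K\<^esub> (3::nat) \<noteq> \<one>\<^bsub>mordell_weil_group E K\<^esub>"
    and "\<sigma> \<in> galois_group K"
  shows "abelian_rank (mordell_weil_group E (fixed_field \<sigma>)) = \<infinity>"
proof (rule ccontr)
  assume rank: "abelian_rank (mordell_weil_group E (fixed_field \<sigma>)) \<noteq> \<infinity>"
  let ?L = "fixed_field \<sigma>" and ?G = "mordell_weil_group E (fixed_field \<sigma>)"
  have K: "is_subfield K" using assms(1) by (simp add: number_field_def)
  have EK: "{a1 E, a2 E, a3 E, a4 E, a6 E} \<subseteq> K" and ns: "nonsingular_curve E"
    using assms(3) nonsingular_curve_if_discriminant by (auto simp: elliptic_curve_over_def)
  have L: "is_subfield ?L" by (rule subfield_fixed_field[OF assms(7)])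
  have KL: "K \<subseteq> ?L" using galois_groupD(10)[OF assms(7)] by (auto simp: fixed_field_def)
  have two: "point_add E P P \<noteq> Infinity" and three: "point_add E (point_add E P P) P \<noteq> Infinity"
    using assms(5,6) by (simp_all add: mordell_weil_group_def numeral_eq_Suc)
  obtain x0 y0 where P: "P = Affine x0 y0" using two by (cases P) auto
  have P_in: "x0 \<in> K" "y0 \<in> K" "on_curve E x0 y0"
    using assms(4) by (auto simp: P mordell_weil_group_def Affine_in_rational_points)
  define \<psi> where "\<psi> = 2 * y0 + a1 E * x0 + a3 E"
  have \<psi>: "\<psi> \<noteq> 0" using two by (auto simp: P \<psi>_def)
  \<comment> \<open>The slope of the tangent at \<open>P\<close>; removing it makes the new tangent
    horizontal, that is \<open>a4 = 0\<close>.\<close>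
  define l where "l = (3 * x0\<^sup>2 + 2 * a2 E * x0 + a4 E - a1 E * y0) / \<psi>"
  have l\<psi>: "l * \<psi> = 3 * x0\<^sup>2 + 2 * a2 E * x0 + a4 E - a1 E * y0" using \<psi> by (simp add: l_def)
  have EKs: "a1 E \<in> K" "a2 E \<in> K" "a3 E \<in> K" "a4 E \<in> K" "a6 E \<in> K" using EK by auto
  have lK: "l \<in> K" unfolding l_def \<psi>_def by (intro is_subfieldD[OF K] EKs P_in)
  let ?E = "shift_curve x0 l y0 E"
  have EK': "a1 ?E \<in> K" "a2 ?E \<in> K" "a3 ?E \<in> K"
    unfolding shift_curve_simps by (intro is_subfieldD[OF K] EKs P_in lK)+
  have a4: "a4 ?E = 0" using l\<psi> unfolding \<psi>_def shift_curve_simps by Groebner_Basis.algebra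
  have a6: "a6 ?E = 0" using P_in(3) unfolding on_curve_def shift_curve_simps by Groebner_Basis.algebra
  have a3: "a3 ?E \<noteq> 0" using \<psi> unfolding \<psi>_def shift_curve_simps by (simp add: algebra_simps)
  \<comment> \<open>If the new \<open>a2\<close> vanished, the duplication formula would give
    \<open>2P\<close> the abscissa of \<open>P\<close> and the ordinate of \<open>- P\<close>, so
    \<open>3P\<close> would be \<open>O\<close>.\<close>
  have a2: "a2 ?E \<noteq> 0"
  proof
    assume "a2 ?E = 0"
    then have x: "l\<^sup>2 + a1 E * l - a2 E - x0 - x0 = x0" unfolding shift_curve_simps by Groebner_Basis.algebra
    have "y0 + y0 + a1 E * x0 + a3 E \<noteq> 0" using \<psi> unfolding \<psi>_def mult_2 .
    then have "point_add E P P = Affine x0 (- (l + a1 E) * x0 - (y0 - l * x0) - a3 E)"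
      unfolding P point_add.simps Let_def
      by (simp only: simp_thms not_False_eq_True if_True if_False l_def[unfolded \<psi>_def, symmetric] x)
    moreover have "- (l + a1 E) * x0 - (y0 - l * x0) - a3 E + y0 + a1 E * x0 + a3 E = 0" by Groebner_Basis.algebra
    ultimately show False using three unfolding P by simp
  qed
  have cg: "comm_group ?G" by (rule comm_group_mordell_weil[OF L _ ns]) (use EK KL in blast)
  then interpret comm_group ?G .
  obtain S where S: "finite S" "S \<subseteq> carrier ?G"
    "\<And>R. R \<in> carrier ?G \<Longrightarrow> \<exists>N>0. \<forall>H. subgroup H ?G \<longrightarrow> S \<subseteq> H \<longrightarrow> R [^]\<^bsub>?G\<^esub> (N::nat) \<in> H"
    using finite_rank_hull[OF cg rank] by (elim exE conjE) (rule that, assumption+, erule bspec)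
  \<comment> \<open>Coordinates of the points in \<open>S\<close>, together with the data of the
    curve and of the translation, so that a field containing \<open>X\<close> is respected by the
    passage between the two curves.\<close>
  define X where "X = (\<Union>Q\<in>S. set_point Q) \<union> {a1 E, a2 E, a3 E, a4 E, a6 E, x0, l, y0}"
  have "finite (set_point Q)" for Q :: "'a point" by (cases Q) auto
  then have "finite X" using S(1) by (simp add: X_def)
  moreover have "\<exists>N>0. R [^]\<^bsub>mordell_weil_group ?E UNIV\<^esub> (N::nat) \<in> rational_points ?E F"
    if F: "is_subfield F" and XF: "X \<subseteq> F" and R: "R \<in> rational_points ?E ?L" for F R
  proof -
    \<comment> \<open>The group in question consists of points over \<open>?L\<close>, so its
      subgroup is formed with \<open>F \<inter> ?L\<close> rather than with
      \<open>F\<close>.\<close>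
    have FL: "is_subfield (F \<inter> ?L)" using F L by (auto simp: is_subfield_def)
    have EF: "{a1 E, a2 E, a3 E, a4 E, a6 E} \<subseteq> F \<inter> ?L" using XF EK KL by (auto simp: X_def)
    have sub: "subgroup (rational_points E (F \<inter> ?L)) ?G"
    proof (rule subgroupI)
      show "rational_points E (F \<inter> ?L) \<subseteq> carrier ?G"
        using rational_points_mono[of "F \<inter> ?L" ?L E] by (simp add: mordell_weil_group_def)
      show "rational_points E (F \<inter> ?L) \<noteq> {}" using Infinity_in_rational_points by blast
    next
      fix Q assume Q: "Q \<in> rational_points E (F \<inter> ?L)"
      have "inv\<^bsub>?G\<^esub> Q = point_neg E Q"
        by (rule inv_equality) (use Q point_neg_rational[OF FL EF Q] rational_points_mono[of "F \<inter> ?L" ?L E] point_add_neg(1)[of E Q]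
          in \<open>auto simp: mordell_weil_group_def\<close>)
      then show "inv\<^bsub>?G\<^esub> Q \<in> rational_points E (F \<inter> ?L)" using point_neg_rational[OF FL EF Q] by simp
    next
      fix Q Q' assume "Q \<in> rational_points E (F \<inter> ?L)" "Q' \<in> rational_points E (F \<inter> ?L)"
      then show "Q \<otimes>\<^bsub>?G\<^esub> Q' \<in> rational_points E (F \<inter> ?L)"
        using point_add_rational[OF FL EF ns] by (simp add: mordell_weil_group_def)
    qed
    have SH: "S \<subseteq> rational_points E (F \<inter> ?L)"
    proof
      fix Q assume Q: "Q \<in> S"
      then have "set_point Q \<subseteq> F" using XF by (auto simp: X_def)
      moreover have "Q \<in> rational_points E ?L" using S(2) Q by (auto simp: mordell_weil_group_def)
      ultimately show "Q \<in> rational_points E (F \<inter> ?L)" by (cases Q) (auto simp: Affine_in_rational_points)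
    qed
    obtain R0 where R0: "R0 \<in> rational_points E ?L" "R = shift_point x0 l y0 R0"
    proof (cases R)
      case Infinity
      then show ?thesis using that[of Infinity] by simp
    next
      case (Affine x y)
      have xy: "x \<in> ?L" "y \<in> ?L" and oc: "on_curve ?E x y" using R by (auto simp: Affine Affine_in_rational_points)
      have "x0 \<in> ?L" "l \<in> ?L" "y0 \<in> ?L" using P_in lK KL by auto
      with xy have "x + x0 \<in> ?L" "y + l * x + y0 \<in> ?L" by (simp_all add: is_subfieldD(3,4)[OF L])
      moreover have "on_curve E (x + x0) (y + l * x + y0)"
        using on_curve_shift[of x0 l y0 E "x + x0" "y + l * x + y0"] oc by simp
      ultimately show ?thesis
        using that[of "Affine (x + x0) (y + l * x + y0)"] by (simp add: Affine Affine_in_rational_points)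
    qed
    then have R0U: "R0 \<in> rational_points E UNIV" using rational_points_mono[of ?L UNIV E] by auto
    obtain N :: nat where N: "N > 0" "R0 [^]\<^bsub>?G\<^esub> N \<in> rational_points E (F \<inter> ?L)"
      using S(3)[of R0] R0(1) sub SH by (auto simp: mordell_weil_group_def)
    define T where "T = R0 [^]\<^bsub>mordell_weil_group E UNIV\<^esub> N"
    have T: "T \<in> rational_points E (F \<inter> ?L)" using N(2) unfolding T_def nat_pow_mordell_weil[of E ?L] .
    have "shift_point x0 l y0 T \<in> rational_points ?E F"
    proof (cases T)
      case (Affine x y)
      have "x \<in> F" "y \<in> F" "on_curve E x y" using T by (auto simp: Affine Affine_in_rational_points)
      moreover have "x0 \<in> F" "l \<in> F" "y0 \<in> F" using XF by (auto simp: X_def)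
      ultimately show ?thesis
        using is_subfieldD(4,7)[OF F] by (simp add: Affine Affine_in_rational_points on_curve_shift)
    qed simp
    moreover have "shift_point x0 l y0 T = R [^]\<^bsub>mordell_weil_group ?E UNIV\<^esub> N"
      unfolding T_def R0(2) by (rule shift_point_nat_pow(1)[OF ns R0U])
    ultimately show ?thesis using N(1) by auto
  qed
  ultimately show False
    by (rule finite_hull_impossible[OF algebraic_over_number_field[OF assms(1,2)] K assms(7) EK' a4 a6 a2 a3
        nonsingular_curve_shift[OF ns]])
qed

end
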